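(* Let $(K,v)$ be a valued field of positive characteristic $p$ and finite rank $r$. Assume additionally that $(K,v)$ has finite $p$-degree and $d(K^{1/p}|K,v)=p^m$. Then $\mathrm{ndd}^*_i(K,v)$ is finite for every natural number $i$. More precisely, $$\mathrm{ndd}^*_i(K,v)\leq r+im .$$
   Context: Valuations are written additively; $vK$ is the value group, $Kv$ the residue field, $\widetilde{vK}$ the divisible hull of $vK$. An extension of $v$ from $K$ to its algebraic closure $\tilde K$ is fixed. The rank of $(K,v)$, if finite, is the number of proper convex subgroups of $vK$. $K^{1/p}=\{c^{1/p}\mid c\in K\}$; $K$ has finite $p$-degree if $[K^{1/p}:K]=[K:K^p]$ is finite. An algebraic extension $(L|K,v)$ is a uv--extension if the extension of $v$ from $K$ to $L$ is unique (every purely inseparable algebraic extension is one). For a finite uv--extension the defect is $d(L|K,v)=\frac{[L:K]}{(vL:vK)[Lv:Kv]}$, a power of $p=\mathrm{char}\,Kv$. For $a\in\tilde K$, put $v(a-K)=\{v(a-c)\mid c\in K\}$; $a$ is weakly immediate over $K$ if $v(a-K)$ has no maximal element. The distance $\mathrm{dist}(a,K)$ is the cut in $\widetilde{vK}$ whose lower cut set is the smallest initial segment of $\widetilde{vK}$ containing $v(a-K)\cap\widetilde{vK}$. Two distances are equal modulo $\widetilde{vK}$ if the lower cut set of one is obtained from that of the other by adding a fixed $\alpha\in\widetilde{vK}$ to all its elements. For a natural number $i$, $\mathrm{ndd}^*_i(K,v)$ denotes the number of distances $\mathrm{dist}(a,K)$, distinct modulo $\widetilde{vK}$, of elements $a\in\tilde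 K\setminus K$ such that $[K(a):K]\leq p^i$, $(K(a)|K,v)$ is a uv--extension, and $a$ is weakly immediate over $K$. *)

theory Defs
  imports "HOL-Algebra.Algebra" "HOL-Library.Extended"
begin

text \<open>
  Throughout, \<open>L\<close> is an algebraic closure of its subfield \<open>K\<close>, and \<open>v\<close> is the fixed extension of
  the valuation to \<open>L\<close>; all algebraic extensions of \<open>K\<close> are subfields \<open>F\<close> of \<open>L\<close>.
  Valuations are additive with values in \<open>\<Gamma> \<union> {\<infinity>}\<close> for a linearly ordered abelian group \<open>\<Gamma>\<close>;
  the value \<open>-\<infinity>\<close> provided by the type of extended values never occurs.
\<close>

definition ring_char :: "('a, 'b) ring_scheme \<Rightarrow> nat" where
  "ring_char R = group.ord (add_monoid R) \<one>\<^bsub>R\<^esub>"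

definition valuation_on ::
    "('a, 'b) ring_scheme \<Rightarrow> 'a set \<Rightarrow> ('a \<Rightarrow> 'g :: linordered_ab_group_add extended) \<Rightarrow> bool" where
  "valuation_on L F v \<longleftrightarrow>
     (\<forall>x\<in>F. v x \<noteq> Minf \<and> (v x = Pinf \<longleftrightarrow> x = \<zero>\<^bsub>L\<^esub>)) \<and>
     (\<forall>x\<in>F. \<forall>y\<in>F. v (x \<otimes>\<^bsub>L\<^esub> y) = v x + v y \<and> min (v x) (v y) \<le> v (x \<oplus>\<^bsub>L\<^esub> y))"

definition value_group :: "('a \<Rightarrow> 'g extended) \<Rightarrow> 'a set \<Rightarrow> 'g set" where
  "value_group v F = {g. \<exists>x\<in>F. v x = Fin g}"

definition valuation_ring ::
    "('a, 'b) ring_scheme \<Rightarrow> ('a \<Rightarrow> 'g :: linordered_ab_group_add extended) \<Rightarrow> 'a set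
      \<Rightarrow> ('a, 'b) ring_scheme" where
  "valuation_ring L v F = L\<lparr>carrier := {x \<in> F. 0 \<le> v x}\<rparr>"

definition valuation_ideal :: "('a \<Rightarrow> 'g :: linordered_ab_group_add extended) \<Rightarrow> 'a set \<Rightarrow> 'a set" where
  "valuation_ideal v F = {x \<in> F. 0 < v x}"

definition residue_field ::
    "('a, 'b) ring_scheme \<Rightarrow> ('a \<Rightarrow> 'g :: linordered_ab_group_add extended) \<Rightarrow> 'a set
      \<Rightarrow> 'a set ring" where
  "residue_field L v F = valuation_ring L v F Quot valuation_ideal v F"

text \<open>The image of \<open>Kv\<close> under its natural embedding into \<open>Fv\<close>, for \<open>K \<subseteq> F\<close>.\<close>

definition residue_subfield ::
    "('a, 'b) ring_scheme \<Rightarrow> ('a \<Rightarrow> 'g :: linordered_ab_group_add extended) \<Rightarrow> 'a set \<Rightarrow> 'a set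
      \<Rightarrow> 'a set set" where
  "residue_subfield L v F K =
     (\<lambda>x. valuation_ideal v F +>\<^bsub>valuation_ring L v F\<^esub> x) ` carrier (valuation_ring L v K)"

definition extension_degree :: "('a, 'b) ring_scheme \<Rightarrow> 'a set \<Rightarrow> 'a set \<Rightarrow> nat" where
  "extension_degree L K F = (ring.dim L over K) F"

definition ramification_index :: "('a \<Rightarrow> 'g :: linordered_ab_group_add extended) \<Rightarrow> 'a set \<Rightarrow> 'a set \<Rightarrow> nat" where
  "ramification_index v K F = card ((\<lambda>g. (+) g ` value_group v K) ` value_group v F)"

definition inertia_degree ::
    "('a, 'b) ring_scheme \<Rightarrow> ('a \<Rightarrow> 'g :: linordered_ab_group_add extended) \<Rightarrow> 'a set \<Rightarrow> 'a set
      \<Rightarrow> nat" where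
  "inertia_degree L v K F =
     extension_degree (residue_field L v F) (residue_subfield L v F K) (carrier (residue_field L v F))"

text \<open>Meant for finite extensions to which \<open>v\<close> extends uniquely from \<open>K\<close>.\<close>

definition defect ::
    "('a, 'b) ring_scheme \<Rightarrow> ('a \<Rightarrow> 'g :: linordered_ab_group_add extended) \<Rightarrow> 'a set \<Rightarrow> 'a set
      \<Rightarrow> rat" where
  "defect L v K F =
     of_nat (extension_degree L K F) /
     (of_nat (ramification_index v K F) * of_nat (inertia_degree L v K F))"

text \<open>
  Comparing only with valuations \<open>w\<close> that have values in the same group \<open>\<Gamma>\<close> and agree with \<open>v\<close> on
  \<open>K\<close> loses nothing: if \<open>F\<close> is algebraic over \<open>K\<close>, every extension of \<open>v\<close> from \<open>K\<close> to \<open>F\<close> is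
  equivalent to exactly one with values in the divisible hull of \<open>vK\<close>, which is contained in \<open>\<Gamma>\<close>.
\<close>

definition uv_extension ::
    "('a, 'b) ring_scheme \<Rightarrow> ('a \<Rightarrow> 'g :: linordered_ab_group_add extended) \<Rightarrow> 'a set \<Rightarrow> 'a set
      \<Rightarrow> bool" where
  "uv_extension L v K F \<longleftrightarrow>
     (\<forall>w :: 'a \<Rightarrow> 'g extended.
        valuation_on L F w \<and> (\<forall>x\<in>K. w x = v x) \<longrightarrow> (\<forall>x\<in>F. w x = v x))"

definition proper_convex_subgroups :: "'g :: linordered_ab_group_add set \<Rightarrow> 'g set set" where
  "proper_convex_subgroups G =
     {H. H \<subset> G \<and> 0 \<in> H \<and> (\<forall>x\<in>H. \<forall>y\<in>H. x - y \<in> H) \<and>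
         (\<forall>x\<in>H. \<forall>z\<in>H. \<forall>y\<in>G. x \<le> y \<and> y \<le> z \<longrightarrow> y \<in> H)}"

definition has_finite_rank ::
    "('a \<Rightarrow> 'g :: linordered_ab_group_add extended) \<Rightarrow> 'a set \<Rightarrow> nat \<Rightarrow> bool" where
  "has_finite_rank v K r \<longleftrightarrow>
     finite (proper_convex_subgroups (value_group v K)) \<and>
     card (proper_convex_subgroups (value_group v K)) = r"

text \<open>
  The divisible hull of \<open>vK\<close>, formed inside \<open>\<Gamma>\<close>. It is the full divisible hull, because
  \<open>vL \<subseteq> \<Gamma>\<close> is divisible when \<open>L\<close> is algebraically closed.
\<close>

definition divisible_hull :: "'g :: linordered_ab_group_add set \<Rightarrow> 'g set" where
  "divisible_hull G = {g. \<exists>n::nat>0. (\<Sum>i<n. g) \<in> G}"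

definition root_field :: "('a, 'b) ring_scheme \<Rightarrow> 'a set \<Rightarrow> nat \<Rightarrow> 'a set" where
  "root_field L K p = {x \<in> carrier L. x [^]\<^bsub>L\<^esub> p \<in> K}"

definition finite_p_degree :: "('a, 'b) ring_scheme \<Rightarrow> 'a set \<Rightarrow> nat \<Rightarrow> bool" where
  "finite_p_degree L K p \<longleftrightarrow> ring.finite_dimension L K (root_field L K p)"

definition adjoin :: "('a, 'b) ring_scheme \<Rightarrow> 'a set \<Rightarrow> 'a \<Rightarrow> 'a set" where
  "adjoin L K a = generate_field L (insert a K)"

text \<open>The set \<open>v(a - K)\<close>; it contains \<open>\<infinity>\<close> if and only if \<open>a \<in> K\<close>.\<close>

definition difference_values ::
    "('a, 'b) ring_scheme \<Rightarrow> ('a \<Rightarrow> 'g :: linordered_ab_group_add extended) \<Rightarrow> 'a set \<Rightarrow> 'a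
      \<Rightarrow> 'g extended set" where
  "difference_values L v K a = {v (a \<ominus>\<^bsub>L\<^esub> c) |c. c \<in> K}"

definition weakly_immediate ::
    "('a, 'b) ring_scheme \<Rightarrow> ('a \<Rightarrow> 'g :: linordered_ab_group_add extended) \<Rightarrow> 'a set \<Rightarrow> 'a
      \<Rightarrow> bool" where
  "weakly_immediate L v K a \<longleftrightarrow>
     \<not> (\<exists>x\<in>difference_values L v K a. \<forall>y\<in>difference_values L v K a. y \<le> x)"

definition initial_segment :: "'g :: linorder set \<Rightarrow> 'g set \<Rightarrow> bool" where
  "initial_segment G S \<longleftrightarrow> S \<subseteq> G \<and> (\<forall>x\<in>S. \<forall>y\<in>G. y \<le> x \<longrightarrow> y \<in> S)"

text \<open>
  A cut in the divisible hull is determined by its lower cut set; the distance of \<open>a\<close> from \<open>K\<close>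
  is represented by that set.
\<close>

definition distance ::
    "('a, 'b) ring_scheme \<Rightarrow> ('a \<Rightarrow> 'g :: linordered_ab_group_add extended) \<Rightarrow> 'a set \<Rightarrow> 'a
      \<Rightarrow> 'g set" where
  "distance L v K a =
     \<Inter>{S. initial_segment (divisible_hull (value_group v K)) S \<and>
          {g \<in> divisible_hull (value_group v K). Fin g \<in> difference_values L v K a} \<subseteq> S}"

definition equal_modulo :: "'g :: linordered_ab_group_add set \<Rightarrow> ('g set \<times> 'g set) set" where
  "equal_modulo G = {(D, E). \<exists>\<alpha>\<in>G. E = (+) \<alpha> ` D}"

definition ndd_distances ::
    "('a, 'b) ring_scheme \<Rightarrow> ('a \<Rightarrow> 'g :: linordered_ab_group_add extended) \<Rightarrow> 'a set \<Rightarrow> nat \<Rightarrow> nat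
      \<Rightarrow> 'g set set" where
  "ndd_distances L v K p i =
     {distance L v K a |a. a \<in> carrier L - K \<and> extension_degree L K (adjoin L K a) \<le> p ^ i \<and>
        uv_extension L v K (adjoin L K a) \<and> weakly_immediate L v K a}"

definition ndd_classes ::
    "('a, 'b) ring_scheme \<Rightarrow> ('a \<Rightarrow> 'g :: linordered_ab_group_add extended) \<Rightarrow> 'a set \<Rightarrow> nat \<Rightarrow> nat
      \<Rightarrow> 'g set set set" where
  "ndd_classes L v K p i =
     ndd_distances L v K p i // equal_modulo (divisible_hull (value_group v K))"

text \<open>As a cardinality this is meaningful only together with finiteness of the set of classes.\<close>

definition ndd ::
    "('a, 'b) ring_scheme \<Rightarrow> ('a \<Rightarrow> 'g :: linordered_ab_group_add extended) \<Rightarrow> 'a set \<Rightarrow> nat \<Rightarrow> nat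
      \<Rightarrow> nat" where
  "ndd L v K p i = card (ndd_classes L v K p i)"

end

theory Submission
  imports Defs
begin

text \<open>
  Let \<open>a\<close> be weakly immediate over \<open>K\<close> with \<open>K(a)|K\<close> a uv-extension of degree \<open>n = p^t n'\<close>, \<open>p\<close> not
  dividing \<open>n'\<close>, and let \<open>S\<close> be the initial segment generated by \<open>v(a - K)\<close>. Since all conjugates of
  \<open>a\<close> have the same values \<open>v(a - c)\<close>, the minimal polynomial \<open>f\<close> satisfies \<open>v(f(c)) = n v(a - c)\<close>, so
  in its Taylor expansion at \<open>a\<close> the coefficient of index \<open>j < n\<close> has value above \<open>(n - j)S\<close>. Hence the
  coefficient of index \<open>n - p^t\<close> in the expansion at \<open>c \<in> K\<close> is a unit times \<open>(a - c)^(p^t)\<close> up to a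
  small error, and its \<open>p^t\<close>-th root yields an element of \<open>K^(1/p^t)\<close> closer to \<open>a\<close> than all of \<open>K\<close>,
  unless \<open>S = {x. x < \<delta> + H}\<close> for a convex subgroup \<open>H\<close>. The latter accounts for \<open>r\<close> classes.

  For an element of \<open>K^(1/p^t)\<close>, passing to the last field \<open>K^(1/p^l)\<close> that does not approximate it
  better than \<open>K\<close> and applying the \<open>l\<close>-th power of the Frobenius gives a weakly immediate element of
  \<open>K^(1/p)\<close> whose distance is \<open>p^l S\<close>. It remains to bound the classes coming from \<open>K^(1/p)\<close> by \<open>m\<close>.
  If \<open>w^p \<in> E\<close> and \<open>w\<close> has no best approximation in \<open>E\<close>, then \<open>E(w)|E\<close> is immediate of degree \<open>p\<close> and
  all distances of elements of \<open>E(w)\<close> from \<open>E\<close> lie in one class. Adjoining elements with pairwise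
  distinct classes thus produces an immediate subextension of degree \<open>p^s\<close>, and the fundamental
  inequality over it gives \<open>s \<le> m\<close>.
\<close>


section \<open>Multiples in ordered groups and basic properties of valuations\<close>

text \<open>The factor i in i * m counts the exponents l: they satisfy l < t \<le> i, and for each l
  the cut p^l S runs through at most m classes. Up to translation S is recovered from p^l S because
  translations by elements of the divisible hull can be divided by p^l. The index n - p^t is chosen
  because n choose p^t is prime to p. The precision of the root is governed by \<delta>, the least
  v(a_j)/(n - j) over the Taylor coefficients a_j at a with j < n. If c in K has v(c - a) = \<gamma>
  and q = p^t, the root approximates a to at least ((q - 1)\<gamma> + \<delta>)/q. When no choice of
  \<gamma> takes this beyond S, one can move up inside S by a fixed fraction of any gap below
  \<delta>, and this forces S to end just below \<delta> + H for a convex subgroup H. For K^(1/p)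
  the obstacle is that a step E(w)|E is controlled over E whereas distances are measured from K. The
  chain of extensions therefore carries the distances of all its elements from K along.\<close>

definition nmul :: "nat \<Rightarrow> 'g::comm_monoid_add \<Rightarrow> 'g" where
  "nmul n x = (\<Sum>i<n. x)"

lemma nmul_0 [simp]: "nmul 0 x = 0"
  by (simp add: nmul_def)

lemma nmul_Suc [simp]: "nmul (Suc n) x = x + nmul n x"
  by (simp add: nmul_def add.commute)

lemma nmul_zero [simp]: "nmul n (0::'g::comm_monoid_add) = 0"
  by (induction n) auto

lemma nmul_add_left: "nmul (m + n) x = nmul m x + nmul n x"
  by (induction m) (auto simp: add.assoc)

lemma nmul_add_right: "nmul n (x + y) = nmul n x + nmul n y"
  by (induction n) (auto simp: ac_simps)

lemma nmul_mult: "nmul (m * n) x = nmul m (nmul n x)"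
  by (induction m) (auto simp: nmul_add_left)

lemma nmul_Fin: "nmul n (Fin g) = Fin (nmul n g)"
  by (induction n) (auto simp: zero_extended_def)

lemma nmul_minus: "nmul n (- x) = - nmul n (x::'g::ab_group_add)"
  by (induction n) auto

lemma nmul_diff: "nmul n (x - y) = nmul n x - nmul n (y::'g::ab_group_add)"
  by (induction n) (auto simp: algebra_simps)

lemma nmul_diff_left: "n \<le> m \<Longrightarrow> nmul (m - n) x = nmul m x - nmul n (x::'g::ab_group_add)"
  by (metis add_diff_cancel_right' le_add_diff_inverse2 nmul_add_left)

lemma nmul_mono: "x \<le> y \<Longrightarrow> nmul n x \<le> nmul n (y::'g::ordered_comm_monoid_add)"
  by (induction n) (auto intro: add_mono)

lemma nmul_strict_mono: "x < y \<Longrightarrow> n > 0 \<Longrightarrow> nmul n x < nmul n (y::'g::linordered_ab_group_add)"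
proof (induction n)
  case (Suc n)
  then show ?case by (cases n) (auto intro: add_strict_mono)
qed simp

lemma nmul_less_iff: "n > 0 \<Longrightarrow> nmul n x < nmul n y \<longleftrightarrow> x < (y::'g::linordered_ab_group_add)"
  using nmul_strict_mono[of x y n] nmul_mono[of y x n] by (metis leD not_le_imp_less)

lemma nmul_le_iff: "n > 0 \<Longrightarrow> nmul n x \<le> nmul n y \<longleftrightarrow> x \<le> (y::'g::linordered_ab_group_add)"
  by (metis nmul_less_iff not_le)

lemma nmul_eq_iff: "n > 0 \<Longrightarrow> nmul n x = nmul n y \<longleftrightarrow> x = (y::'g::linordered_ab_group_add)"
  by (metis nmul_less_iff linorder_neq_iff)

lemma nmul_nonneg: "0 \<le> x \<Longrightarrow> 0 \<le> nmul n (x::'g::ordered_comm_monoid_add)"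
  using nmul_mono[of 0 x n] by simp

text \<open>Affine functions of distinct slopes have a strictly monotone difference; all later
  comparisons of terms \<open>\<beta> + nmul j \<gamma>\<close> rest on this.\<close>

lemma nmul_left_strict_mono:
  assumes "i < j" "x < (y::'g::linordered_ab_group_add)"
  shows "nmul j x - nmul i x < nmul j y - nmul i y"
proof -
  have "nmul (j - i) x < nmul (j - i) y" using assms by (intro nmul_strict_mono) auto
  then show ?thesis using assms by (simp add: nmul_diff_left)
qed

lemma Fin_le_add_cancel: "Fin (a::'g::linordered_ab_group_add) + x \<le> Fin a + y \<longleftrightarrow> x \<le> y"
  by (cases x; cases y) auto

locale valued_field = field L for L :: "('a, 'b) ring_scheme" (structure) +
  fixes v :: "'a \<Rightarrow> 'g::linordered_ab_group_add extended"
  assumes val: "valuation_on L (carrier L) v"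
begin

lemma v_not_Minf [simp]: "x \<in> carrier L \<Longrightarrow> v x \<noteq> Minf"
  using val by (auto simp: valuation_on_def)

lemma v_Pinf_iff [simp]: "x \<in> carrier L \<Longrightarrow> v x = Pinf \<longleftrightarrow> x = \<zero>"
  using val by (auto simp: valuation_on_def)

lemma v_zero [simp]: "v \<zero> = Pinf"
  by simp

lemma v_mult: "x \<in> carrier L \<Longrightarrow> y \<in> carrier L \<Longrightarrow> v (x \<otimes> y) = v x + v y"
  using val by (auto simp: valuation_on_def)

lemma v_add_ge: "x \<in> carrier L \<Longrightarrow> y \<in> carrier L \<Longrightarrow> min (v x) (v y) \<le> v (x \<oplus> y)"
  using val by (auto simp: valuation_on_def)

lemma v_FinE:
  assumes "x \<in> carrier L" "x \<noteq> \<zero>"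
  obtains g where "v x = Fin g"
  using assms v_not_Minf[of x] v_Pinf_iff[of x] by (cases "v x") auto

lemma v_one [simp]: "v \<one> = 0"
proof -
  obtain g where g: "v \<one> = Fin g" using v_FinE one_closed one_not_zero by blast
  have "v \<one> = v \<one> + v \<one>" using v_mult[of \<one> \<one>] by simp
  then show ?thesis using g by (auto simp: zero_extended_def)
qed

lemma v_minus [simp]: "x \<in> carrier L \<Longrightarrow> v (\<ominus> x) = v x"
proof -
  assume x: "x \<in> carrier L"
  obtain g where g: "v (\<ominus> \<one>) = Fin g"
    using v_FinE[of "\<ominus> \<one>"] by (metis a_inv_closed add.inv_eq_1_iff one_closed one_not_zero)
  have "v (\<ominus> \<one> \<otimes> \<ominus> \<one>) = 0" by (simp add: l_minus)
  \<comment> \<open>An ordered abelian group is torsion-free, so twice the value of -1 being zero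
    makes that value zero.\<close>
  then have "g + g = 0" using v_mult[of "\<ominus> \<one>" "\<ominus> \<one>"] g by (auto simp: zero_extended_def)
  then have "v (\<ominus> \<one>) = 0" using g by (simp add: zero_extended_def)
  then show ?thesis using v_mult[of "\<ominus> \<one>" x] x by (simp add: l_minus)
qed

lemma v_diff_ge: "x \<in> carrier L \<Longrightarrow> y \<in> carrier L \<Longrightarrow> min (v x) (v y) \<le> v (x \<ominus> y)"
  using v_add_ge[of x "\<ominus> y"] by (simp add: a_minus_def)

lemma v_diff_commute: "x \<in> carrier L \<Longrightarrow> y \<in> carrier L \<Longrightarrow> v (x \<ominus> y) = v (y \<ominus> x)"
  using v_minus[of "x \<ominus> y"] by (simp add: minus_add minus_minus a_minus_def a_comm)

lemma v_add_ge': "B \<le> v x \<Longrightarrow> B \<le> v y \<Longrightarrow> x \<in> carrier L \<Longrightarrow> y \<in> carrier L \<Longrightarrow> B \<le> v (x \<oplus> y)"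
  using v_add_ge[of x y] by (metis min_def order_trans)

lemma v_add_gr: "B < v x \<Longrightarrow> B < v y \<Longrightarrow> x \<in> carrier L \<Longrightarrow> y \<in> carrier L \<Longrightarrow> B < v (x \<oplus> y)"
  using v_add_ge[of x y] by (metis min_def order_less_le_trans)

lemma v_diff_ge': "B \<le> v x \<Longrightarrow> B \<le> v y \<Longrightarrow> x \<in> carrier L \<Longrightarrow> y \<in> carrier L \<Longrightarrow> B \<le> v (x \<ominus> y)"
  using v_diff_ge[of x y] by (metis min_def order_trans)

lemma v_diff_gr: "B < v x \<Longrightarrow> B < v y \<Longrightarrow> x \<in> carrier L \<Longrightarrow> y \<in> carrier L \<Longrightarrow> B < v (x \<ominus> y)"
  using v_diff_ge[of x y] by (metis min_def order_less_le_trans)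

lemma v_add_eq: 
  assumes "v x < v y" "x \<in> carrier L" "y \<in> carrier L"
  shows "v (x \<oplus> y) = v x"
proof (rule antisym)
  show "v x \<le> v (x \<oplus> y)" using assms v_add_ge'[of "v x" x y] by auto
  show "v (x \<oplus> y) \<le> v x"
  proof (rule ccontr)
    assume "\<not> ?thesis"
    then have "v x < v ((x \<oplus> y) \<ominus> y)" using assms by (intro v_diff_gr) auto
    moreover have "(x \<oplus> y) \<ominus> y = x" using assms by algebra
    ultimately show False by simp
  qed
qed

lemma v_eq_of_close:
  assumes "v x < v (x \<ominus> y)" "x \<in> carrier L" "y \<in> carrier L"
  shows "v y = v x"
proof -
  have "v (x \<oplus> (\<ominus> (x \<ominus> y))) = v x" using assms by (intro v_add_eq) (auto simp: v_diff_commute)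
  moreover have "x \<oplus> (\<ominus> (x \<ominus> y)) = y" using assms by algebra
  ultimately show ?thesis by simp
qed

text \<open>Here \<open>nmul\<close> acts on extended values, so x = 0 is covered together with the
  nonzero elements.\<close>

lemma v_pow: "x \<in> carrier L \<Longrightarrow> v (x [^] (n::nat)) = nmul n (v x)"
  by (induction n) (auto simp: v_mult add.commute)

lemma v_inv: 
  assumes "x \<in> carrier L" "x \<noteq> \<zero>" 
  shows "v (inv x) = - v x"
proof -
  have i: "inv x \<in> carrier L" "inv x \<otimes> x = \<one>" using assms by (auto simp: field_Units)
  obtain g where g: "v x = Fin g" using v_FinE assms by blast
  have "v (inv x) + v x = 0" using v_mult[of "inv x" x] i assms by simp
  then have "v (inv x) + Fin g = Fin 0" using g by (simp add: zero_extended_def)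
  then have "v (inv x) = Fin (- g)"
    by (cases "v (inv x)") (auto simp: eq_neg_iff_add_eq_0)
  then show ?thesis using g by simp
qed

end

section \<open>Taylor expansion of polynomials given as coefficient lists\<close>

context cring
begin

text \<open>The constant term comes first, in reverse to the library's \<open>eval\<close>. Trailing
  zeros are allowed, so the length of a list only bounds the degree.\<close>

primrec peval :: "'a list \<Rightarrow> 'a \<Rightarrow> 'a" where
  "peval [] x = \<zero>"
| "peval (a # as) x = a \<oplus> x \<otimes> peval as x"

text \<open>Product rule on the Horner form: the derivative of a + X b(X) is b + X b'.\<close>

primrec pder :: "'a list \<Rightarrow> 'a \<Rightarrow> 'a" where
  "pder [] x = \<zero>"
| "pder (a # as) x = peval as x \<oplus> x \<otimes> pder as x"

text \<open>\<open>comb c t bs\<close> lists the coefficients of \<open>c + (X + t) b(X)\<close>, lowest degree first, and \<open>shift t as\<close>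
  those of \<open>a(X + t)\<close>, i.e. the Taylor coefficients at \<open>t\<close>.\<close>

fun comb :: "'a \<Rightarrow> 'a \<Rightarrow> 'a list \<Rightarrow> 'a list" where
  "comb c t [] = [c]"
| "comb c t (b # bs) = (c \<oplus> t \<otimes> b) # comb b t bs"

primrec shift :: "'a \<Rightarrow> 'a list \<Rightarrow> 'a list" where
  "shift t [] = []"
| "shift t (a # as) = comb a t (shift t as)"

lemma peval_closed [simp]: "set as \<subseteq> carrier R \<Longrightarrow> x \<in> carrier R \<Longrightarrow> peval as x \<in> carrier R"
  by (induction as) auto

lemma pder_closed [simp]: "set as \<subseteq> carrier R \<Longrightarrow> x \<in> carrier R \<Longrightarrow> pder as x \<in> carrier R"
  by (induction as) auto

lemma length_comb [simp]: "length (comb c t bs) = Suc (length bs)"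
  by (induction c t bs rule: comb.induct) auto

lemma length_shift [simp]: "length (shift t as) = length as"
  by (induction as) auto

lemma comb_subring:
  assumes "subring E R" "c \<in> E" "t \<in> E" "set bs \<subseteq> E"
  shows "set (comb c t bs) \<subseteq> E"
  using assms(2-) by (induction c t bs rule: comb.induct) (auto simp: subringE[OF assms(1)])

lemma shift_subring:
  assumes "subring E R" "t \<in> E" "set as \<subseteq> E"
  shows "set (shift t as) \<subseteq> E"
  using assms by (induction as) (auto simp: comb_subring)

lemma shift_closed [simp]:
  "t \<in> carrier R \<Longrightarrow> set as \<subseteq> carrier R \<Longrightarrow> set (shift t as) \<subseteq> carrier R"
  by (rule shift_subring[OF carrier_is_subring])

lemma comb_closed [simp]:
  "c \<in> carrier R \<Longrightarrow> t \<in> carrier R \<Longrightarrow> set as \<subseteq> carrier R \<Longrightarrow> set (comb c t as) \<subseteq> carrier R"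
  by (rule comb_subring[OF carrier_is_subring])

lemma peval_subring:
  assumes "subring E R" "x \<in> E" "set as \<subseteq> E"
  shows "peval as x \<in> E"
  using assms by (induction as) (auto simp: subringE[OF assms(1)])

lemma peval_comb:
  assumes "c \<in> carrier R" "t \<in> carrier R" "x \<in> carrier R" "set bs \<subseteq> carrier R"
  shows "peval (comb c t bs) x = c \<oplus> (x \<oplus> t) \<otimes> peval bs x"
  using assms
proof (induction c t bs rule: comb.induct)
  case (2 c t b bs)
  then have IH: "peval (comb b t bs) x = b \<oplus> (x \<oplus> t) \<otimes> peval bs x" by auto
  define y where "y = peval bs x"
  have y: "y \<in> carrier R" using 2 by (auto simp: y_def)
  show ?case using 2(2-) y by (simp add: IH flip: y_def) algebra
qed simp

lemma peval_shift:
  assumes "t \<in> carrier R" "x \<in> carrier R" "set as \<subseteq> carrier R"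
  shows "peval (shift t as) x = peval as (x \<oplus> t)"
  using assms by (induction as) (auto simp: peval_comb)

lemma pder_comb:
  assumes "c \<in> carrier R" "t \<in> carrier R" "x \<in> carrier R" "set bs \<subseteq> carrier R"
  shows "pder (comb c t bs) x = peval bs x \<oplus> (x \<oplus> t) \<otimes> pder bs x"
  using assms
proof (induction c t bs rule: comb.induct)
  case (2 c t b bs)
  then have IH: "pder (comb b t bs) x = peval bs x \<oplus> (x \<oplus> t) \<otimes> pder bs x" by auto
  define y where "y = peval bs x"
  define z where "z = pder bs x"
  have y: "y \<in> carrier R" "z \<in> carrier R" using 2 by (auto simp: y_def z_def)
  have "peval (comb b t bs) x = b \<oplus> (x \<oplus> t) \<otimes> peval bs x" using 2 by (intro peval_comb) auto
  then show ?case using 2(2-) y by (simp add: IH flip: y_def z_def) algebra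
qed simp

lemma pder_shift:
  assumes "t \<in> carrier R" "x \<in> carrier R" "set as \<subseteq> carrier R"
  shows "pder (shift t as) x = pder as (x \<oplus> t)"
  using assms by (induction as) (auto simp: pder_comb peval_shift)

text \<open>Both sides list the coefficients of c + (X + s + u) d + (X + s)(X + u) b(X), where b has
  coefficients \<open>ds\<close>; this is symmetric in s and u.\<close>

lemma comb_comb:
  assumes "c \<in> carrier R" "s \<in> carrier R" "u \<in> carrier R" "d \<in> carrier R" "set ds \<subseteq> carrier R"
  shows "comb (c \<oplus> u \<otimes> d) s (comb d u ds) = comb (c \<oplus> s \<otimes> d) u (comb d s ds)"
  using assms
proof (induction ds arbitrary: c d)
  case Nil
  then show ?case by simp algebra
next
  case (Cons e ds)
  have "comb (d \<oplus> u \<otimes> e) s (comb e u ds) = comb (d \<oplus> s \<otimes> e) u (comb e s ds)"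
    using Cons by auto
  then show ?case using Cons(2-) by simp algebra
qed

lemma shift_comb:
  assumes "c \<in> carrier R" "s \<in> carrier R" "t \<in> carrier R" "set bs \<subseteq> carrier R"
  shows "shift s (comb c t bs) = comb c (s \<oplus> t) (shift s bs)"
  using assms
proof (induction c t bs rule: comb.induct)
  case (2 c t b bs)
  have IH: "shift s (comb b t bs) = comb b (s \<oplus> t) (shift s bs)" using 2 by auto
  \<comment> \<open>Chosen so that both heads take the form in which \<open>comb_comb\<close> can
    exchange the factors X + s and X + (s + t).\<close>
  define c' where "c' = c \<ominus> s \<otimes> b"
  have c: "c' \<in> carrier R" "c \<oplus> t \<otimes> b = c' \<oplus> (s \<oplus> t) \<otimes> b" "c = c' \<oplus> s \<otimes> b"
    using 2(2-) unfolding c'_def by (auto, algebra, algebra)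
  have "shift s (comb c t (b # bs)) = comb (c' \<oplus> (s \<oplus> t) \<otimes> b) s (comb b (s \<oplus> t) (shift s bs))"
    using 2(2-) c by (simp add: IH)
  also have "\<dots> = comb (c' \<oplus> s \<otimes> b) (s \<oplus> t) (comb b s (shift s bs))"
    using 2(2-) c by (intro comb_comb) auto
  finally show ?case using c by simp
qed simp

lemma shift_shift:
  assumes "s \<in> carrier R" "t \<in> carrier R" "set as \<subseteq> carrier R"
  shows "shift s (shift t as) = shift (s \<oplus> t) as"
  using assms by (induction as) (auto simp: shift_comb)

lemma shift_zero:
  assumes "set as \<subseteq> carrier R"
  shows "shift \<zero> as = as"
proof -
  have "comb c \<zero> bs = c # bs" if "set bs \<subseteq> carrier R" "c \<in> carrier R" for c bs
    using that by (induction bs arbitrary: c) auto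
  then show ?thesis using assms by (induction as) auto
qed

lemma comb_nth_0: "bs \<noteq> [] \<Longrightarrow> comb c t bs ! 0 = c \<oplus> t \<otimes> bs ! 0"
  by (cases bs) auto

lemma comb_nth_Suc:
  "Suc k < length bs \<Longrightarrow> comb c t bs ! Suc k = bs ! k \<oplus> t \<otimes> bs ! Suc k"
proof (induction c t bs arbitrary: k rule: comb.induct)
  case (2 c t b bs)
  show ?case
  proof (cases k)
    case 0
    then show ?thesis using 2 by (auto simp: comb_nth_0)
  next
    case (Suc k')
    then show ?thesis using 2 by auto
  qed
qed simp

lemma comb_nth_last: "bs \<noteq> [] \<Longrightarrow> comb c t bs ! length bs = last bs"
  by (induction c t bs rule: comb.induct) auto

lemma last_comb: "bs \<noteq> [] \<Longrightarrow> last (comb c t bs) = last bs"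
  by (metis comb_nth_last diff_Suc_1 last_conv_nth length_comb length_greater_0_conv zero_less_Suc)

lemma shift_eq_Nil_iff [simp]: "shift t as = [] \<longleftrightarrow> as = []"
  by (metis length_0_conv length_shift)

lemma last_shift: "as \<noteq> [] \<Longrightarrow> last (shift t as) = last as"
  by (induction as) (auto simp: last_comb)

lemma shift_nth_0: 
  assumes "as \<noteq> []" "t \<in> carrier R" "set as \<subseteq> carrier R"
  shows "shift t as ! 0 = peval as t"
proof -
  have "peval (shift t as) \<zero> = peval as t" using peval_shift[of t \<zero> as] assms by simp
  moreover obtain b bs where b: "shift t as = b # bs" using assms by (cases "shift t as") auto
  moreover have "set (b # bs) \<subseteq> carrier R" using shift_closed[of t as] assms b by simp
  ultimately show ?thesis by auto
qed

end

section \<open>Polynomials along approximations without best element\<close>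

definition nomax :: "'g::linorder set \<Rightarrow> bool" where
  "nomax S \<longleftrightarrow> S \<noteq> {} \<and> (\<forall>s\<in>S. \<exists>s'\<in>S. s < s')"

text \<open>Packaging "for all large elements of S" as a filter lets several such conditions be
  combined by \<open>eventually_elim\<close>.\<close>

definition tail :: "'g::linorder set \<Rightarrow> 'g filter" where
  "tail S = (INF s\<in>S. principal {x\<in>S. s \<le> x})"

lemma eventually_tail:
  assumes "S \<noteq> {}"
  shows "eventually P (tail S) \<longleftrightarrow> (\<exists>s\<in>S. \<forall>x\<in>S. s \<le> x \<longrightarrow> P x)"
  unfolding tail_def
proof (subst eventually_INF_base)
  fix a b assume "a \<in> S" "b \<in> S"
  then show "\<exists>x\<in>S. principal {y \<in> S. x \<le> y} \<le> inf (principal {x \<in> S. a \<le> x}) (principal {x \<in> S. b \<le> x})"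
    by (intro bexI[of _ "max a b"]) (auto simp: max_def)
qed (use assms in \<open>auto simp: eventually_principal\<close>)

lemma tail_not_bot: "S \<noteq> {} \<Longrightarrow> tail S \<noteq> bot"
  unfolding trivial_limit_def by (subst eventually_tail) auto

lemma eventually_tail_greater:
  assumes "nomax S" "s \<in> S"
  shows "\<forall>\<^sub>F x in tail S. x \<in> S \<and> s < x"
proof -
  obtain t where "t \<in> S" "s < t" using assms by (auto simp: nomax_def)
  then show ?thesis using assms by (subst eventually_tail) (auto simp: nomax_def intro!: bexI[of _ t])
qed

text \<open>Two points determine an affine function; uniqueness of slopes will follow from
  this.\<close>

lemma tail_two_values:
  assumes "nomax S" "\<forall>\<^sub>F x in tail S. P x"
  obtains x y where "x \<in> S" "y \<in> S" "x < y" "P x" "P y"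
proof -
  obtain s where s: "s \<in> S" "\<forall>x\<in>S. s \<le> x \<longrightarrow> P x"
    using assms by (subst (asm) eventually_tail) (auto simp: nomax_def)
  obtain t where "t \<in> S" "s < t" using assms s by (auto simp: nomax_def)
  then show ?thesis using s that[of s t] by auto
qed

text \<open>Once the function of larger slope has caught up, it is strictly ahead at every larger
  argument. If it never catches up, the opposite strict inequality holds on all of S.\<close>

lemma tail_cases:
  assumes "nomax S" "i \<noteq> j"
  shows "(\<forall>\<^sub>F x in tail S. \<alpha> + nmul i x < \<beta> + nmul j (x::'g::linordered_ab_group_add)) \<or>
         (\<forall>\<^sub>F x in tail S. \<beta> + nmul j x < \<alpha> + nmul i x)"
proof -
  have *: "(\<forall>\<^sub>F x in tail S. \<alpha> + nmul i x < \<beta> + nmul j x) \<or> (\<forall>\<^sub>F x in tail S. \<beta> + nmul j x < \<alpha> + nmul i x)"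
    if ij: "i < j" for i j \<alpha> \<beta>
  proof (cases "\<exists>s\<in>S. \<alpha> + nmul i s \<le> \<beta> + nmul j s")
    case True
    then obtain s where s: "s \<in> S" "\<alpha> + nmul i s \<le> \<beta> + nmul j s" by auto
    have "\<alpha> + nmul i x < \<beta> + nmul j x" if "s < x" for x
    proof -
      have "\<alpha> \<le> \<beta> + (nmul j s - nmul i s)" using s by (simp add: algebra_simps)
      also have "\<dots> < \<beta> + (nmul j x - nmul i x)"
        using nmul_left_strict_mono[OF ij that] by simp
      finally show ?thesis by (simp add: algebra_simps)
    qed
    then show ?thesis using eventually_tail_greater[OF assms(1) s(1)]
      by (auto elim: eventually_mono)
  next
    case False
    then have "\<forall>x\<in>S. \<beta> + nmul j x < \<alpha> + nmul i x" by (auto simp: not_le)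
    moreover have "S \<noteq> {}" using assms by (auto simp: nomax_def)
    ultimately show ?thesis by (subst (2) eventually_tail) auto
  qed
  show ?thesis
    using assms(2) *[of i j] *[of j i] by (cases "i < j") auto
qed

context valued_field
begin

lemma peval_gr:
  assumes "set as \<subseteq> carrier L" "u \<in> carrier L" "v u = Fin \<gamma>"
    "\<And>j. j < length as \<Longrightarrow> Fin B < v (as ! j) + Fin (nmul j \<gamma>)"
  shows "Fin B < v (peval as u)"
  using assms(1,4)
proof (induction as arbitrary: B)
  case (Cons a as)
  \<comment> \<open>Passing to the inner Horner polynomial divides by u and so lowers the bound by
    \<open>\<gamma>\<close>.\<close>
  have "Fin (B - \<gamma>) < v (peval as u)"
  proof (rule Cons.IH)
    fix j assume "j < length as"
    then have "Fin B < v (as ! j) + Fin (nmul (Suc j) \<gamma>)" using Cons.prems(2)[of "Suc j"] by simp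
    then show "Fin (B - \<gamma>) < v (as ! j) + Fin (nmul j \<gamma>)"
      by (cases "v (as ! j)") (auto simp: algebra_simps)
  qed (use Cons in auto)
  then have "Fin B < v (u \<otimes> peval as u)"
    using Cons.prems assms by (cases "v (peval as u)") (auto simp: v_mult algebra_simps)
  moreover have "Fin B < v a" using Cons.prems(2)[of 0] by (cases "v a") auto
  ultimately show ?case using Cons.prems assms by (auto intro!: v_add_gr)
qed simp

lemma peval_dominant:
  assumes "set as \<subseteq> carrier L" "u \<in> carrier L" "v u = Fin \<gamma>"
    "j0 < length as" "v (as ! j0) + Fin (nmul j0 \<gamma>) = Fin B"
    "\<And>j. j < length as \<Longrightarrow> j \<noteq> j0 \<Longrightarrow> Fin B < v (as ! j) + Fin (nmul j \<gamma>)"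
  shows "v (peval as u) = Fin B"
  using assms(1,4-)
proof (induction as arbitrary: B j0)
  case (Cons a as)
  show ?case
  proof (cases j0)
    case 0
    then have a: "v a = Fin B" using Cons.prems(3) by (cases "v a") auto
    have "Fin (B - \<gamma>) < v (peval as u)"
    proof (rule peval_gr[OF _ assms(2,3)])
      fix j assume "j < length as"
      then have "Fin B < v (as ! j) + Fin (nmul (Suc j) \<gamma>)" using Cons.prems(4)[of "Suc j"] 0 by simp
      then show "Fin (B - \<gamma>) < v (as ! j) + Fin (nmul j \<gamma>)"
        by (cases "v (as ! j)") (auto simp: algebra_simps)
    qed (use Cons in auto)
    then have "Fin B < v (u \<otimes> peval as u)"
      using Cons.prems assms by (cases "v (peval as u)") (auto simp: v_mult algebra_simps)
    then have "v (a \<oplus> u \<otimes> peval as u) = v a" using Cons.prems assms a by (intro v_add_eq) auto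
    then show ?thesis using a by simp
  next
    case (Suc j1)
    have "v (peval as u) = Fin (B - \<gamma>)"
    proof (rule Cons.IH)
      show "v (as ! j1) + Fin (nmul j1 \<gamma>) = Fin (B - \<gamma>)"
        using Cons.prems(3) Suc by (cases "v (as ! j1)") (auto simp: algebra_simps)
      fix j assume "j < length as" "j \<noteq> j1"
      then have "Fin B < v (as ! j) + Fin (nmul (Suc j) \<gamma>)" using Cons.prems(4)[of "Suc j"] Suc by simp
      then show "Fin (B - \<gamma>) < v (as ! j) + Fin (nmul j \<gamma>)"
        by (cases "v (as ! j)") (auto simp: algebra_simps)
    qed (use Cons Suc in auto)
    then have *: "v (u \<otimes> peval as u) = Fin B" using assms Cons.prems by (simp add: v_mult)
    have "Fin B < v a" using Cons.prems(4)[of 0] Suc by (cases "v a") auto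
    then have "v (u \<otimes> peval as u \<oplus> a) = Fin B" using Cons.prems assms * v_add_eq[of "u \<otimes> peval as u" a] by auto
    then show ?thesis using Cons.prems assms by (simp add: a_comm)
  qed
qed simp

definition dominant :: "'a list \<Rightarrow> 'g set \<Rightarrow> nat \<Rightarrow> 'g \<Rightarrow> bool" where
  "dominant as S j0 \<beta> \<longleftrightarrow> j0 < length as \<and> v (as ! j0) = Fin \<beta> \<and>
    (\<forall>\<^sub>F \<gamma> in tail S. \<forall>j < length as. j \<noteq> j0 \<longrightarrow> Fin (\<beta> + nmul j0 \<gamma>) < v (as ! j) + Fin (nmul j \<gamma>))"

text \<open>For large \<open>\<gamma>\<close> in a set without maximum, the terms \<open>v(a\<^sub>j) + j\<gamma>\<close> have pairwise distinct
  values, so one index dominates.\<close>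

lemma dominant_index:
  assumes "set as \<subseteq> carrier L" "nomax S" "\<not> set as \<subseteq> {\<zero>}"
  shows "\<exists>j0 \<beta>. dominant as S j0 \<beta>"
  unfolding dominant_def using assms(1,3)
proof (induction as)
  case (Cons a as)
  show ?case
  proof (cases "set as \<subseteq> {\<zero>}")
    case True
    then have "a \<noteq> \<zero>" using Cons.prems by auto
    then obtain \<beta> where \<beta>: "v a = Fin \<beta>" using Cons.prems v_FinE[of a] by auto
    have "Fin (\<beta> + nmul 0 \<gamma>) < v ((a # as) ! j) + Fin (nmul j \<gamma>)" if "j < length (a # as)" "j \<noteq> 0" for j \<gamma>
    proof -
      have "(a # as) ! j = \<zero>" using True that by (auto simp: nth_Cons' subset_eq)
      then show ?thesis by simp
    qed
    then show ?thesis using \<beta> by (intro exI[of _ "0::nat"] exI[of _ \<beta>]) auto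
  next
    case False
    obtain j0 \<beta> where j0: "j0 < length as" "v (as ! j0) = Fin \<beta>"
      "\<forall>\<^sub>F \<gamma> in tail S. \<forall>j < length as. j \<noteq> j0 \<longrightarrow> Fin (\<beta> + nmul j0 \<gamma>) < v (as ! j) + Fin (nmul j \<gamma>)"
      using Cons False by auto
    have ev: "\<forall>\<^sub>F \<gamma> in tail S. \<forall>j < length as. j \<noteq> j0 \<longrightarrow>
        Fin (\<beta> + nmul (Suc j0) \<gamma>) < v (as ! j) + Fin (nmul (Suc j) \<gamma>)"
      using j0(3)
    proof eventually_elim
      case (elim \<gamma>)
      show ?case
      proof (intro allI impI)
        fix j assume "j < length as" "j \<noteq> j0"
        then have "Fin (\<beta> + nmul j0 \<gamma>) < v (as ! j) + Fin (nmul j \<gamma>)" using elim by auto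
        then show "Fin (\<beta> + nmul (Suc j0) \<gamma>) < v (as ! j) + Fin (nmul (Suc j) \<gamma>)"
          by (cases "v (as ! j)") (auto simp: algebra_simps)
      qed
    qed
    have "(\<exists>\<alpha>. v a = Fin \<alpha> \<and> (\<forall>\<^sub>F \<gamma> in tail S. \<alpha> + nmul 0 \<gamma> < \<beta> + nmul (Suc j0) \<gamma>)) \<or>
       (\<forall>\<^sub>F \<gamma> in tail S. Fin (\<beta> + nmul (Suc j0) \<gamma>) < v a)"
    proof (cases "v a")
      case (Fin \<alpha>)
      then show ?thesis using tail_cases[OF assms(2), of 0 "Suc j0" \<alpha> \<beta>] by auto
    next
      case Pinf
      then show ?thesis by auto
    qed (use Cons.prems in auto)
    then show ?thesis
    proof (elim disjE exE conjE)
      fix \<alpha> assume \<alpha>: "v a = Fin \<alpha>" "\<forall>\<^sub>F \<gamma> in tail S. \<alpha> + nmul 0 \<gamma> < \<beta> + nmul (Suc j0) \<gamma>"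
      have "\<forall>\<^sub>F \<gamma> in tail S. \<forall>j<length (a # as). j \<noteq> 0 \<longrightarrow>
          Fin (\<alpha> + nmul 0 \<gamma>) < v ((a # as) ! j) + Fin (nmul j \<gamma>)"
        using ev \<alpha>(2)
      proof eventually_elim
        case (elim \<gamma>)
        show ?case
        proof (intro allI impI)
          fix j assume j: "j < length (a # as)" "j \<noteq> 0"
          then obtain j' where j': "j = Suc j'" by (cases j) auto
          show "Fin (\<alpha> + nmul 0 \<gamma>) < v ((a # as) ! j) + Fin (nmul j \<gamma>)"
          proof (cases "j' = j0")
            case True
            then show ?thesis using elim j' j0 by auto
          next
            case False
            then have "Fin (\<beta> + nmul (Suc j0) \<gamma>) < v (as ! j') + Fin (nmul (Suc j') \<gamma>)"
              using elim j j' by auto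
            moreover have "Fin (\<alpha> + nmul 0 \<gamma>) < Fin (\<beta> + nmul (Suc j0) \<gamma>)" using elim by auto
            ultimately show ?thesis using j' by (metis less_trans nth_Cons_Suc)
          qed
        qed
      qed
      then show ?thesis using \<alpha> by (intro exI[of _ "0::nat"] exI[of _ \<alpha>]) auto
    next
      assume *: "\<forall>\<^sub>F \<gamma> in tail S. Fin (\<beta> + nmul (Suc j0) \<gamma>) < v a"
      have "\<forall>\<^sub>F \<gamma> in tail S. \<forall>j<length (a # as). j \<noteq> Suc j0 \<longrightarrow>
          Fin (\<beta> + nmul (Suc j0) \<gamma>) < v ((a # as) ! j) + Fin (nmul j \<gamma>)"
        using ev *
      proof eventually_elim
        case (elim \<gamma>)
        show ?case
        proof (intro allI impI)
          fix j assume j: "j < length (a # as)" "j \<noteq> Suc j0"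
          show "Fin (\<beta> + nmul (Suc j0) \<gamma>) < v ((a # as) ! j) + Fin (nmul j \<gamma>)"
          proof (cases j)
            case 0
            then show ?thesis using elim by (cases "v a") auto
          next
            case (Suc j')
            then show ?thesis using elim j by auto
          qed
        qed
      qed
      then show ?thesis using j0 by (intro exI[of _ "Suc j0"] exI[of _ \<beta>]) auto
    qed
  qed
qed simp

lemma set_shift_zero: 
  assumes "t \<in> carrier L" "set as \<subseteq> {\<zero>}"
  shows "set (shift t as) \<subseteq> {\<zero>}"
proof -
  have "set (comb \<zero> t bs) \<subseteq> {\<zero>}" if "set bs \<subseteq> {\<zero>}" for bs
    using that by (induction bs) (use assms(1) in auto)
  then show ?thesis using assms by (induction as) auto
qed

lemma set_shift_zero_iff: 
  assumes "t \<in> carrier L" "set as \<subseteq> carrier L"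
  shows "set (shift t as) \<subseteq> {\<zero>} \<longleftrightarrow> set as \<subseteq> {\<zero>}"
proof
  assume "set (shift t as) \<subseteq> {\<zero>}"
  then have "set (shift (\<ominus> t) (shift t as)) \<subseteq> {\<zero>}" using set_shift_zero[of "\<ominus> t" "shift t as"] assms by simp
  moreover have "shift (\<ominus> t) (shift t as) = as" using assms by (subst shift_shift) (auto simp: l_neg shift_zero)
  ultimately show "set as \<subseteq> {\<zero>}" by simp
qed (use set_shift_zero assms in auto)

lemma peval_zero_list: "set as \<subseteq> {\<zero>} \<Longrightarrow> x \<in> carrier L \<Longrightarrow> peval as x = \<zero>"
  by (induction as) auto

text \<open>The difference is written c - w because c - w is the argument of the Taylor expansion at
  w. The value infinity, which occurs only if w lies in E, is left out.\<close>

definition dvals :: "'a set \<Rightarrow> 'a \<Rightarrow> 'g set" where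
  "dvals E w = {\<gamma>. \<exists>c\<in>E. v (c \<ominus> w) = Fin \<gamma>}"

definition approx :: "'a set \<Rightarrow> 'a \<Rightarrow> 'a filter" where
  "approx E w = (INF c0\<in>E. principal {c\<in>E. v (c0 \<ominus> w) \<le> v (c \<ominus> w)})"

lemma eventually_approx:
  assumes "E \<noteq> {}"
  shows "eventually P (approx E w) \<longleftrightarrow> (\<exists>c0\<in>E. \<forall>c\<in>E. v (c0 \<ominus> w) \<le> v (c \<ominus> w) \<longrightarrow> P c)"
  unfolding approx_def
proof (subst eventually_INF_base)
  fix a b assume "a \<in> E" "b \<in> E"
  then show "\<exists>x\<in>E. principal {c\<in>E. v (x \<ominus> w) \<le> v (c \<ominus> w)} \<le>
      inf (principal {c\<in>E. v (a \<ominus> w) \<le> v (c \<ominus> w)}) (principal {c\<in>E. v (b \<ominus> w) \<le> v (c \<ominus> w)})"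
    by (cases "v (a \<ominus> w) \<le> v (b \<ominus> w)") (auto intro: bexI[of _ a] bexI[of _ b])
qed (use assms in \<open>auto simp: eventually_principal\<close>)

end

locale approximated = valued_field L v
  for L :: "('a, 'b) ring_scheme" (structure) and v :: "'a \<Rightarrow> 'g::linordered_ab_group_add extended" +
  fixes E :: "'a set" and w :: 'a
  assumes E: "subfield E L" and w: "w \<in> carrier L" "w \<notin> E"
    and nomax: "nomax (dvals E w)"
begin

lemma E_closed: "c \<in> E \<Longrightarrow> c \<in> carrier L"
  using subfieldE(3)[OF E] by auto

lemma E_ne [simp]: "E \<noteq> {}" "\<zero> \<in> E" "\<one> \<in> E"
  using subringE(2-4)[OF subfieldE(1)[OF E]] by auto

lemma E_nomax: "c \<in> E \<Longrightarrow> \<exists>\<gamma>\<in>dvals E w. v (c \<ominus> w) = Fin \<gamma>"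
proof -
  assume c: "c \<in> E"
  then have "c \<ominus> w \<noteq> \<zero>" using w E_closed by auto
  then obtain \<gamma> where "v (c \<ominus> w) = Fin \<gamma>" using v_FinE w E_closed[OF c] by (metis minus_closed)
  then show ?thesis using c by (auto simp: dvals_def)
qed

text \<open>Together with \<open>eventually_tailI\<close> this moves statements between the filter
  on values and the filter on approximants.\<close>

lemma eventually_approxI:
  assumes "\<forall>\<^sub>F \<gamma> in tail (dvals E w). P \<gamma>"
  shows "\<forall>\<^sub>F c in approx E w. c \<in> E \<and> (\<exists>\<gamma>\<in>dvals E w. v (c \<ominus> w) = Fin \<gamma> \<and> P \<gamma>)"
proof -
  obtain s where s: "s \<in> dvals E w" "\<forall>x\<in>dvals E w. s \<le> x \<longrightarrow> P x"
    using assms nomax by (subst (asm) eventually_tail) (auto simp: nomax_def)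
  then obtain c0 where c0: "c0 \<in> E" "v (c0 \<ominus> w) = Fin s" by (auto simp: dvals_def)
  show ?thesis
  proof (subst eventually_approx, simp, intro bexI[of _ c0] ballI impI)
    fix c assume c: "c \<in> E" "v (c0 \<ominus> w) \<le> v (c \<ominus> w)"
    then obtain \<gamma> where "\<gamma> \<in> dvals E w" "v (c \<ominus> w) = Fin \<gamma>" using E_nomax by blast
    then show "c \<in> E \<and> (\<exists>\<gamma>\<in>dvals E w. v (c \<ominus> w) = Fin \<gamma> \<and> P \<gamma>)" using s c c0 by auto
  qed fact
qed

lemma eventually_tailI:
  assumes "\<forall>\<^sub>F c in approx E w. P c"
  shows "\<forall>\<^sub>F \<gamma> in tail (dvals E w). \<exists>c\<in>E. v (c \<ominus> w) = Fin \<gamma> \<and> P c"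
proof -
  obtain c0 where c0: "c0 \<in> E" "\<forall>c\<in>E. v (c0 \<ominus> w) \<le> v (c \<ominus> w) \<longrightarrow> P c"
    using assms by (subst (asm) eventually_approx) auto
  then obtain s where s: "s \<in> dvals E w" "v (c0 \<ominus> w) = Fin s" using E_nomax by blast
  have "\<exists>c\<in>E. v (c \<ominus> w) = Fin x \<and> P c" if "x \<in> dvals E w" "s \<le> x" for x
    using that c0 s unfolding dvals_def by fastforce
  then show ?thesis using s(1) by (subst eventually_tail) auto
qed

lemma eventually_in_E: "\<forall>\<^sub>F c in approx E w. c \<in> E"
  using E_ne by (subst eventually_approx) blast+

text \<open>As \<open>c \<in> E\<close> approaches \<open>w\<close>, the value of \<open>\<phi> c\<close> becomes an affine function of \<open>v (c - w)\<close> with slope \<open>j\<close>.\<close>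

definition asym :: "('a \<Rightarrow> 'a) \<Rightarrow> nat \<Rightarrow> 'g \<Rightarrow> bool" where
  "asym \<phi> j \<beta> \<longleftrightarrow> (\<forall>\<^sub>F c in approx E w. \<forall>\<gamma>. v (c \<ominus> w) = Fin \<gamma> \<longrightarrow> v (\<phi> c) = Fin (\<beta> + nmul j \<gamma>))"

text \<open>Two affine functions that agree at two points coincide. The slope is thus an invariant
  of the map and can serve as a substitute for a degree.\<close>

lemma asym_unique:
  assumes "asym \<phi> j \<beta>" "asym \<phi> j' \<beta>'"
  shows "j = j'" "\<beta> = \<beta>'"
proof -
  have *: "\<forall>\<^sub>F \<gamma> in tail (dvals E w). \<beta> + nmul j \<gamma> = \<beta>' + nmul j' \<gamma>"
    using eventually_tailI[OF eventually_conj[OF assms[unfolded asym_def]]]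
    by eventually_elim auto
  obtain x y where xy: "x < y" "\<beta> + nmul j x = \<beta>' + nmul j' x" "\<beta> + nmul j y = \<beta>' + nmul j' y"
    using tail_two_values[OF nomax *] by metis
  have **: "nmul j y - nmul j' y = nmul j x - nmul j' x" 
    using xy(2,3) by (metis add_diff_cancel_left' add_diff_eq diff_diff_eq2)
  then show "j = j'"
    using nmul_left_strict_mono[of j j' x y] nmul_left_strict_mono[of j' j x y] xy(1)
    by (metis linorder_neqE_nat minus_diff_eq order_less_irrefl)
  then show "\<beta> = \<beta>'" using xy by simp
qed

lemma asym_mult:
  assumes "asym \<phi> j \<beta>" "asym \<psi> j' \<beta>'" "\<And>c. c \<in> E \<Longrightarrow> \<phi> c \<in> carrier L" "\<And>c. c \<in> E \<Longrightarrow> \<psi> c \<in> carrier L"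
  shows "asym (\<lambda>c. \<phi> c \<otimes> \<psi> c) (j + j') (\<beta> + \<beta>')"
  using assms(1,2) eventually_in_E unfolding asym_def
  by eventually_elim (auto simp: v_mult assms nmul_add_left algebra_simps)

lemma asym_cong:
  assumes "asym \<phi> j \<beta>" "\<And>c. c \<in> E \<Longrightarrow> \<phi> c = \<psi> c"
  shows "asym \<psi> j \<beta>"
  using assms(1) eventually_in_E unfolding asym_def
  by eventually_elim (auto simp: assms)

text \<open>Distinct slopes exclude cancellation: eventually one summand has strictly smaller value
  and determines the sum.\<close>

lemma asym_add:
  assumes "asym \<phi> j \<beta>" "asym \<psi> j' \<beta>'" "\<And>c. c \<in> E \<Longrightarrow> \<phi> c \<in> carrier L" "\<And>c. c \<in> E \<Longrightarrow> \<psi> c \<in> carrier L"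
    and "j \<noteq> j'"
  shows "asym (\<lambda>c. \<phi> c \<oplus> \<psi> c) j \<beta> \<or> asym (\<lambda>c. \<phi> c \<oplus> \<psi> c) j' \<beta>'"
proof -
  have *: "asym (\<lambda>c. \<phi> c \<oplus> \<psi> c) j \<beta>"
    if ev: "\<forall>\<^sub>F x in tail (dvals E w). \<beta> + nmul j x < \<beta>' + nmul j' x" 
      and "asym \<phi> j \<beta>" "asym \<psi> j' \<beta>'" "\<And>c. c \<in> E \<Longrightarrow> \<phi> c \<in> carrier L" "\<And>c. c \<in> E \<Longrightarrow> \<psi> c \<in> carrier L"
    for \<phi> \<psi> j j' \<beta> \<beta>'
    using eventually_approxI[OF ev] that(2,3) unfolding asym_def
    by eventually_elim (auto simp: that v_add_eq)
  show ?thesis using tail_cases[OF nomax assms(5), of \<beta> \<beta>']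
  proof
    assume "\<forall>\<^sub>F x in tail (dvals E w). \<beta> + nmul j x < \<beta>' + nmul j' x"
    then show ?thesis using *[of \<beta> j \<beta>' j' \<phi> \<psi>] assms by auto
  next
    assume "\<forall>\<^sub>F x in tail (dvals E w). \<beta>' + nmul j' x < \<beta> + nmul j x"
    then have "asym (\<lambda>c. \<psi> c \<oplus> \<phi> c) j' \<beta>'" using *[of \<beta>' j' \<beta> j \<psi> \<phi>] assms by auto
    then show ?thesis using asym_cong[of "\<lambda>c. \<psi> c \<oplus> \<phi> c" j' \<beta>' "\<lambda>c. \<phi> c \<oplus> \<psi> c"] assms(3,4) a_comm by auto
  qed
qed

lemma asym_dominant:
  assumes "set bs \<subseteq> carrier L" "dominant bs (dvals E w) j0 \<beta>"
  shows "asym (\<lambda>c. peval bs (c \<ominus> w)) j0 \<beta>"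
  using eventually_approxI[OF assms(2)[unfolded dominant_def, THEN conjunct2, THEN conjunct2]] eventually_in_E
  unfolding asym_def
proof eventually_elim
  case (elim c)
  show ?case
  proof (intro allI impI)
    fix \<gamma> assume g: "v (c \<ominus> w) = Fin \<gamma>"
    show "v (peval bs (c \<ominus> w)) = Fin (\<beta> + nmul j0 \<gamma>)"
      by (rule peval_dominant[where ?j0.0=j0 and \<gamma>=\<gamma>]) (use assms w elim g E_closed in \<open>auto simp: dominant_def\<close>)
  qed
qed

lemma peval_shift_w:
  assumes "set as \<subseteq> carrier L" "c \<in> E"
  shows "peval as c = peval (shift w as) (c \<ominus> w)" "pder as c = pder (shift w as) (c \<ominus> w)"
proof -
  have "c \<ominus> w \<oplus> w = c" using assms w E_closed[of c] by algebra
  then show "peval as c = peval (shift w as) (c \<ominus> w)" "pder as c = pder (shift w as) (c \<ominus> w)"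
    using peval_shift[of w "c \<ominus> w" as] pder_shift[of w "c \<ominus> w" as] assms w E_closed[of c] by auto
qed

text \<open>The slope is the dominant index of the Taylor expansion at w. In particular it is
  smaller than the length of the list.\<close>

lemma asym_peval:
  assumes "set as \<subseteq> carrier L" "\<not> set as \<subseteq> {\<zero>}"
  obtains j0 \<beta> where "dominant (shift w as) (dvals E w) j0 \<beta>" "asym (peval as) j0 \<beta>"
proof -
  have "\<not> set (shift w as) \<subseteq> {\<zero>}" using assms w by (simp add: set_shift_zero_iff)
  then obtain j0 \<beta> where j0: "dominant (shift w as) (dvals E w) j0 \<beta>"
    using dominant_index[of "shift w as" "dvals E w"] assms w nomax by auto
  have "asym (\<lambda>c. peval (shift w as) (c \<ominus> w)) j0 \<beta>"
    using j0 assms w by (intro asym_dominant) auto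
  then have "asym (peval as) j0 \<beta>"
    by (rule asym_cong) (use assms peval_shift_w in auto)
  then show ?thesis using j0 that by blast
qed

end

section \<open>Characteristic p\<close>

context cring
begin

abbreviation nmult :: "nat \<Rightarrow> 'a \<Rightarrow> 'a" where
  "nmult k x \<equiv> add_pow R k x"

lemma peval_snoc:
  assumes "set as \<subseteq> carrier R" "e \<in> carrier R" "x \<in> carrier R"
  shows "peval (as @ [e]) x = peval as x \<oplus> x [^] length as \<otimes> e"
  using assms
proof (induction as)
  case (Cons a as)
  define y where "y = peval as x"
  define z where "z = x [^] length as"
  have yz: "y \<in> carrier R" "z \<in> carrier R" using Cons.prems by (auto simp: y_def z_def)
  show ?case using Cons yz by (simp flip: y_def z_def) algebra
qed simp

lemma peval_map2:
  assumes "length as = length bs" "set as \<subseteq> carrier R" "set bs \<subseteq> carrier R" "k \<in> carrier R" "x \<in> carrier R"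
  shows "peval (map2 (\<lambda>a b. a \<ominus> k \<otimes> b) as bs) x = peval as x \<ominus> k \<otimes> peval bs x"
  using assms
proof (induction as bs rule: list_induct2)
  case Nil
  then show ?case by simp algebra
next
  case (Cons a as b bs)
  define y where "y = peval as x"
  define z where "z = peval bs x"
  have yz: "y \<in> carrier R" "z \<in> carrier R" using Cons.prems by (auto simp: y_def z_def)
  show ?case using Cons yz by (simp flip: y_def z_def) algebra
qed

lemma peval_monom:
  assumes "x \<in> carrier R"
  shows "peval (replicate n \<zero> @ [\<one>]) x = x [^] n"
  using assms by (induction n) (auto simp: m_comm)

text \<open>The binomial theorem as a Taylor expansion; the recursion of \<open>comb\<close> is
  Pascal's rule.\<close>

lemma shift_monom_nth:
  assumes "t \<in> carrier R" "k \<le> n"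
  shows "shift t (replicate n \<zero> @ [\<one>]) ! k = nmult (n choose k) (t [^] (n - k))"
  using assms(2)
proof (induction n arbitrary: k)
  case (Suc n)
  let ?bs = "shift t (replicate n \<zero> @ [\<one>])"
  have ne: "?bs \<noteq> []" by simp
  show ?case
  proof (cases k)
    case 0
    then show ?thesis using Suc.IH[of 0] assms(1) by (simp add: comb_nth_0 m_comm)
  next
    case (Suc k')
    show ?thesis
    proof (cases "k' = n")
      case True
      have "comb \<zero> t ?bs ! length ?bs = last ?bs" using comb_nth_last[OF ne] .
      also have "last ?bs = \<one>" by (simp add: last_shift)
      finally show ?thesis using True Suc by simp
    next
      case False
      then have k': "k' < n" using Suc.prems Suc by auto
      define m where "m = n - Suc k'"
      have m: "n - k' = Suc m" "Suc n - k = Suc m" using k' Suc by (auto simp: m_def)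
      have "comb \<zero> t ?bs ! Suc k' = ?bs ! k' \<oplus> t \<otimes> ?bs ! Suc k'"
        using k' by (intro comb_nth_Suc) auto
      also have "\<dots> = nmult (n choose k') (t [^] Suc m) \<oplus> t \<otimes> (nmult (n choose Suc k') (t [^] m))"
        using Suc.IH[of k'] Suc.IH[of "Suc k'"] k' m by (simp add: m_def)
      also have "\<dots> = nmult (n choose k') (t [^] Suc m) \<oplus> nmult (n choose Suc k') (t [^] Suc m)"
        using assms(1) by (simp add: add_pow_rdistr m_comm)
      also have "\<dots> = nmult (Suc n choose k) (t [^] (Suc n - k))"
        using assms(1) m Suc by (simp add: add.nat_pow_mult)
      finally show ?thesis using Suc by simp
    qed
  qed
qed simp

text \<open>Entry \<open>j\<close> is multiplied by \<open>k + j\<close>, so \<open>cder 1 as\<close> lists the coefficients of the derivative of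
  \<open>a # as\<close>.\<close>

primrec cder :: "nat \<Rightarrow> 'a list \<Rightarrow> 'a list" where
  "cder k [] = []"
| "cder k (a # as) = (nmult k a) # cder (Suc k) as"

lemma length_cder [simp]: "length (cder k as) = length as"
  by (induction as arbitrary: k) auto

lemma cder_nth: "j < length as \<Longrightarrow> cder k as ! j = nmult (k + j) (as ! j)"
  by (induction as arbitrary: k j) (auto simp: nth_Cons' simp del: add.nat_pow_Suc)

lemma add_pow_subring:
  assumes "subring E R" "a \<in> E"
  shows "nmult k a \<in> E"
  using assms by (induction k) (auto simp: subringE)

lemma cder_subring:
  assumes "subring E R" "set as \<subseteq> E"
  shows "set (cder k as) \<subseteq> E"
  using assms(2) by (induction as arbitrary: k) (auto simp: add_pow_subring[OF assms(1)])

text \<open>The offset k makes the induction work: the sum of (k + j) a_j x^j is k a(x) + x a'(x).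
  For k = 1 this is the derivative of X a(X).\<close>

lemma peval_cder_gen:
  assumes "set as \<subseteq> carrier R" "x \<in> carrier R"
  shows "peval (cder k as) x = nmult k (peval as x) \<oplus> x \<otimes> pder as x"
  using assms(1)
proof (induction as arbitrary: k)
  case (Cons a as)
  define y where "y = peval as x"
  define z where "z = pder as x"
  have yz: "y \<in> carrier R" "z \<in> carrier R" using Cons.prems assms by (auto simp: y_def z_def)
  have IH: "peval (cder (Suc k) as) x = nmult k y \<oplus> y \<oplus> x \<otimes> z"
    using Cons by (simp add: y_def z_def)
  have "peval (cder k (a # as)) x = nmult k a \<oplus> x \<otimes> (nmult k y \<oplus> y \<oplus> x \<otimes> z)"
    using IH by simp
  also have "\<dots> = nmult k a \<oplus> x \<otimes> (nmult k y) \<oplus> x \<otimes> (y \<oplus> x \<otimes> z)"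
  proof -
    define u where "u = nmult k y"
    define s where "s = nmult k a"
    have "u \<in> carrier R" "s \<in> carrier R" using yz Cons.prems by (auto simp: u_def s_def)
    then show ?thesis unfolding u_def[symmetric] s_def[symmetric] using yz assms by algebra
  qed
  also have "\<dots> = nmult k (a \<oplus> x \<otimes> y) \<oplus> x \<otimes> (y \<oplus> x \<otimes> z)"
    using yz assms Cons.prems by (simp add: add.nat_pow_distrib add_pow_rdistr)
  finally show ?case by (simp add: y_def z_def)
qed (use assms in simp)

lemma pder_Cons_eq:
  assumes "set as \<subseteq> carrier R" "x \<in> carrier R"
  shows "pder (a # as) x = peval (cder 1 as) x"
  using assms by (simp add: peval_cder_gen)

end

section \<open>Division with remainder over a subfield\<close>

context field
begin

text \<open>Horner induction: from g = q h + r one gets a + X g = (X q) h + (a + X r), and at most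
  one cancellation of a top coefficient restores the length of the remainder. The bound on the
  length of q is the degree count used in \<open>slope_zero\<close>.\<close>

lemma peval_division:
  assumes E: "subfield E R" and h: "set h \<subseteq> E" "h \<noteq> []" "last h \<noteq> \<zero>" and g: "set g \<subseteq> E"
  shows "\<exists>q r. set q \<subseteq> E \<and> set r \<subseteq> E \<and> length r < length h \<and> length r \<le> length g \<and>
    length q \<le> length g + 1 - length h \<and>
    (\<forall>x\<in>carrier R. peval g x = peval q x \<otimes> peval h x \<oplus> peval r x)"
  using g
proof (induction g)
  case Nil
  then show ?case using h by (intro exI[of _ "[]"]) (auto simp: subset_eq subfieldE(3)[OF E, THEN subsetD])
next
  case (Cons a g)
  have Ec: "x \<in> carrier R" if "x \<in> E" for x using that subfieldE(3)[OF E] by auto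
  note sub = subringE[OF subfieldE(1)[OF E]]
  obtain q r where qr: "set q \<subseteq> E" "set r \<subseteq> E" "length r < length h" "length r \<le> length g"
    "length q \<le> length g + 1 - length h"
    "\<And>x. x \<in> carrier R \<Longrightarrow> peval g x = peval q x \<otimes> peval h x \<oplus> peval r x"
    using Cons by auto
  have cl: "set q \<subseteq> carrier R" "set r \<subseteq> carrier R" "set h \<subseteq> carrier R" "a \<in> carrier R"
    using qr Ec h Cons.prems by auto
  have main: "peval (a # g) x = (x \<otimes> peval q x) \<otimes> peval h x \<oplus> peval (a # r) x" if x: "x \<in> carrier R" for x
  proof -
    define y where "y = peval q x"
    define z where "z = peval h x"
    define u where "u = peval r x"
    have "y \<in> carrier R" "z \<in> carrier R" "u \<in> carrier R" using cl x by (auto simp: y_def z_def u_def)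
    then show ?thesis unfolding peval.simps qr(6)[OF x] y_def[symmetric] z_def[symmetric] u_def[symmetric]
      using x cl(4) by algebra
  qed
  show ?case
  proof (cases "Suc (length r) < length h")
    case True
    \<comment> \<open>An empty quotient has to stay empty: prefixing a zero could break the length
      bound, whose subtraction is truncated.\<close>
    have "\<forall>x\<in>carrier R. peval (a # g) x = peval (if q = [] then [] else \<zero> # q) x \<otimes> peval h x \<oplus> peval (a # r) x"
      using main cl by auto
    moreover have "length (if q = [] then [] else \<zero> # q) \<le> length (a # g) + 1 - length h"
      using qr(5) by (cases q) auto
    ultimately show ?thesis using qr Cons.prems True sub
      by (intro exI[of _ "if q = [] then [] else \<zero> # q"] exI[of _ "a # r"]) auto
  next
    case False
    then have len: "Suc (length r) = length h" using qr by auto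
    obtain h' f where h': "h = h' @ [f]" using h by (metis append_butlast_last_id)
    obtain r' e where r': "a # r = r' @ [e]" by (metis append_butlast_last_id list.distinct(1))
    have len': "length r' = length h'" using len h' r' by (metis Suc_inject length_Cons length_append_singleton)
    have f: "f \<in> E" "f \<noteq> \<zero>" using h h' by auto
    have e: "e \<in> E" "set r' \<subseteq> E" "set h' \<subseteq> E" 
      using qr(2) Cons.prems r' h h' by (metis insert_subset list.simps(15) set_append Un_subset_iff empty_set)+
    \<comment> \<open>Subtracting k times the divisor cancels the top coefficient \<open>e\<close>
      of \<open>a # r\<close>.\<close>
    define k where "k = e \<otimes> inv f"
    have k: "k \<in> E" using subfield_m_inv(1)[OF E, of f] f e sub by (auto simp: k_def)
    have kf: "k \<otimes> f = e" using subfield_m_inv(3)[OF E, of f] f e Ec by (simp add: k_def m_assoc field_Units)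
    let ?r = "map2 (\<lambda>a b. a \<ominus> k \<otimes> b) r' h'"
    have "x \<ominus> k \<otimes> y \<in> E" if "x \<in> E" "y \<in> E" for x y using that k sub by (simp add: a_minus_def)
    moreover have "x \<in> E \<and> y \<in> E" if "(x, y) \<in> set (zip r' h')" for x y
      using that e set_zip_leftD[OF that] set_zip_rightD[OF that] by auto
    ultimately have r_E: "set ?r \<subseteq> E" by auto
    have eq: "peval (a # g) x = peval (k # q) x \<otimes> peval h x \<oplus> peval ?r x" if x: "x \<in> carrier R" for x
    proof -
      have cl': "set r' \<subseteq> carrier R" "set h' \<subseteq> carrier R" "k \<in> carrier R" "f \<in> carrier R" "e \<in> carrier R"
        using e Ec k f by auto
      have h_eq: "peval h x = peval h' x \<oplus> x [^] length h' \<otimes> f"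
        unfolding h' using cl' x by (intro peval_snoc) auto
      have r_eq: "peval (a # r) x = peval r' x \<oplus> x [^] length h' \<otimes> (k \<otimes> f)"
        unfolding r' kf len'[symmetric] using cl' x by (intro peval_snoc) auto
      have r2: "peval ?r x = peval r' x \<ominus> k \<otimes> peval h' x"
        using len' cl' x by (intro peval_map2) auto
      define y where "y = peval q x"
      define z where "z = peval h' x"
      define u where "u = peval r' x"
      define t where "t = x [^] length h'"
      have "y \<in> carrier R" "z \<in> carrier R" "u \<in> carrier R" "t \<in> carrier R"
        using cl cl' x by (auto simp: y_def z_def u_def t_def)
      then show ?thesis unfolding main[OF x] r_eq r2 h_eq unfolding peval.simps 
          y_def[symmetric] z_def[symmetric] u_def[symmetric] t_def[symmetric]
        using x cl' by algebra
    qed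
    have "length (k # q) \<le> length (a # g) + 1 - length h" using qr len by auto
    moreover have "length ?r < length h" "length ?r \<le> length (a # g)" using len' h' len qr by auto
    ultimately show ?thesis using eq qr k r_E by (intro exI[of _ "k # q"] exI[of _ ?r]) auto
  qed
qed

end

section \<open>Integer multiples and the Frobenius map in characteristic p\<close>

locale valued_field_p = valued_field L v
  for L :: "('a, 'b) ring_scheme" (structure) and v :: "'a \<Rightarrow> 'g::linordered_ab_group_add extended" +
  fixes p :: nat
  assumes prime_p: "Factorial_Ring.prime p" and char_p: "nmult p \<one> = \<zero>"
begin

lemma p_pos [simp]: "p > 0"
  using prime_p prime_gt_0_nat by auto

lemma add_pow_dvd:
  assumes "p dvd k" "x \<in> carrier L"
  shows "nmult k x = \<zero>"
proof -
  obtain l where l: "k = p * l" using assms by auto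
  have "nmult p x = (nmult p \<one>) \<otimes> x" using assms by (simp add: add_pow_ldistr)
  then have "nmult p x = \<zero>" using assms char_p by simp
  then show ?thesis using assms l add.nat_pow_pow[of x p l] by (metis add.nat_pow_one mult.commute add.nat_pow_pow)
qed

lemma v_nat_nonneg: "0 \<le> v (nmult k \<one>)"
proof (induction k)
  case (Suc k)
  then show ?case using v_add_ge'[of 0 "nmult k \<one>" \<one>] by simp
qed simp

text \<open>Since multiples of p vanish, a Bezout relation makes k invertible with an integer
  inverse. Both factors have nonnegative value and the values add up to zero.\<close>

lemma v_nat_unit:
  assumes "\<not> p dvd k"
  shows "v (nmult k \<one>) = 0"
proof -
  have "algebraic_semidom_class.coprime k p" using prime_imp_coprime[OF prime_p assms] by (simp add: ac_simps)
  then obtain u w where uw: "k * u = p * w + 1"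
    using bezout_nat[of k p] assms by (metis coprime_imp_gcd_eq_1 dvd_0_right)
  have "nmult (k * u) \<one> = nmult (p * w) \<one> \<oplus> nmult (1::nat) \<one>" unfolding uw by (simp add: add.nat_pow_mult)
  also have "\<dots> = \<one>" by (simp add: add_pow_dvd)
  finally have "(nmult k \<one>) \<otimes> (nmult u \<one>) = \<one>"
    by (simp add: add_pow_ldistr add_pow_rdistr add.nat_pow_pow mult.commute)
  then have s: "v (nmult k \<one>) + v (nmult u \<one>) = 0" by (metis add.nat_pow_closed one_closed v_mult v_one)
  then show ?thesis using v_nat_nonneg[of k] v_nat_nonneg[of u]
    by (cases "v (nmult k \<one>)"; cases "v (nmult u \<one>)") (auto simp: zero_extended_def add_nonneg_eq_0_iff)
qed

lemma v_nat_mult: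
  assumes "\<not> p dvd k" "x \<in> carrier L"
  shows "v (nmult k x) = v x"
proof -
  have "nmult k x = (nmult k \<one>) \<otimes> x" using assms by (simp add: add_pow_ldistr)
  then show ?thesis using assms v_nat_unit[of k] by (simp add: v_mult)
qed

text \<open>The Taylor list of X^p at y has only its two outer entries nonzero, because p divides
  the inner binomial coefficients.\<close>

lemma frobenius_add:
  assumes x: "x \<in> carrier L" and y: "y \<in> carrier L"
  shows "(x \<oplus> y) [^] p = x [^] p \<oplus> y [^] p"
proof -
  let ?bs = "shift y (replicate p \<zero> @ [\<one>])"
  have len: "length ?bs = Suc p" by simp
  have "?bs = (y [^] p) # replicate (p - 1) \<zero> @ [\<one>]"
  proof (rule nth_equalityI)
    fix k assume k: "k < length ?bs"
    then have *: "?bs ! k = nmult (p choose k) (y [^] (p - k))" using y by (intro shift_monom_nth) auto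
    show "?bs ! k = (y [^] p # replicate (p - 1) \<zero> @ [\<one>]) ! k"
    proof (cases "k = 0 \<or> k = p")
      case False
      then have "p dvd (p choose k)" using prime_p k by (intro dvd_choose_prime) auto
      then have "?bs ! k = \<zero>" using * y by (simp add: add_pow_dvd)
      then show ?thesis using k False by (auto simp: nth_Cons' nth_append)
    qed (use * y p_pos in \<open>auto simp: nth_Cons' nth_append\<close>)
  qed (use p_pos in auto)
  then have "peval ?bs x = y [^] p \<oplus> x \<otimes> x [^] (p - 1)" using x by (simp add: peval_monom)
  moreover have "x \<otimes> x [^] (p - 1) = x [^] p"
    using x p_pos by (metis Suc_diff_1 nat_pow_Suc m_comm nat_pow_closed)
  moreover have "peval ?bs x = (x \<oplus> y) [^] p"
    using x y by (subst peval_shift) (auto simp: peval_monom)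
  ultimately show ?thesis using x y by (simp add: a_comm)
qed

lemma frobenius_power_add:
  assumes x: "x \<in> carrier L" and y: "y \<in> carrier L"
  shows "(x \<oplus> y) [^] (p ^ l) = x [^] (p ^ l) \<oplus> y [^] (p ^ l)"
proof (induction l)
  case (Suc l)
  have *: "z [^] (p ^ Suc l) = (z [^] (p ^ l)) [^] p" if "z \<in> carrier L" for z
    using that by (simp add: nat_pow_pow mult.commute)
  show ?case using x y by (simp add: * Suc frobenius_add del: power_Suc)
qed (use assms in simp)

lemma frobenius_power_diff:
  assumes x: "x \<in> carrier L" and y: "y \<in> carrier L"
  shows "(x \<ominus> y) [^] (p ^ l) = x [^] (p ^ l) \<ominus> y [^] (p ^ l)"
proof -
  have "x \<ominus> y \<oplus> y = x" using x y by algebra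
  then have "x [^] (p ^ l) = (x \<ominus> y) [^] (p ^ l) \<oplus> y [^] (p ^ l)"
    using frobenius_power_add[of "x \<ominus> y" y l] x y by simp
  moreover have "z \<oplus> u \<ominus> u = z" if "z \<in> carrier L" "u \<in> carrier L" for z u using that by algebra
  ultimately show ?thesis using x y by simp
qed

lemmas frobenius_diff = frobenius_power_diff[of _ _ 1, simplified]

end

section \<open>Purely inseparable extensions of degree p\<close>

locale inseparable_step = approximated L v E w + valued_field_p L v p
  for L :: "('a, 'b) ring_scheme" (structure) and v :: "'a \<Rightarrow> 'g::linordered_ab_group_add extended"
    and E w p +
  assumes w_pow: "w [^] p \<in> E"
begin

lemmas E_sub = subringE[OF subfieldE(1)[OF E]]

lemma E_set_closed: "set h \<subseteq> E \<Longrightarrow> set h \<subseteq> carrier L"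
  using E_closed by auto

text \<open>Over L the polynomial X^p - w^p equals (X - w)^p, so its value at c is exactly p v(c -
  w).\<close>

lemma asym_radical: "asym (peval ((\<ominus> (w [^] p)) # replicate (p - 1) \<zero> @ [\<one>])) p 0"
proof -
  have "peval ((\<ominus> (w [^] p)) # replicate (p - 1) \<zero> @ [\<one>]) c = (c \<ominus> w) [^] p" if "c \<in> E" for c
  proof -
    have "c \<otimes> c [^] (p - 1) = c [^] p"
      using that E_closed p_pos by (metis Suc_diff_1 nat_pow_Suc m_comm nat_pow_closed)
    moreover have "(c \<ominus> w) [^] p = c [^] p \<ominus> w [^] p" using that E_closed w by (intro frobenius_diff) auto
    ultimately show ?thesis using that E_closed w by (simp add: peval_monom a_minus_def a_comm)
  qed
  moreover have "v ((c \<ominus> w) [^] p) = Fin (0 + nmul p \<gamma>)" if "c \<in> E" "v (c \<ominus> w) = Fin \<gamma>" for c \<gamma>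
    using that E_closed w by (simp add: v_pow nmul_Fin)
  ultimately show ?thesis using eventually_in_E unfolding asym_def
    by (auto elim: eventually_mono)
qed

text \<open>Take \<open>h\<close> of minimal degree \<open>d\<close> with positive slope \<open>j\<^sub>0\<close>. Repeated division by \<open>h\<close> shows that every
  polynomial over \<open>E\<close> has slope \<open>k j\<^sub>0\<close> with \<open>k d\<close> at most its degree. Since \<open>X^p - w^p\<close> has slope \<open>p\<close>,
  this forces \<open>d = 1\<close>, i.e. \<open>w\<close> would be as close to an element of \<open>E\<close> as to all of \<open>E\<close>.\<close>

lemma slope_zero:
  assumes "set h \<subseteq> E" "length h \<le> p" "asym (peval h) j \<beta>"
  shows "j = 0"
proof (rule ccontr)
  assume "j \<noteq> 0"
  define P where "P = (\<lambda>n. \<exists>h j \<beta>. set h \<subseteq> E \<and> length h = n \<and> asym (peval h) j \<beta> \<and> j \<noteq> 0)"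
  define n where "n = (LEAST n. P n)"
  have P0: "P (length h)" unfolding P_def using assms \<open>j \<noteq> 0\<close> by blast
  have "P n" unfolding n_def using P0 by (rule LeastI)
  have n_le: "n \<le> p" using Least_le[of P "length h"] P0 assms(2) by (simp add: n_def)
  have min: "j = 0" if "set r \<subseteq> E" "length r < n" "asym (peval r) j \<beta>" for r j \<beta>
    using not_less_Least[of "length r" P] that unfolding n_def P_def by blast
  obtain h j0 \<beta>0 where h: "set h \<subseteq> E" "length h = n" "asym (peval h) j0 \<beta>0" "j0 \<noteq> 0"
    using \<open>P n\<close> unfolding P_def by blast
  \<comment> \<open>Asymptotic values are finite, so a map with a slope cannot vanish identically on
    E.\<close>
  have asym_not_zero: "\<exists>c\<in>E. \<phi> c \<noteq> \<zero>" if "asym \<phi> i \<gamma>" for \<phi> i \<gamma>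
  proof -
    have "\<forall>\<^sub>F \<gamma>' in tail (dvals E w). \<exists>c\<in>E. \<phi> c \<noteq> \<zero>"
      using eventually_tailI[OF that[unfolded asym_def]]
    proof eventually_elim
      case (elim \<gamma>')
      then obtain c where c: "c \<in> E" "v (\<phi> c) = Fin (\<gamma> + nmul i \<gamma>')" by blast
      then have "\<phi> c \<noteq> \<zero>" by auto
      then show ?case using c by blast
    qed
    then show ?thesis using tail_not_bot[of "dvals E w"] nomax by (auto simp: nomax_def)
  qed
  have h_nz: "\<not> set h \<subseteq> {\<zero>}" using asym_not_zero[OF h(3)] peval_zero_list E_closed by blast
  have h_ne: "h \<noteq> []" using h_nz by auto
  have last_h: "last h \<noteq> \<zero>"
  proof
    assume "last h = \<zero>"
    then have hb: "h = butlast h @ [\<zero>]" using h_ne by (metis append_butlast_last_id)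
    have sb: "set (butlast h) \<subseteq> E" using h(1) by (meson in_set_butlastD subset_eq)
    have "asym (peval (butlast h)) j0 \<beta>0"
    proof (rule asym_cong[OF h(3)])
      fix c assume c: "c \<in> E"
      have "peval (butlast h @ [\<zero>]) c = peval (butlast h) c"
        using c E_closed E_set_closed[OF sb] by (subst peval_snoc) auto
      then show "peval h c = peval (butlast h) c" using hb by simp
    qed
    moreover have "length (butlast h) < n" using h h_ne by (cases h) auto
    ultimately show False using min[OF sb] h by blast
  qed
  have j0_less: "j0 < n"
  proof -
    obtain j1 \<beta>1 where "dominant (shift w h) (dvals E w) j1 \<beta>1" "asym (peval h) j1 \<beta>1"
      by (rule asym_peval[OF E_set_closed[OF h(1)] h_nz])
    then show ?thesis using asym_unique(1)[OF h(3)] h by (auto simp: dominant_def)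
  qed
  have slopes: "(\<forall>x\<in>E. peval g x = \<zero>) \<or> (\<exists>k \<gamma>. asym (peval g) (k * j0) \<gamma> \<and> k * (n - 1) \<le> length g - 1)"
    if "set g \<subseteq> E" for g
    using that
  proof (induction "length g" arbitrary: g rule: less_induct)
    case less
    obtain q r where qr: "set q \<subseteq> E" "set r \<subseteq> E" "length r < length h" "length r \<le> length g"
      "length q \<le> length g + 1 - length h"
      "\<And>x. x \<in> carrier L \<Longrightarrow> peval g x = peval q x \<otimes> peval h x \<oplus> peval r x"
      using peval_division[OF E h(1) h_ne last_h less.prems] by blast
    have cl: "set q \<subseteq> carrier L" "set r \<subseteq> carrier L" "set h \<subseteq> carrier L" "set g \<subseteq> carrier L"
      using qr h less E_set_closed by auto
    \<comment> \<open>The remainder is shorter than \<open>h\<close>, so minimality of n leaves only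
      slope zero.\<close>
    have r_slope: "(\<forall>x\<in>E. peval r x = \<zero>) \<or> (\<exists>\<gamma>. asym (peval r) 0 \<gamma>)"
    proof (cases "set r \<subseteq> {\<zero>}")
      case True
      then show ?thesis using peval_zero_list E_closed by auto
    next
      case False
      then obtain j1 \<gamma> where "asym (peval r) j1 \<gamma>" using asym_peval[OF cl(2)] by metis
      then show ?thesis using min[OF qr(2)] qr(3) h(2) by blast
    qed
    show ?case
    proof (cases "\<forall>x\<in>E. peval q x = \<zero>")
      case True
      then have "peval g x = peval r x" if "x \<in> E" for x
        using that E_closed qr(6)[of x] cl by auto
      then have "(\<forall>x\<in>E. peval g x = \<zero>) \<or> (\<exists>\<gamma>. asym (peval g) (0 * j0) \<gamma>)"
        using r_slope asym_cong[of "peval r" 0 _ "peval g"] by auto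
      then show ?thesis by (metis le0 mult_0)
    next
      case False
      then have q_ne: "q \<noteq> []" by auto
      have n1: "n > 1" using j0_less h(4) by auto
      moreover have "length q > 0" using q_ne by simp
      ultimately have "length q < length g" using qr(5) h(2) by linarith
      then obtain k \<gamma> where k: "asym (peval q) (k * j0) \<gamma>" "k * (n - 1) \<le> length q - 1"
        using less.hyps[of q] qr(1) False by blast
      have qh: "asym (\<lambda>c. peval q c \<otimes> peval h c) (k * j0 + j0) (\<gamma> + \<beta>0)"
        using asym_mult[OF k(1) h(3)] cl E_closed by auto
      have deg: "(k + 1) * (n - 1) \<le> length g - 1"
        using k(2) qr(5) h(2) q_ne n1 by (cases q) auto
      show ?thesis
        using r_slope
      proof
        assume "\<forall>x\<in>E. peval r x = \<zero>"
        then have "peval q x \<otimes> peval h x = peval g x" if "x \<in> E" for x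
          using that E_closed qr(6)[of x] cl by auto
        then have "asym (peval g) ((k + 1) * j0) (\<gamma> + \<beta>0)"
          using asym_cong[OF qh] by (simp add: add.commute)
        then show ?thesis using deg by blast
      next
        assume "\<exists>\<gamma>. asym (peval r) 0 \<gamma>"
        then obtain \<gamma>' where r: "asym (peval r) 0 \<gamma>'" by auto
        \<comment> \<open>The product has positive slope and the remainder slope zero, so they
          cannot cancel.\<close>
        have "asym (\<lambda>c. peval q c \<otimes> peval h c \<oplus> peval r c) (k * j0 + j0) (\<gamma> + \<beta>0) \<or>
              asym (\<lambda>c. peval q c \<otimes> peval h c \<oplus> peval r c) 0 \<gamma>'"
          using cl E_closed h(4) by (intro asym_add[OF qh r]) auto
        moreover have "peval q x \<otimes> peval h x \<oplus> peval r x = peval g x" if "x \<in> E" for x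
          using that E_closed qr(6)[of x] by auto
        ultimately have "asym (peval g) ((k + 1) * j0) (\<gamma> + \<beta>0) \<or> asym (peval g) (0 * j0) \<gamma>'"
          using asym_cong[of "\<lambda>c. peval q c \<otimes> peval h c \<oplus> peval r c" _ _ "peval g"]
          by (auto simp: add.commute)
        then show ?thesis using deg by (metis le0 mult_0)
      qed
    qed
  qed
  define g where "g = (\<ominus> (w [^] p)) # replicate (p - 1) \<zero> @ [\<one>]"
  have g: "set g \<subseteq> E" "length g = p + 1" "asym (peval g) p 0"
    using w_pow E_sub asym_radical p_pos by (auto simp: g_def)
  obtain k \<gamma> where k': "asym (peval g) (k * j0) \<gamma>" "k * (n - 1) \<le> length g - 1"
    using slopes[OF g(1)] asym_not_zero[OF g(3)] by blast
  have k: "p = k * j0" "k * (n - 1) \<le> p"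
    using asym_unique(1)[OF g(3) k'(1)] k'(2) g(2) by simp_all
  have "j0 dvd p" using k by simp
  \<comment> \<open>A divisor of p that is smaller than n, hence smaller than p, is 1. Then k = p,
    and p (n - 1) \<le> p leaves only a linear \<open>h\<close>.\<close>
  then have "j0 = 1" using prime_p j0_less n_le by (metis leD prime_nat_iff)
  then have "k = p" using k by simp
  then have "n - 1 \<le> 1" using k(2) p_pos by simp
  then have "n = 2" using j0_less \<open>j0 = 1\<close> by auto
  then obtain a b where ab: "h = [a, b]" using h(2)
    by (metis One_nat_def Suc_1 length_0_conv length_Suc_conv)
  have abE: "a \<in> E" "b \<in> E" "b \<noteq> \<zero>" using h(1) last_h ab by auto
  \<comment> \<open>The root of the linear \<open>h\<close>. Once c is closer to w than r is, v(c -
    r) = v(r - w) is constant, so the slope would be zero after all.\<close>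
  define r where "r = \<ominus> (inv b \<otimes> a)"
  have r: "r \<in> E" using abE E_sub subfield_m_inv(1)[OF E, of b] by (auto simp: r_def)
  have abL: "a \<in> carrier L" "b \<in> carrier L" "r \<in> carrier L" using abE E_closed r by auto
  have "b \<otimes> r = \<ominus> a"
    using abL abE unfolding r_def by (simp add: r_minus m_assoc[symmetric] field_Units)
  then have h_eq: "peval h c = b \<otimes> (c \<ominus> r)" if "c \<in> carrier L" for c
  proof -
    have "b \<otimes> (c \<ominus> r) = b \<otimes> c \<ominus> b \<otimes> r" using abL that by algebra
    also have "\<dots> = b \<otimes> c \<oplus> a" using \<open>b \<otimes> r = \<ominus> a\<close> abL that by (simp add: a_minus_def minus_minus)
    finally show ?thesis using abL that by (simp add: ab a_comm m_comm)
  qed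
  obtain \<rho> where \<rho>: "\<rho> \<in> dvals E w" "v (r \<ominus> w) = Fin \<rho>" using E_nomax[OF r] by auto
  obtain \<beta>b where \<beta>b: "v b = Fin \<beta>b" using v_FinE abL abE by blast
  have "asym (peval h) 0 (\<beta>b + \<rho>)"
    using eventually_approxI[OF eventually_tail_greater[OF nomax \<rho>(1)]] unfolding asym_def
  proof eventually_elim
    case (elim c)
    then obtain \<gamma> where c: "c \<in> E" "v (c \<ominus> w) = Fin \<gamma>" "\<rho> < \<gamma>" by auto
    have cL: "c \<in> carrier L" using c E_closed by auto
    have "c \<ominus> r = \<ominus> (r \<ominus> w) \<oplus> (c \<ominus> w)" using cL abL w by algebra
    moreover have "v (\<ominus> (r \<ominus> w) \<oplus> (c \<ominus> w)) = v (\<ominus> (r \<ominus> w))"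
      using cL abL w c \<rho> by (intro v_add_eq) auto
    ultimately have "v (c \<ominus> r) = Fin \<rho>" using \<rho> abL w by simp
    then show ?case using h_eq[OF cL] abL cL \<beta>b by (simp add: v_mult)
  qed
  then show False using asym_unique(1)[OF h(3)] h(4) by blast
qed

text \<open>By \<open>slope_zero\<close> the index 0 dominates the Taylor expansion at w: the
  constant coefficient h(w) has finite value and all other terms are eventually larger. Hence w has
  degree p over E, and elements of E(w) are approximated by elements h(c) of E beyond their own
  value.\<close>

lemma nonzero_peval_w:
  assumes "set h \<subseteq> E" "length h \<le> p" "\<not> set h \<subseteq> {\<zero>}"
  obtains \<beta> where "v (peval h w) = Fin \<beta>"
    "\<forall>\<^sub>F c in approx E w. Fin \<beta> < v (peval h c \<ominus> peval h w)"
proof -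
  have cl: "set h \<subseteq> carrier L" using assms E_set_closed by auto
  obtain j1 \<beta> where dom: "dominant (shift w h) (dvals E w) j1 \<beta>" "asym (peval h) j1 \<beta>"
    by (rule asym_peval[OF cl assms(3)])
  have "j1 = 0" using slope_zero[OF assms(1,2) dom(2)] .
  then have j0: "v (shift w h ! 0) = Fin \<beta>" "\<forall>\<^sub>F \<gamma> in tail (dvals E w). \<forall>j < length h. j \<noteq> 0 \<longrightarrow>
      Fin \<beta> < v (shift w h ! j) + Fin (nmul j \<gamma>)"
    using dom(1) by (auto simp: dominant_def)
  have ne: "h \<noteq> []" using assms by auto
  have s0: "shift w h ! 0 = peval h w" using shift_nth_0[OF ne] w cl by auto
  obtain b0 bs where bs: "shift w h = b0 # bs" using ne by (cases "shift w h") auto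
  have bcl: "set (b0 # bs) \<subseteq> carrier L" using shift_closed[of w h] cl w bs by simp
  have len: "length h = Suc (length bs)" by (metis bs length_Cons length_shift)
  have b0: "b0 = peval h w" using s0 bs by simp
  have "\<forall>\<^sub>F c in approx E w. Fin \<beta> < v (peval h c \<ominus> peval h w)"
    using eventually_approxI[OF j0(2)]
  proof eventually_elim
    case (elim c)
    then obtain \<gamma> where c: "c \<in> E" "v (c \<ominus> w) = Fin \<gamma>"
      "\<And>j. j < length h \<Longrightarrow> j \<noteq> 0 \<Longrightarrow> Fin \<beta> < v (shift w h ! j) + Fin (nmul j \<gamma>)" by auto
    have cL: "c \<in> carrier L" using c E_closed by auto
    have "peval h c = peval (b0 # bs) (c \<ominus> w)" using peval_shift_w(1)[OF cl c(1)] bs by simp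
    then have "peval h c \<ominus> peval h w = peval (\<zero> # bs) (c \<ominus> w)"
    proof -
      define u where "u = (c \<ominus> w) \<otimes> peval bs (c \<ominus> w)"
      have u: "u \<in> carrier L" "b0 \<in> carrier L" using bcl cL w by (auto simp: u_def)
      assume "peval h c = peval (b0 # bs) (c \<ominus> w)"
      then show ?thesis unfolding peval.simps b0[symmetric] u_def[symmetric] using u by simp algebra
    qed
    moreover have "Fin \<beta> < v (peval (\<zero> # bs) (c \<ominus> w))"
    proof (rule peval_gr[OF _ _ c(2)])
      fix j assume "j < length (\<zero> # bs)"
      then show "Fin \<beta> < v ((\<zero> # bs) ! j) + Fin (nmul j \<gamma>)"
        using c(3)[of j] bs len by (cases j) auto
    qed (use bcl cL w in auto)
    ultimately show ?case by simp
  qed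
  then show ?thesis using that[of \<beta>] j0(1) s0 by simp
qed

text \<open>Write h(c) - h(w) = (c - w) b(c - w). The multipliers 1, ..., p - 1 occurring in the
  derivative are units of value zero, so the coefficients of b have the same values as the Taylor
  coefficients of h' at w. As \<open>slope_zero\<close> applies to h', the quotient b(c - w) has
  eventually constant value, and this value is the translation \<open>\<beta>\<close>.\<close>

lemma dist_peval_w:
  assumes h: "set h \<subseteq> E" "length h \<le> p" and x: "peval h w \<notin> E"
  obtains \<beta> where 
    "\<forall>\<^sub>F c in approx E w. \<forall>\<gamma>. v (c \<ominus> w) = Fin \<gamma> \<longrightarrow> v (peval h c \<ominus> peval h w) = Fin (\<beta> + \<gamma>)"
    "\<And>y. y \<in> E \<Longrightarrow> \<forall>\<^sub>F c in approx E w. v (y \<ominus> peval h w) < v (peval h c \<ominus> peval h w)"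
proof -
  have cl: "set h \<subseteq> carrier L" using h E_set_closed by auto
  have ne: "h \<noteq> []" using x by auto
  obtain h0 hs where hs: "h = h0 # hs" using ne by (cases h) auto
  have hsE: "set hs \<subseteq> E" "h0 \<in> E" "length hs < p" using h hs by auto
  have hscl: "set hs \<subseteq> carrier L" using cl hs by auto
  have hs_nz: "\<not> set hs \<subseteq> {\<zero>}"
  proof
    assume "set hs \<subseteq> {\<zero>}"
    then have "peval h w = h0" using peval_zero_list[of hs w] w hsE E_closed by (auto simp: hs)
    then show False using x hsE by simp
  qed
  have cderE: "set (cder 1 hs) \<subseteq> E" using cder_subring[OF subfieldE(1)[OF E] hsE(1)] .
  have cder_nz: "\<not> set (cder 1 hs) \<subseteq> {\<zero>}"
  proof -
    obtain y where "y \<in> set hs" "y \<noteq> \<zero>" using hs_nz by auto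
    then obtain j where j: "j < length hs" "hs ! j \<noteq> \<zero>" by (auto simp: in_set_conv_nth)
    have "\<not> p dvd (1 + j)" using j hsE(3) by (auto dest: dvd_imp_le)
    then have "v (cder 1 hs ! j) = v (hs ! j)"
      using j hscl by (subst cder_nth) (auto intro!: v_nat_mult simp del: add.nat_pow_Suc)
    moreover have "hs ! j \<in> carrier L" "cder 1 hs ! j \<in> carrier L" 
      using j hscl cderE E_closed by (auto simp: subset_eq)
    ultimately have "cder 1 hs ! j \<noteq> \<zero>" using j(2) by (metis v_Pinf_iff)
    then show ?thesis using j by (metis length_cder nth_mem singletonD subsetD)
  qed
  obtain j1 \<beta>' where "asym (peval (cder 1 hs)) j1 \<beta>'"
    using asym_peval[OF E_set_closed[OF cderE] cder_nz] by metis
  then have as0: "asym (peval (cder 1 hs)) 0 \<beta>'"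
    using slope_zero[OF cderE] hsE(3) by (metis length_cder less_imp_le)
  obtain b0 bs where bs: "shift w h = b0 # bs" using ne by (cases "shift w h") auto
  have bcl: "set (b0 # bs) \<subseteq> carrier L" using shift_closed[of w h] cl w bs by simp
  have len: "length h = Suc (length bs)" by (metis bs length_Cons length_shift)
  have b0: "b0 = peval h w" using shift_nth_0[OF ne, of w] w cl bs by auto
  have cder_cl: "set (cder 1 bs) \<subseteq> carrier L" using cder_subring[OF carrier_is_subring] bcl by auto
  have eq: "peval (cder 1 hs) c = peval (cder 1 bs) (c \<ominus> w)" if "c \<in> E" for c
  proof -
    have "pder h c = pder (b0 # bs) (c \<ominus> w)" using peval_shift_w(2)[OF cl that] bs by simp
    then show ?thesis using pder_Cons_eq[of hs c h0] pder_Cons_eq[of bs "c \<ominus> w" b0] hs hscl bcl that w E_closed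
      by auto
  qed
  have as1: "asym (\<lambda>c. peval (cder 1 bs) (c \<ominus> w)) 0 \<beta>'"
    using asym_cong[OF as0] eq by auto
  have bs_nz: "\<not> set (cder 1 bs) \<subseteq> {\<zero>}"
  proof
    assume z: "set (cder 1 bs) \<subseteq> {\<zero>}"
    have "\<forall>\<^sub>F \<gamma> in tail (dvals E w). False"
      using eventually_tailI[OF as1[unfolded asym_def]] 
    proof eventually_elim
      case (elim \<gamma>)
      then obtain c where c: "c \<in> E" "v (peval (cder 1 bs) (c \<ominus> w)) = Fin \<beta>'" by auto
      moreover have "peval (cder 1 bs) (c \<ominus> w) = \<zero>" using z c E_closed w by (intro peval_zero_list) auto
      ultimately show False by simp
    qed
    then show False using nomax tail_not_bot[of "dvals E w"] by (auto simp: nomax_def)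
  qed
  obtain j2 \<beta>2 where j2: "dominant (cder 1 bs) (dvals E w) j2 \<beta>2"
    using dominant_index[OF cder_cl nomax bs_nz] by blast
  have "asym (\<lambda>c. peval (cder 1 bs) (c \<ominus> w)) j2 \<beta>2" by (rule asym_dominant[OF cder_cl j2])
  then have [simp]: "j2 = 0" using asym_unique(1)[OF as1] by auto
  have v_cder: "v (cder 1 bs ! j) = v (bs ! j)" if "j < length bs" for j
  proof -
    have "\<not> p dvd (1 + j)" using that h(2) len by (auto dest: dvd_imp_le)
    then show ?thesis using that bcl
      by (subst cder_nth) (auto intro!: v_nat_mult simp del: add.nat_pow_Suc)
  qed
  \<comment> \<open>Dominance depends on the values of the coefficients only, so it passes from the
    derivative to the difference quotient.\<close>
  have "dominant bs (dvals E w) 0 \<beta>2"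
  proof -
    have v_cder': "v (cder (Suc 0) bs ! j) = v (bs ! j)" if "j < length bs" for j using v_cder[OF that] by simp
    have "\<forall>\<^sub>F \<gamma> in tail (dvals E w). \<forall>j<length bs. j \<noteq> 0 \<longrightarrow>
        Fin \<beta>2 < v (cder (Suc 0) bs ! j) + Fin (nmul j \<gamma>)"
      using j2 by (simp add: dominant_def)
    then have "\<forall>\<^sub>F \<gamma> in tail (dvals E w). \<forall>j<length bs. j \<noteq> 0 \<longrightarrow> Fin \<beta>2 < v (bs ! j) + Fin (nmul j \<gamma>)"
      by (rule eventually_mono) (metis v_cder')
    then show ?thesis using j2 v_cder'[of 0] by (simp add: dominant_def)
  qed
  then have as2: "asym (\<lambda>c. peval bs (c \<ominus> w)) 0 \<beta>2" using bcl by (intro asym_dominant) auto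
  have diff: "peval h c \<ominus> peval h w = (c \<ominus> w) \<otimes> peval bs (c \<ominus> w)" if "c \<in> E" for c
  proof -
    have "peval h c = peval (b0 # bs) (c \<ominus> w)" using peval_shift_w(1)[OF cl that] bs by simp
    moreover have "(c \<ominus> w) \<otimes> peval bs (c \<ominus> w) \<in> carrier L" "b0 \<in> carrier L" using bcl w E_closed that by auto
    ultimately show ?thesis unfolding b0[symmetric] peval.simps by algebra
  qed
  have 1: "\<forall>\<^sub>F c in approx E w. \<forall>\<gamma>. v (c \<ominus> w) = Fin \<gamma> \<longrightarrow> v (peval h c \<ominus> peval h w) = Fin (\<beta>2 + \<gamma>)"
    using as2[unfolded asym_def] eventually_in_E
  proof eventually_elim
    case (elim c)
    then show ?case using w bcl E_closed by (auto simp: diff v_mult add.commute)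
  qed
  have 2: "\<forall>\<^sub>F c in approx E w. v (y \<ominus> peval h w) < v (peval h c \<ominus> peval h w)" if y: "y \<in> E" for y
  proof -
    have yL: "y \<in> carrier L" using y E_closed by auto
    have h0L: "h0 \<in> carrier L" using hsE E_closed by auto
    \<comment> \<open>Subtracting y changes the constant term only, so
      \<open>nonzero_peval_w\<close> applies and compares v(h(w) - y) with the error of
      h(c).\<close>
    let ?h = "(h0 \<ominus> y) # hs"
    have hE: "set ?h \<subseteq> E" using hsE y E_sub by (auto simp: a_minus_def)
    have pe: "peval ?h c = peval h c \<ominus> y" if "c \<in> carrier L" for c
    proof -
      define u where "u = c \<otimes> peval hs c"
      have "u \<in> carrier L" using that hscl by (auto simp: u_def)
      then show ?thesis unfolding hs peval.simps u_def[symmetric] using h0L yL by algebra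
    qed
    obtain \<beta>3 where \<beta>3: "v (peval ?h w) = Fin \<beta>3"
      "\<forall>\<^sub>F c in approx E w. Fin \<beta>3 < v (peval ?h c \<ominus> peval ?h w)"
      using nonzero_peval_w[OF hE] h hs hs_nz by auto
    show ?thesis using \<beta>3(2) eventually_in_E
    proof eventually_elim
      case (elim c)
      have "c \<in> carrier L" using elim E_closed by auto
      then have "peval h c \<in> carrier L" "peval h w \<in> carrier L" using cl w by auto
      moreover have "peval ?h c \<ominus> peval ?h w = peval h c \<ominus> peval h w"
        unfolding pe[OF \<open>c \<in> carrier L\<close>] pe[OF w(1)] using calculation yL by algebra
      moreover have "v (peval ?h w) = v (y \<ominus> peval h w)"
        unfolding pe[OF w(1)] using calculation yL by (intro v_diff_commute)
      ultimately show ?case using elim \<beta>3(1) by simp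
    qed
  qed
  show ?thesis using that[OF 1 2] .
qed

end

section \<open>Immediate subextensions of the p-th root field\<close>

lemma (in field) nat_pow_eq_zeroD:
  assumes "x [^] (n::nat) = \<zero>" "x \<in> carrier R"
  shows "x = \<zero>"
  using assms by (induction n) (auto simp: integral_iff)

lemma (in field) inv_nat_pow:
  assumes "x \<in> carrier R" "x \<noteq> \<zero>"
  shows "(inv x) [^] (n::nat) = inv (x [^] n)"
proof -
  have i: "inv x \<in> carrier R" "x \<otimes> inv x = \<one>" using assms by (auto simp: field_Units)
  have "x [^] n \<otimes> (inv x) [^] n = \<one>" using i assms by (simp flip: nat_pow_distrib)
  then show ?thesis using i assms by (metis comm_inv_char nat_pow_closed)
qed

lemma (in valued_field) v_self [simp]: "x \<in> carrier L \<Longrightarrow> v (x \<ominus> x) = Pinf"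
proof -
  assume "x \<in> carrier L"
  then have "x \<ominus> x = \<zero>" by algebra
  then show ?thesis by simp
qed

section \<open>Value group, divisible hull and classes of cuts\<close>

locale valued_subfield_p = valued_field_p L v p
  for L :: "('a, 'b) ring_scheme" (structure) and v :: "'a \<Rightarrow> 'g::linordered_ab_group_add extended"
    and p +
  fixes K :: "'a set"
  assumes K: "subfield K L"
begin

abbreviation "vK \<equiv> value_group v K"
abbreviation "\<Delta> \<equiv> divisible_hull vK"

lemmas K_sub = subringE[OF subfieldE(1)[OF K]]

lemma K_closed: "c \<in> K \<Longrightarrow> c \<in> carrier L"
  using K_sub(1) by auto

lemma K_diff: "c \<in> K \<Longrightarrow> d \<in> K \<Longrightarrow> c \<ominus> d \<in> K"
  using K_sub by (simp add: a_minus_def)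

lemma K_inv: "c \<in> K \<Longrightarrow> c \<noteq> \<zero> \<Longrightarrow> inv c \<in> K"
  using subfield_m_inv(1)[OF K, of c] by simp

lemma K_pow: "c \<in> K \<Longrightarrow> c [^] (n::nat) \<in> K"
  using K_sub by (induction n) auto

lemma vK_zero: "0 \<in> vK"
  using K_sub(3) v_one unfolding value_group_def zero_extended_def by blast

lemma vK_add: "g \<in> vK \<Longrightarrow> h \<in> vK \<Longrightarrow> g + h \<in> vK"
proof -
  assume "g \<in> vK" "h \<in> vK"
  then obtain x y where "x \<in> K" "v x = Fin g" "y \<in> K" "v y = Fin h" by (auto simp: value_group_def)
  then have "x \<otimes> y \<in> K" "v (x \<otimes> y) = Fin (g + h)" using K_sub K_closed by (auto simp: v_mult)
  then show ?thesis by (auto simp: value_group_def)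
qed

lemma vK_minus: "g \<in> vK \<Longrightarrow> - g \<in> vK"
proof -
  assume "g \<in> vK"
  then obtain x where x: "x \<in> K" "v x = Fin g" by (auto simp: value_group_def)
  then have "x \<noteq> \<zero>" by auto
  then have "inv x \<in> K" "v (inv x) = Fin (- g)" using x K_inv K_closed by (auto simp: v_inv)
  then show ?thesis by (auto simp: value_group_def)
qed

lemma vK_diff: "g \<in> vK \<Longrightarrow> h \<in> vK \<Longrightarrow> g - h \<in> vK"
  using vK_add[of g "- h"] vK_minus[of h] by simp

lemma vK_nmul: "g \<in> vK \<Longrightarrow> nmul n g \<in> vK"
  by (induction n) (auto simp: vK_zero vK_add)

lemma hull_iff: "g \<in> \<Delta> \<longleftrightarrow> (\<exists>n>0. nmul n g \<in> vK)"
  by (auto simp: divisible_hull_def nmul_def)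

lemma vK_hull: "vK \<subseteq> \<Delta>"
  unfolding hull_iff subset_eq by (auto intro!: exI[of _ 1])

lemma hull_zero: "0 \<in> \<Delta>"
  using vK_hull vK_zero by auto

lemma hull_add: "g \<in> \<Delta> \<Longrightarrow> h \<in> \<Delta> \<Longrightarrow> g + h \<in> \<Delta>"
proof -
  assume "g \<in> \<Delta>" "h \<in> \<Delta>"
  then obtain m n where mn: "m > 0" "n > 0" "nmul m g \<in> vK" "nmul n h \<in> vK" by (auto simp: hull_iff)
  have "nmul (m * n) (g + h) = nmul n (nmul m g) + nmul m (nmul n h)"
    by (metis mult.commute nmul_add_right nmul_mult)
  then have "nmul (m * n) (g + h) \<in> vK" using mn by (simp add: vK_add vK_nmul)
  then show ?thesis using mn by (metis hull_iff nat_0_less_mult_iff)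
qed

lemma hull_minus: "g \<in> \<Delta> \<Longrightarrow> - g \<in> \<Delta>"
  by (auto simp: hull_iff nmul_minus vK_minus)

lemma hull_diff: "g \<in> \<Delta> \<Longrightarrow> h \<in> \<Delta> \<Longrightarrow> g - h \<in> \<Delta>"
  using hull_add[of g "- h"] hull_minus[of h] by simp

lemma hull_root: "n > 0 \<Longrightarrow> nmul n g \<in> \<Delta> \<Longrightarrow> g \<in> \<Delta>"
  unfolding hull_iff by (metis nat_0_less_mult_iff nmul_mult)

lemma hull_nmul: "g \<in> \<Delta> \<Longrightarrow> nmul n g \<in> \<Delta>"
  by (induction n) (auto simp: hull_zero hull_add)

definition down :: "'g set \<Rightarrow> 'g set" where
  "down S = {x \<in> \<Delta>. \<exists>s\<in>S. x \<le> s}"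

text \<open>All translates of the cut, whether or not they are distances themselves. This is
  precisely the form of the classes in \<open>ndd_classes\<close>, since a quotient consists of full
  images under the relation.\<close>

definition cls :: "'g set \<Rightarrow> 'g set set" where
  "cls D = equal_modulo \<Delta> `` {D}"

lemma cls_alt: "cls D = {(+) \<alpha> ` D |\<alpha>. \<alpha> \<in> \<Delta>}"
  by (auto simp: cls_def equal_modulo_def)

lemma image_add_add: "(+) \<alpha> ` (+) \<beta> ` D = (+) (\<alpha> + \<beta>) ` (D :: 'g set)"
  by (auto simp: image_image add.assoc)

lemma cls_translate:
  assumes "\<beta> \<in> \<Delta>"
  shows "cls ((+) \<beta> ` D) = cls D"
proof
  show "cls ((+) \<beta> ` D) \<subseteq> cls D"
    using assms hull_add unfolding cls_alt image_add_add by auto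
  show "cls D \<subseteq> cls ((+) \<beta> ` D)"
  proof
    fix D2 assume "D2 \<in> cls D"
    then obtain \<alpha> where "\<alpha> \<in> \<Delta>" "D2 = (+) \<alpha> ` D" by (auto simp: cls_alt)
    then have "D2 = (+) (\<alpha> - \<beta>) ` (+) \<beta> ` D" "\<alpha> - \<beta> \<in> \<Delta>"
      using assms hull_diff by (auto simp: image_add_add)
    then show "D2 \<in> cls ((+) \<beta> ` D)" unfolding cls_alt by blast
  qed
qed

lemma cls_eqD:
  assumes "cls D = cls D'"
  obtains \<alpha> where "\<alpha> \<in> \<Delta>" "D = (+) \<alpha> ` D'"
proof -
  have "(+) 0 ` D \<in> cls D" unfolding cls_alt using hull_zero by blast
  then have "D \<in> cls D'" using assms by simp
  then show ?thesis using that by (auto simp: cls_alt)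
qed

text \<open>Only cofinality matters: S and the translate of T bound each other.\<close>

lemma down_translate:
  assumes "\<beta> \<in> \<Delta>" "\<And>s. s \<in> S \<Longrightarrow> \<exists>t\<in>T. s \<le> \<beta> + t" "\<And>t. t \<in> T \<Longrightarrow> \<exists>s\<in>S. \<beta> + t \<le> s"
  shows "down S = (+) \<beta> ` down T"
proof
  show "down S \<subseteq> (+) \<beta> ` down T"
  proof
    fix x assume "x \<in> down S"
    then obtain s where s: "x \<in> \<Delta>" "s \<in> S" "x \<le> s" by (auto simp: down_def)
    then obtain t where t: "t \<in> T" "x \<le> \<beta> + t" using assms(2)[of s] by force
    have "x - \<beta> \<le> t" using t by (simp add: algebra_simps)
    then have "x - \<beta> \<in> down T" using t s assms hull_diff by (auto simp: down_def)
    then show "x \<in> (+) \<beta> ` down T" by (intro image_eqI[of _ _ "x - \<beta>"]) auto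
  qed
  show "(+) \<beta> ` down T \<subseteq> down S"
  proof
    fix x assume "x \<in> (+) \<beta> ` down T"
    then obtain y t where y: "x = \<beta> + y" "y \<in> \<Delta>" "t \<in> T" "y \<le> t" by (auto simp: down_def)
    then obtain s where "s \<in> S" "\<beta> + t \<le> s" using assms(3) by blast
    moreover have "\<beta> + y \<le> \<beta> + t" using y by simp
    ultimately have "\<exists>s\<in>S. \<beta> + y \<le> s" by (meson order_trans)
    then show "x \<in> down S" using y hull_add assms(1) by (auto simp: down_def)
  qed
qed

lemma dvals_FinE:
  assumes "a \<in> carrier L" "a \<notin> K" "c \<in> K"
  obtains s where "s \<in> dvals K a" "v (c \<ominus> a) = Fin s"
proof -
  have "c \<ominus> a \<noteq> \<zero>" using assms K_closed by auto
  then obtain s where "v (c \<ominus> a) = Fin s" using v_FinE assms K_closed by (metis minus_closed)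
  then show ?thesis using that assms by (auto simp: dvals_def)
qed

text \<open>If c' in K is closer to a than c, then v(c - a) = v(c - c'). Such a c' always exists
  when there is no maximum.\<close>

lemma dvals_subset_vK:
  assumes "a \<in> carrier L" "nomax (dvals K a)"
  shows "dvals K a \<subseteq> vK"
proof
  fix s assume s: "s \<in> dvals K a"
  then obtain s' where s': "s' \<in> dvals K a" "s < s'" using assms by (auto simp: nomax_def)
  from s s' obtain c c' where c: "c \<in> K" "v (c \<ominus> a) = Fin s" "c' \<in> K" "v (c' \<ominus> a) = Fin s'"
    by (auto simp: dvals_def)
  have cl: "c \<in> carrier L" "c' \<in> carrier L" using c K_closed by auto
  have "v ((c \<ominus> a) \<oplus> \<ominus> (c' \<ominus> a)) = Fin s"
    using c s' cl assms(1) v_add_eq[of "c \<ominus> a" "\<ominus> (c' \<ominus> a)"] by simp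
  moreover have "(c \<ominus> a) \<oplus> \<ominus> (c' \<ominus> a) = c \<ominus> c'" using cl assms(1) by algebra
  ultimately show "s \<in> vK" using c K_diff by (auto simp: value_group_def)
qed

lemma difference_values_eq:
  assumes "a \<in> carrier L" "a \<notin> K"
  shows "difference_values L v K a = Fin ` dvals K a"
proof -
  have "v (a \<ominus> c) = v (c \<ominus> a)" if "c \<in> K" for c using v_diff_commute assms(1) K_closed[OF that] by auto
  then have "difference_values L v K a = (\<lambda>c. v (c \<ominus> a)) ` K"
    unfolding difference_values_def by (force simp: image_def)
  also have "\<dots> = Fin ` dvals K a"
  proof
    show "(\<lambda>c. v (c \<ominus> a)) ` K \<subseteq> Fin ` dvals K a"
    proof
      fix y assume "y \<in> (\<lambda>c. v (c \<ominus> a)) ` K"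
      then obtain c where c: "c \<in> K" "y = v (c \<ominus> a)" by auto
      obtain s where "s \<in> dvals K a" "v (c \<ominus> a) = Fin s" using dvals_FinE[OF assms c(1)] .
      then show "y \<in> Fin ` dvals K a" using c by auto
    qed
    show "Fin ` dvals K a \<subseteq> (\<lambda>c. v (c \<ominus> a)) ` K"
    proof
      fix y assume "y \<in> Fin ` dvals K a"
      then obtain s c where "c \<in> K" "v (c \<ominus> a) = Fin s" "y = Fin s" by (auto simp: dvals_def)
      then show "y \<in> (\<lambda>c. v (c \<ominus> a)) ` K" by (metis imageI)
    qed
  qed
  finally show ?thesis .
qed

lemma weakly_immediate_iff:
  assumes "a \<in> carrier L" "a \<notin> K"
  shows "weakly_immediate L v K a \<longleftrightarrow> nomax (dvals K a)"
proof -
  obtain t where "t \<in> dvals K a" using dvals_FinE[OF assms K_sub(2)] .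
  then have "dvals K a \<noteq> {}" by auto
  then show ?thesis
    unfolding weakly_immediate_def difference_values_eq[OF assms] nomax_def
    by (auto simp: not_le)
qed

lemma distance_eq:
  assumes "a \<in> carrier L" "a \<notin> K" "nomax (dvals K a)"
  shows "distance L v K a = down (dvals K a)"
proof -
  have "{g \<in> \<Delta>. Fin g \<in> difference_values L v K a} = dvals K a"
    using dvals_subset_vK[OF assms(1,3)] vK_hull unfolding difference_values_eq[OF assms(1,2)] by auto
  moreover have "initial_segment \<Delta> (down (dvals K a))"
    by (auto simp: initial_segment_def down_def) (meson order_trans)
  moreover have "dvals K a \<subseteq> down (dvals K a)"
    using dvals_subset_vK[OF assms(1,3)] vK_hull by (auto simp: down_def)
  moreover have "down (dvals K a) \<subseteq> S" if "initial_segment \<Delta> S" "dvals K a \<subseteq> S" for S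
    using that by (auto simp: initial_segment_def down_def)
  ultimately show ?thesis unfolding distance_def by blast
qed

section \<open>Approximation beyond K and immediate extensions\<close>

definition close :: "'a \<Rightarrow> 'a \<Rightarrow> bool" where
  "close a b \<longleftrightarrow> (\<forall>s\<in>dvals K a. Fin s < v (a \<ominus> b))"

text \<open>The error v(a - b) exceeds every v(c - a), so each c in K is equally far from a and from
  b.\<close>

lemma close_dvals:
  assumes "a \<in> carrier L" "a \<notin> K" "b \<in> carrier L" "close a b"
  shows "dvals K b = dvals K a" "b \<notin> K"
proof -
  have eq: "v (c \<ominus> b) = v (c \<ominus> a)" if c: "c \<in> K" for c
  proof -
    obtain s where s: "s \<in> dvals K a" "v (c \<ominus> a) = Fin s" using dvals_FinE assms c by blast
    have "v ((c \<ominus> a) \<oplus> (a \<ominus> b)) = v (c \<ominus> a)"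
      using s assms K_closed[OF c] by (intro v_add_eq) (auto simp: close_def)
    moreover have "(c \<ominus> a) \<oplus> (a \<ominus> b) = c \<ominus> b" using assms(1,3) K_closed[OF c] by algebra
    ultimately show ?thesis by simp
  qed
  then show "dvals K b = dvals K a" unfolding dvals_def by auto
  show "b \<notin> K"
  proof
    assume b: "b \<in> K"
    then obtain s where s: "v (b \<ominus> a) = Fin s" using dvals_FinE assms by blast
    moreover have "v (b \<ominus> b) = Pinf" using assms(3) by simp
    ultimately show False using eq[OF b] by simp
  qed
qed

text \<open>Immediacy of E|K without quotients: an approximation c of x with v(x - c) > v(x) shares
  the value of x, and x/c has residue 1. So the value group and the residue field do not
  grow.\<close>

definition immediate :: "'a set \<Rightarrow> bool" where
  "immediate E \<longleftrightarrow> subfield E L \<and> K \<subseteq> E \<and> (\<forall>x\<in>E. x \<noteq> \<zero> \<longrightarrow> (\<exists>c\<in>K. v x < v (x \<ominus> c)))"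

lemma immediate_K: "immediate K"
proof -
  have "v x < v (x \<ominus> x)" if x: "x \<in> K" "x \<noteq> \<zero>" for x
  proof -
    obtain g where "v x = Fin g" using v_FinE x K_closed by blast
    then show ?thesis using x K_closed by simp
  qed
  then show ?thesis using K by (auto simp: immediate_def)
qed

lemma immediate_value:
  assumes "immediate E" "x \<in> E" "v x = Fin g"
  shows "g \<in> vK"
proof -
  have "subfield E L" using assms by (simp add: immediate_def)
  then have xL: "x \<in> carrier L" "x \<noteq> \<zero>" using assms subfieldE(3) by auto
  then obtain c where c: "c \<in> K" "v x < v (x \<ominus> c)" using assms by (auto simp: immediate_def)
  then have "v c = v x" using xL K_closed by (intro v_eq_of_close) auto
  then show ?thesis using c assms by (auto simp: value_group_def)
qed

lemma eval_eq_peval: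
  assumes "set q \<subseteq> carrier L" "x \<in> carrier L"
  shows "eval q x = peval (rev q) x"
  using assms by (induction q) (auto simp: peval_snoc m_comm a_comm)

lemma carrier_univ_polyD:
  assumes "subfield E L" "q \<in> carrier (E[X])"
  shows "set q \<subseteq> E" "set q \<subseteq> carrier L" "q \<noteq> [] \<Longrightarrow> lead_coeff q \<noteq> \<zero>"
proof -
  have *: "q = [] \<or> set q \<subseteq> E \<and> lead_coeff q \<noteq> \<zero>"
    using assms(2) unfolding sym[OF univ_poly_carrier] polynomial_def .
  show 1: "set q \<subseteq> E" using * by auto
  show "set q \<subseteq> carrier L" using 1 subfieldE(3)[OF assms(1)] by blast
  show "q \<noteq> [] \<Longrightarrow> lead_coeff q \<noteq> \<zero>" using * by auto
qed

text \<open>By \<open>far\<close>, the set \<open>dvals K w\<close> is cofinal in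
  \<open>dvals E w\<close>, so the results on purely inseparable steps apply over E and not only
  over K. The third claim passes control of distances from E on to E(w): either x is approximated
  beyond K from E and inherits the distance of an element of E, or its distance is a translate of
  that of w.\<close>

lemma immediate_step:
  assumes E: "immediate E" and w: "w \<in> carrier L" "w [^] p \<in> K" "w \<notin> K" "nomax (dvals K w)"
    and far: "\<And>y. y \<in> E \<Longrightarrow> \<not> close w y"
  shows "immediate (simple_extension E w)" "dimension p E (simple_extension E w)"
    "\<And>x. x \<in> simple_extension E w \<Longrightarrow> x \<notin> K \<Longrightarrow>
       (\<exists>y\<in>E. y \<notin> K \<and> dvals K x = dvals K y) \<or> (\<exists>\<beta>\<in>\<Delta>. down (dvals K x) = (+) \<beta> ` down (dvals K w))"
proof -
  have sE: "subfield E L" "K \<subseteq> E" using E by (auto simp: immediate_def)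
  have EL: "y \<in> carrier L" if "y \<in> E" for y using that subfieldE(3)[OF sE(1)] by auto
  have far': "\<exists>s\<in>dvals K w. v (y \<ominus> w) \<le> Fin s" if "y \<in> E" for y
    using far[OF that] v_diff_commute[of y w] w(1) EL[OF that] by (auto simp: close_def not_less)
  have wE: "w \<notin> E"
  proof
    assume "w \<in> E"
    then show False using far'[of w] w(1) by auto
  qed
  have sub: "dvals K w \<subseteq> dvals E w" using sE(2) by (auto simp: dvals_def)
  have cof: "\<exists>t\<in>dvals K w. s \<le> t" if "s \<in> dvals E w" for s
    using that far' by (auto simp: dvals_def) fastforce
  have nomaxE: "nomax (dvals E w)"
    unfolding nomax_def
  proof (intro conjI ballI)
    show "dvals E w \<noteq> {}" using sub w(4) by (auto simp: nomax_def)
    fix s assume "s \<in> dvals E w"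
    then obtain t where "t \<in> dvals K w" "s \<le> t" using cof by blast
    moreover then obtain t' where "t' \<in> dvals K w" "t < t'" using w(4) by (auto simp: nomax_def)
    ultimately show "\<exists>s'\<in>dvals E w. s < s'" using sub by (meson order_le_less_trans subsetD)
  qed
  have wpE: "w [^] p \<in> E" using w(2) sE(2) by blast
  interpret st: inseparable_step L v E w p
    by (intro inseparable_step.intro approximated.intro approximated_axioms.intro
        inseparable_step_axioms.intro valued_field_axioms valued_field_p_axioms sE(1) w(1) wE nomaxE wpE)
  have ev_ex: "\<exists>c\<in>E. P c" if "\<forall>\<^sub>F c in approx E w. P c" for P
  proof -
    have "\<forall>\<^sub>F \<gamma> in tail (dvals E w). \<exists>c\<in>E. P c"
      using st.eventually_tailI[OF that] by eventually_elim auto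
    then show ?thesis using tail_not_bot[of "dvals E w"] nomaxE by (auto simp: nomax_def)
  qed
  have alg_poly: "[\<one>] @ replicate (p - 1) \<zero> @ [\<ominus> (w [^] p)] \<in> carrier (E[X])"
  proof -
    have "\<ominus> (w [^] p) \<in> E" using st.E_sub(5) w(2) sE(2) by auto
    then show ?thesis using st.E_sub(2,3) unfolding sym[OF univ_poly_carrier] polynomial_def by auto
  qed
  let ?f = "[\<one>] @ replicate (p - 1) \<zero> @ [\<ominus> (w [^] p)]"
  have f0: "eval ?f w = \<zero>"
  proof -
    have "rev ?f = (\<ominus> (w [^] p)) # replicate (p - 1) \<zero> @ [\<one>]" by simp
    moreover have "w \<otimes> w [^] (p - 1) = w [^] p"
      using w p_pos by (metis Suc_diff_1 nat_pow_Suc m_comm nat_pow_closed)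
    ultimately show ?thesis using w carrier_univ_polyD(2)[OF sE(1) alg_poly]
      by (subst eval_eq_peval) (auto simp: peval_monom l_neg)
  qed
  have alg: "(algebraic over E) w" using algebraicI[OF alg_poly _ f0] by simp
  note Irr = IrrE[OF sE(1) w(1) alg]
  have Irr_ne: "Irr E w \<noteq> []" using pirreducibleE(1)[OF subfieldE(1)[OF sE(1)] Irr(1,2)] .
  have deg_le: "degree (Irr E w) \<le> p"
    using pdivides_imp_degree_le[OF subfieldE(1)[OF sE(1)] Irr(1) alg_poly _ Irr_minimal[OF sE(1) w(1) alg alg_poly f0]] p_pos
    by simp
  \<comment> \<open>A nonzero list over E of length at most p cannot vanish at w, by
    \<open>nonzero_peval_w\<close>.\<close>
  have deg_ge: "p \<le> degree (Irr E w)"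
  proof (rule ccontr)
    assume "\<not> ?thesis"
    then have len: "length (rev (Irr E w)) \<le> p" by simp
    have "\<not> set (rev (Irr E w)) \<subseteq> {\<zero>}"
      using Irr(3) Irr_ne by (metis hd_in_set one_not_zero set_rev singletonD subset_eq)
    then obtain \<beta> where "v (peval (rev (Irr E w)) w) = Fin \<beta>"
      using st.nonzero_peval_w[of "rev (Irr E w)"] carrier_univ_polyD(1)[OF sE(1) Irr(1)] len by auto
    moreover have "peval (rev (Irr E w)) w = \<zero>"
      using Irr(4) eval_eq_peval[OF carrier_univ_polyD(2)[OF sE(1) Irr(1)] w(1)] by simp
    ultimately show False by simp
  qed
  have deg: "degree (Irr E w) = p" using deg_le deg_ge by simp
  show dim: "dimension p E (simple_extension E w)"
    using dimension_simple_extension[OF sE(1) w(1) alg] deg by simp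
  have repr: "\<exists>h. set h \<subseteq> E \<and> length h \<le> p \<and> x = peval h w" if "x \<in> simple_extension E w" for x
  proof -
    have "x \<in> (\<lambda>q. eval q w) ` { q \<in> carrier (E[X]). length q \<le> p }"
      using that Span_exp_base[OF sE(1) w(1) alg] Span_eq_eval_img[OF sE(1) w(1), of p] deg by simp
    then obtain q where "q \<in> carrier (E[X])" "length q \<le> p" "x = eval q w" by auto
    then show ?thesis using carrier_univ_polyD[OF sE(1)] eval_eq_peval w(1)
      by (intro exI[of _ "rev q"]) auto
  qed
  \<comment> \<open>Approximation in two stages: x by h(c) in E, then h(c) by an element of
    K.\<close>
  show imm: "immediate (simple_extension E w)"
    unfolding immediate_def
  proof (intro conjI ballI impI)
    show "subfield (simple_extension E w) L" using simple_extension_is_subfield[OF sE(1) w(1)] alg by simp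
    show "K \<subseteq> simple_extension E w" using simple_extension_incl[OF subfieldE(3)[OF sE(1)] w(1)] sE(2) by auto
    fix x assume x: "x \<in> simple_extension E w" "x \<noteq> \<zero>"
    then obtain h where h: "set h \<subseteq> E" "length h \<le> p" "x = peval h w" using repr by blast
    have nz: "\<not> set h \<subseteq> {\<zero>}" using h(3) x(2) peval_zero_list[of h w] w(1) by auto
    obtain \<beta> where b: "v x = Fin \<beta>" "\<forall>\<^sub>F c in approx E w. Fin \<beta> < v (peval h c \<ominus> x)"
      using st.nonzero_peval_w[OF h(1,2) nz] h(3) by blast
    obtain c where c: "c \<in> E" "Fin \<beta> < v (peval h c \<ominus> x)" using ev_ex[OF b(2)] by blast
    let ?y = "peval h c"
    have y: "?y \<in> E" using peval_subring[OF subfieldE(1)[OF sE(1)] c(1) h(1)] .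
    have L: "?y \<in> carrier L" "x \<in> carrier L" using EL[OF y] h(3) w(1) st.E_set_closed[OF h(1)] by auto
    have lt: "v x < v (x \<ominus> ?y)" using c b(1) v_diff_commute[OF L] by simp
    then have vy: "v ?y = v x" using L by (intro v_eq_of_close) auto
    then have "?y \<noteq> \<zero>" using b(1) by auto
    then obtain d where d: "d \<in> K" "v ?y < v (?y \<ominus> d)" using E y by (auto simp: immediate_def)
    have "v x < v ((x \<ominus> ?y) \<oplus> (?y \<ominus> d))"
      using lt d vy L K_closed[OF d(1)] by (intro v_add_gr) auto
    moreover have "(x \<ominus> ?y) \<oplus> (?y \<ominus> d) = x \<ominus> d" using L K_closed[OF d(1)] by algebra
    ultimately show "\<exists>c\<in>K. v x < v (x \<ominus> c)" using d(1) by auto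
  qed
  fix x assume x: "x \<in> simple_extension E w" "x \<notin> K"
  have xL: "x \<in> carrier L" using x simple_extension_in_carrier[OF subfieldE(3)[OF sE(1)] w(1)] by auto
  show "(\<exists>y\<in>E. y \<notin> K \<and> dvals K x = dvals K y) \<or> (\<exists>\<beta>\<in>\<Delta>. down (dvals K x) = (+) \<beta> ` down (dvals K w))"
  proof (cases "\<exists>y\<in>E. close x y")
    case True
    then show ?thesis using close_dvals[OF xL x(2)] EL by metis
  next
    case False
    then have farx: "\<exists>s\<in>dvals K x. v (y \<ominus> x) \<le> Fin s" if "y \<in> E" for y
      using that v_diff_commute[of y x] xL EL[OF that] by (auto simp: close_def not_less)
    have xE: "x \<notin> E"
    proof
      assume "x \<in> E"
      then show False using farx[of x] xL by auto
    qed
    obtain h where h: "set h \<subseteq> E" "length h \<le> p" "x = peval h w" using repr x by blast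
    obtain \<beta> where b: 
      "\<forall>\<^sub>F c in approx E w. \<forall>\<gamma>. v (c \<ominus> w) = Fin \<gamma> \<longrightarrow> v (peval h c \<ominus> x) = Fin (\<beta> + \<gamma>)"
      "\<And>y. y \<in> E \<Longrightarrow> \<forall>\<^sub>F c in approx E w. v (y \<ominus> x) < v (peval h c \<ominus> x)"
      using st.dist_peval_w[OF h(1,2)] xE h(3) by blast
    have pE: "peval h c \<in> E" if "c \<in> E" for c using peval_subring[OF subfieldE(1)[OF sE(1)] that h(1)] .
    \<comment> \<open>Both \<open>\<gamma>\<close> and \<open>\<beta> + \<gamma>\<close> are values
      of elements of the immediate extension E(w), hence lie in vK.\<close>
    have \<beta>: "\<beta> \<in> \<Delta>"
    proof -
      obtain c where c: "c \<in> E" "\<forall>\<gamma>. v (c \<ominus> w) = Fin \<gamma> \<longrightarrow> v (peval h c \<ominus> x) = Fin (\<beta> + \<gamma>)"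
        using ev_ex[OF b(1)] by blast
      obtain \<gamma> where \<gamma>: "v (c \<ominus> w) = Fin \<gamma>" using st.E_nomax[OF c(1)] by auto
      have s': "subring (simple_extension E w) L" using imm by (auto simp: immediate_def subfieldE)
      have "c \<in> simple_extension E w" "w \<in> simple_extension E w" "peval h c \<in> simple_extension E w"
        using c(1) pE[OF c(1)] simple_extension_incl[OF subfieldE(3)[OF sE(1)] w(1)]
          simple_extension_mem[OF subfieldE(1)[OF sE(1)] w(1)] by auto
      then have "c \<ominus> w \<in> simple_extension E w" "peval h c \<ominus> x \<in> simple_extension E w"
        using subringE(5,7)[OF s'] x(1) by (auto simp: a_minus_def)
      then have "\<gamma> \<in> vK" "\<beta> + \<gamma> \<in> vK" using immediate_value[OF imm] c(2) \<gamma> by auto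
      then have "\<beta> \<in> vK" using vK_diff by fastforce
      then show ?thesis using vK_hull by auto
    qed
    \<comment> \<open>The approximants h(c) overtake any given element of K, and by
      \<open>farx\<close> each of them is matched by an element of K. With \<open>cof\<close> this
      makes the two sets of values cofinal up to translation.\<close>
    have "down (dvals K x) = (+) \<beta> ` down (dvals K w)"
    proof (rule down_translate[OF \<beta>])
      fix s assume "s \<in> dvals K x"
      then obtain c0 where c0: "c0 \<in> K" "v (c0 \<ominus> x) = Fin s" by (auto simp: dvals_def)
      have "c0 \<in> E" using c0 sE by auto
      obtain c where c: "c \<in> E" "\<forall>\<gamma>. v (c \<ominus> w) = Fin \<gamma> \<longrightarrow> v (peval h c \<ominus> x) = Fin (\<beta> + \<gamma>)"
        "v (c0 \<ominus> x) < v (peval h c \<ominus> x)"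
        using ev_ex[OF eventually_conj[OF b(1) b(2)[OF \<open>c0 \<in> E\<close>]]] by blast
      obtain \<gamma> where \<gamma>: "\<gamma> \<in> dvals E w" "v (c \<ominus> w) = Fin \<gamma>" using st.E_nomax[OF c(1)] by auto
      then have "s < \<beta> + \<gamma>" using c c0 by auto
      moreover obtain t where "t \<in> dvals K w" "\<gamma> \<le> t" using cof[OF \<gamma>(1)] by blast
      moreover have "\<beta> + \<gamma> \<le> \<beta> + t" using \<open>\<gamma> \<le> t\<close> by simp
      ultimately show "\<exists>t\<in>dvals K w. s \<le> \<beta> + t" by (metis less_imp_le order_trans)
    next
      fix t assume "t \<in> dvals K w"
      then have t: "t \<in> dvals E w" using sub by auto
      obtain c where c: "c \<in> E" "\<forall>\<gamma>. v (c \<ominus> w) = Fin \<gamma> \<longrightarrow> v (peval h c \<ominus> x) = Fin (\<beta> + \<gamma>)"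
        "\<exists>\<gamma>\<in>dvals E w. v (c \<ominus> w) = Fin \<gamma> \<and> t < \<gamma>"
        using ev_ex[OF eventually_conj[OF b(1) st.eventually_approxI[OF eventually_tail_greater[OF nomaxE t]]]]
        by blast
      then obtain \<gamma> where \<gamma>: "t < \<gamma>" "v (peval h c \<ominus> x) = Fin (\<beta> + \<gamma>)" by auto
      obtain s where "s \<in> dvals K x" "v (peval h c \<ominus> x) \<le> Fin s" using farx[OF pE[OF c(1)]] by blast
      moreover have "\<beta> + t \<le> \<beta> + \<gamma>" using \<gamma> by simp
      ultimately show "\<exists>s\<in>dvals K x. \<beta> + t \<le> s" using \<gamma>(2) by (metis less_eq_extended.simps(1) order_trans)
    qed
    then show ?thesis using \<beta> by blast
  qed
qed

section \<open>The fields K^(1/p^l) and chains of immediate extensions\<close>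

definition rootf :: "nat \<Rightarrow> 'a set" where
  "rootf l = {x \<in> carrier L. x [^] (p ^ l) \<in> K}"

lemma subfield_rootf: "subfield (rootf l) L"
proof (rule subfieldI')
  show "subring (rootf l) L"
  proof (rule subringI)
    show "\<one> \<in> rootf l" using K_sub(3) by (simp add: rootf_def)
    fix h assume h: "h \<in> rootf l"
    have "(\<zero> \<ominus> h) [^] (p ^ l) = \<zero> [^] (p ^ l) \<ominus> h [^] (p ^ l)"
      using h by (intro frobenius_power_diff) (auto simp: rootf_def)
    moreover have "\<zero> [^] (p ^ l) \<ominus> h [^] (p ^ l) \<in> K"
      using h K_diff[OF K_pow[OF K_sub(2)]] by (simp add: rootf_def)
    ultimately show "\<ominus> h \<in> rootf l" using h by (simp add: rootf_def a_minus_def)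
  next
    fix h1 h2 assume h: "h1 \<in> rootf l" "h2 \<in> rootf l"
    show "h1 \<otimes> h2 \<in> rootf l" using h K_sub(6) by (simp add: rootf_def nat_pow_distrib)
    show "h1 \<oplus> h2 \<in> rootf l" using h K_sub(7) by (simp add: rootf_def frobenius_power_add)
  qed (auto simp: rootf_def)
  fix k assume k: "k \<in> rootf l - {\<zero>}"
  then have "(inv k) [^] (p ^ l) = inv (k [^] (p ^ l))"
    by (intro inv_nat_pow) (auto simp: rootf_def)
  moreover have "inv (k [^] (p ^ l)) \<in> K"
    using k nat_pow_eq_zeroD[of k "p ^ l"] by (intro K_inv) (auto simp: rootf_def)
  ultimately show "inv k \<in> rootf l" using k by (auto simp: rootf_def field_Units)
qed

lemma root_field_eq: "root_field L K p = rootf 1"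
  by (simp add: root_field_def rootf_def)

definition wimm :: "'a set" where
  "wimm = {a \<in> rootf 1. a \<notin> K \<and> nomax (dvals K a)}"

text \<open>The last clause is the induction invariant: the classes seen in E are those of the
  elements already adjoined. A further element with a new class therefore satisfies the hypothesis
  \<open>far\<close> of \<open>immediate_step\<close>.\<close>

lemma immediate_chain:
  assumes "set ws \<subseteq> wimm" "distinct (map (\<lambda>w. cls (down (dvals K w))) ws)"
  shows "\<exists>E. immediate E \<and> E \<subseteq> rootf 1 \<and> dimension (p ^ length ws) K E \<and>
    (\<forall>x\<in>E. x \<notin> K \<longrightarrow> (\<exists>w\<in>set ws. cls (down (dvals K x)) = cls (down (dvals K w))))"
  using assms
proof (induction ws)
  case Nil
  have "K \<subseteq> rootf 1" using K_closed K_pow by (auto simp: rootf_def)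
  then show ?case using immediate_K dimension_one[OF K] by (intro exI[of _ K]) auto
next
  case (Cons w ws)
  obtain E where E: "immediate E" "E \<subseteq> rootf 1" "dimension (p ^ length ws) K E"
    "\<And>x. x \<in> E \<Longrightarrow> x \<notin> K \<Longrightarrow> \<exists>w\<in>set ws. cls (down (dvals K x)) = cls (down (dvals K w))"
    using Cons by auto
  have w: "w \<in> carrier L" "w [^] p \<in> K" "w \<notin> K" "nomax (dvals K w)" "w \<in> rootf 1"
    using Cons.prems by (auto simp: wimm_def rootf_def)
  \<comment> \<open>An element y of E approximating w beyond K would have the same distance as w,
    whose class does not occur in E.\<close>
  have far: "\<not> close w y" if y: "y \<in> E" for y
  proof
    assume c: "close w y"
    have "y \<in> carrier L" using y E(2) by (auto simp: rootf_def)
    then have "dvals K y = dvals K w" "y \<notin> K" using close_dvals[OF w(1,3) _ c] by auto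
    then show False using E(4)[OF y] Cons.prems(2) by auto
  qed
  note step = immediate_step[OF E(1) w(1-4), rotated]
  have sE: "subfield E L" using E(1) by (simp add: immediate_def)
  have "dimension (p ^ length ws * p) K (simple_extension E w)"
    by (rule telescopic_base[OF K sE E(3) step(2)[OF far]])
  moreover have "simple_extension E w \<subseteq> rootf 1"
    by (rule simple_extension_subring_incl[OF subfieldE(1)[OF subfield_rootf] E(2) w(5)])
  moreover have "\<exists>w'\<in>set (w # ws). cls (down (dvals K x)) = cls (down (dvals K w'))"
    if "x \<in> simple_extension E w" "x \<notin> K" for x
    using step(3)[OF that far]
  proof
    assume "\<exists>y\<in>E. y \<notin> K \<and> dvals K x = dvals K y"
    then show ?thesis using E(4) by auto
  next
    assume "\<exists>\<beta>\<in>\<Delta>. down (dvals K x) = (+) \<beta> ` down (dvals K w)"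
    then show ?thesis using cls_translate by auto
  qed
  ultimately show ?case using step(1)[OF far] by (intro exI[of _ "simple_extension E w"]) (auto simp: mult.commute)
qed

end

section \<open>Residue fields and the fundamental inequality\<close>

context valued_field
begin

definition int_ring :: "'a set \<Rightarrow> 'a set" where
  "int_ring F = {x \<in> F. 0 \<le> v x}"

definition res :: "'a set \<Rightarrow> 'a \<Rightarrow> 'a set" where
  "res F x = valuation_ideal v F +>\<^bsub>valuation_ring L v F\<^esub> x"

lemma valuation_ring_eq: "valuation_ring L v F = L\<lparr>carrier := int_ring F\<rparr>"
  by (simp add: valuation_ring_def int_ring_def)

lemma subring_int_ring:
  assumes "subfield F L"
  shows "subring (int_ring F) L"
proof (rule subringI)
  note sub = subringE[OF subfieldE(1)[OF assms]]
  show "int_ring F \<subseteq> carrier L" using sub(1) by (auto simp: int_ring_def)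
  show "\<one> \<in> int_ring F" using sub by (auto simp: int_ring_def)
  fix h assume h: "h \<in> int_ring F"
  then have hL: "h \<in> carrier L" using sub(1) by (auto simp: int_ring_def)
  then show "\<ominus> h \<in> int_ring F" using h sub by (auto simp: int_ring_def)
  fix k assume k: "k \<in> int_ring F"
  then have kL: "k \<in> carrier L" using sub(1) by (auto simp: int_ring_def)
  show "h \<oplus> k \<in> int_ring F" using h k hL kL sub v_add_ge' by (auto simp: int_ring_def)
  show "h \<otimes> k \<in> int_ring F" using h k hL kL sub
    by (cases "v h"; cases "v k") (auto simp: int_ring_def v_mult zero_extended_def)
qed

lemma domain_valuation_ring: "subfield F L \<Longrightarrow> domain (valuation_ring L v F)"
  unfolding valuation_ring_eq by (intro subring_is_domain subring_int_ring)

lemma ideal_valuation_ideal: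
  assumes F: "subfield F L"
  shows "ideal (valuation_ideal v F) (valuation_ring L v F)"
proof (rule idealI)
  interpret V: domain "valuation_ring L v F" using domain_valuation_ring[OF F] .
  note sub = subringE[OF subfieldE(1)[OF F]]
  have sg: "subgroup (valuation_ideal v F) (add_monoid L)"
  proof (rule add.subgroupI)
    show "valuation_ideal v F \<subseteq> carrier L" using sub(1) by (auto simp: valuation_ideal_def)
    show "valuation_ideal v F \<noteq> {}" using sub(2) by (auto simp: valuation_ideal_def zero_extended_def)
    fix h assume h: "h \<in> valuation_ideal v F"
    then have hL: "h \<in> carrier L" using sub(1) by (auto simp: valuation_ideal_def)
    then show "\<ominus> h \<in> valuation_ideal v F" using h sub by (auto simp: valuation_ideal_def)
    fix k assume k: "k \<in> valuation_ideal v F"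
    then have kL: "k \<in> carrier L" using sub(1) by (auto simp: valuation_ideal_def)
    show "h \<oplus> k \<in> valuation_ideal v F" using h k hL kL sub v_add_gr by (auto simp: valuation_ideal_def)
  qed
  have "valuation_ideal v F \<subseteq> int_ring F" by (auto simp: valuation_ideal_def int_ring_def)
  then have "subgroup (valuation_ideal v F) ((add_monoid L)\<lparr>carrier := int_ring F\<rparr>)"
    using add.subgroup_incl[OF sg subring.axioms(1)[OF subring_int_ring[OF F]]] by simp
  then show "subgroup (valuation_ideal v F) (add_monoid (valuation_ring L v F))"
    by (simp add: valuation_ring_eq)
  show "ring (valuation_ring L v F)" by (rule V.ring_axioms)
  have mult: "a \<otimes> x \<in> valuation_ideal v F" if "a \<in> valuation_ideal v F" "x \<in> int_ring F" for a x
  proof -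
    have L: "a \<in> carrier L" "x \<in> carrier L" using that sub(1) by (auto simp: valuation_ideal_def int_ring_def)
    then have "0 < v (a \<otimes> x)" using that
      by (cases "v a"; cases "v x") (auto simp: valuation_ideal_def int_ring_def v_mult zero_extended_def add_pos_nonneg)
    then show ?thesis using that sub by (auto simp: valuation_ideal_def int_ring_def)
  qed
  fix a x assume a: "a \<in> valuation_ideal v F" "x \<in> carrier (valuation_ring L v F)"
  then show "a \<otimes>\<^bsub>valuation_ring L v F\<^esub> x \<in> valuation_ideal v F" using mult by (simp add: valuation_ring_eq)
  have "a \<in> carrier L" "x \<in> carrier L" using a sub(1) by (auto simp: valuation_ideal_def valuation_ring_eq int_ring_def)
  then have "x \<otimes> a = a \<otimes> x" by (rule m_comm[rotated])
  then show "x \<otimes>\<^bsub>valuation_ring L v F\<^esub> a \<in> valuation_ideal v F" using mult a by (simp add: valuation_ring_eq)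
qed

lemma res_hom:
  assumes F: "subfield F L"
  shows "ring_hom_ring (valuation_ring L v F) (residue_field L v F) (res F)"
  unfolding residue_field_def res_def using ideal.rcos_ring_hom_ring[OF ideal_valuation_ideal[OF F]] .

lemma res_surj:
  assumes F: "subfield F L"
  shows "carrier (residue_field L v F) = res F ` int_ring F"
  unfolding residue_field_def res_def FactRing_def A_RCOSETS_def' valuation_ring_eq by auto

lemma res_zero_iff:
  assumes F: "subfield F L" and x: "x \<in> int_ring F"
  shows "res F x = \<zero>\<^bsub>residue_field L v F\<^esub> \<longleftrightarrow> 0 < v x"
proof -
  interpret I: ideal "valuation_ideal v F" "valuation_ring L v F" using ideal_valuation_ideal[OF F] .
  have xV: "x \<in> carrier (valuation_ring L v F)" using x by (simp add: valuation_ring_eq)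
  have z: "\<zero>\<^bsub>residue_field L v F\<^esub> = valuation_ideal v F" by (simp add: residue_field_def FactRing_def)
  show ?thesis
  proof
    assume "res F x = \<zero>\<^bsub>residue_field L v F\<^esub>"
    then have "x \<in> valuation_ideal v F" using I.rcos_const_imp_mem[OF xV] by (simp add: z res_def)
    then show "0 < v x" by (simp add: valuation_ideal_def)
  next
    assume "0 < v x"
    then have "x \<in> valuation_ideal v F" using x by (simp add: valuation_ideal_def int_ring_def)
    then show "res F x = \<zero>\<^bsub>residue_field L v F\<^esub>" using I.a_rcos_const by (simp add: z res_def)
  qed
qed

lemma v_unit_inv:
  assumes F: "subfield F L" and x: "x \<in> F" "v x = 0"
  shows "inv x \<in> int_ring F" "x \<otimes> inv x = \<one>"
proof -
  have xL: "x \<in> carrier L" "x \<noteq> \<zero>" using x subfieldE(3)[OF F] by (auto simp: zero_extended_def)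
  then have "v (inv x) = 0" using x by (simp add: v_inv zero_extended_def)
  then show "inv x \<in> int_ring F" using subfield_m_inv(1)[OF F, of x] x xL by (simp add: int_ring_def)
  show "x \<otimes> inv x = \<one>" using xL by (simp add: field_Units)
qed

lemma field_residue_field:
  assumes F: "subfield F L"
  shows "field (residue_field L v F)"
proof -
  interpret V: domain "valuation_ring L v F" using domain_valuation_ring[OF F] .
  interpret I: ideal "valuation_ideal v F" "valuation_ring L v F" using ideal_valuation_ideal[OF F] .
  interpret R: cring "residue_field L v F" using I.quotient_is_cring[OF V.is_cring] by (simp add: residue_field_def)
  interpret h: ring_hom_ring "valuation_ring L v F" "residue_field L v F" "res F" using res_hom[OF F] .
  note sub = subringE[OF subfieldE(1)[OF F]]
  have one: "\<one> \<in> int_ring F" using sub by (simp add: int_ring_def)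
  have h1: "res F \<one> = \<one>\<^bsub>residue_field L v F\<^esub>" using h.hom_one by (simp add: valuation_ring_eq)
  show ?thesis
  proof (rule R.cring_fieldI2)
    show "\<zero>\<^bsub>residue_field L v F\<^esub> \<noteq> \<one>\<^bsub>residue_field L v F\<^esub>"
      using res_zero_iff[OF F one] h1 by (metis order_less_irrefl v_one)
    fix a assume a: "a \<in> carrier (residue_field L v F)" "a \<noteq> \<zero>\<^bsub>residue_field L v F\<^esub>"
    then obtain x where x: "x \<in> int_ring F" "a = res F x" using res_surj[OF F] by auto
    then have "v x = 0" using a(2) res_zero_iff[OF F x(1)] by (auto simp: int_ring_def)
    then have i: "inv x \<in> int_ring F" "x \<otimes> inv x = \<one>" using v_unit_inv[OF F] x by (auto simp: int_ring_def)
    have "a \<otimes>\<^bsub>residue_field L v F\<^esub> res F (inv x) = res F (x \<otimes> inv x)"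
      using h.hom_mult[of x "inv x"] x i by (simp add: valuation_ring_eq)
    then show "\<exists>b\<in>carrier (residue_field L v F). a \<otimes>\<^bsub>residue_field L v F\<^esub> b = \<one>\<^bsub>residue_field L v F\<^esub>"
      using i h1 res_surj[OF F] by auto
  qed
qed

lemma subfield_residue_subfield:
  assumes F: "subfield F L" and K: "subfield K L" and KF: "K \<subseteq> F"
  shows "subfield (residue_subfield L v F K) (residue_field L v F)"
proof -
  interpret R: field "residue_field L v F" using field_residue_field[OF F] .
  interpret h: ring_hom_ring "valuation_ring L v F" "residue_field L v F" "res F" using res_hom[OF F] .
  have eq: "residue_subfield L v F K = res F ` int_ring K"
    by (simp add: residue_subfield_def res_def[abs_def] valuation_ring_eq)
  have KFi: "int_ring K \<subseteq> int_ring F" using KF by (auto simp: int_ring_def)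
  have sr: "subring (int_ring K) (valuation_ring L v F)"
  proof (rule h.R.ring_incl_imp_subring)
    show "int_ring K \<subseteq> carrier (valuation_ring L v F)" using KFi by (simp add: valuation_ring_eq)
    show "ring (valuation_ring L v F\<lparr>carrier := int_ring K\<rparr>)"
      using subring_is_ring[OF subring_int_ring[OF K]] by (simp add: valuation_ring_eq)
  qed
  show ?thesis
  proof (rule R.subfieldI')
    show "subring (residue_subfield L v F K) (residue_field L v F)"
      unfolding eq by (rule h.img_is_subring[OF sr])
    fix k assume k: "k \<in> residue_subfield L v F K - {\<zero>\<^bsub>residue_field L v F\<^esub>}"
    then obtain x where x: "x \<in> int_ring K" "k = res F x" by (auto simp: eq)
    then have xF: "x \<in> int_ring F" using KFi by auto
    have "v x = 0" using k x res_zero_iff[OF F xF] by (auto simp: int_ring_def)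
    then have i: "inv x \<in> int_ring K" "x \<otimes> inv x = \<one>" using v_unit_inv[OF K] x by (auto simp: int_ring_def)
    have iF: "inv x \<in> int_ring F" using i KFi by auto
    have h1: "res F \<one> = \<one>\<^bsub>residue_field L v F\<^esub>" using h.hom_one by (simp add: valuation_ring_eq)
    have "k \<otimes>\<^bsub>residue_field L v F\<^esub> res F (inv x) = \<one>\<^bsub>residue_field L v F\<^esub>"
      using h.hom_mult[of x "inv x"] x xF i iF h1 by (simp add: valuation_ring_eq)
    moreover have "k \<in> carrier (residue_field L v F)" "res F (inv x) \<in> carrier (residue_field L v F)"
      using res_surj[OF F] xF iF x by auto
    ultimately have "inv\<^bsub>residue_field L v F\<^esub> k = res F (inv x)" by (intro R.comm_inv_char)
    then show "inv\<^bsub>residue_field L v F\<^esub> k \<in> residue_subfield L v F K" using i by (simp add: eq)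
  qed
qed

end

section \<open>Linear combinations and independence of products\<close>

context ring
begin

text \<open>The residue map is a homomorphism from the valuation ring as a separate structure, while
  independence is wanted in L; this identifies the linear combinations of the two.\<close>

lemma combine_subring_consistent: 
  assumes "subring A R"
  shows "ring.combine (R\<lparr>carrier := A\<rparr>) Ks Us = combine Ks Us"
  by (induction Ks Us rule: combine.induct)
    (simp_all add: ring.combine.simps[OF subring_is_ring[OF assms]])

lemma combine_diff:
  assumes "length Ks = length Us" "length Ks' = length Us" "set Ks \<subseteq> carrier R" "set Ks' \<subseteq> carrier R" 
    "set Us \<subseteq> carrier R"
  shows "combine Ks Us \<ominus> combine Ks' Us = combine (map2 (\<lambda>a b. a \<ominus> b) Ks Ks') Us"
  using assms
proof (induction Us arbitrary: Ks Ks')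
  case (Cons u Us)
  obtain k Ks2 where k: "Ks = k # Ks2" using Cons.prems by (cases Ks) auto
  obtain k' Ks2' where k': "Ks' = k' # Ks2'" using Cons.prems by (cases Ks') auto
  define a where "a = combine Ks2 Us"
  define b where "b = combine Ks2' Us"
  have ab: "a \<in> carrier R" "b \<in> carrier R" using Cons.prems k k' by (auto simp: a_def b_def intro!: combine_in_carrier)
  have "combine (map2 (\<lambda>a b. a \<ominus> b) Ks2 Ks2') Us = a \<ominus> b"
    using Cons k k' by (simp add: a_def b_def)
  moreover have "(k \<otimes> u \<oplus> a) \<ominus> (k' \<otimes> u \<oplus> b) = (k \<ominus> k') \<otimes> u \<oplus> (a \<ominus> b)"
    using ab Cons.prems k k' 
    by (simp add: a_minus_def minus_add l_distr l_minus a_ac)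
  ultimately show ?case by (simp add: k k' a_def b_def)
qed (simp add: a_minus_def)

end

context valued_field
begin

lemma combine_v_gr:
  assumes "length Ks = length Us" "set Ks \<subseteq> carrier L" "set Us \<subseteq> carrier L"
    "\<And>k. k \<in> set Ks \<Longrightarrow> 0 < v k" "\<And>u. u \<in> set Us \<Longrightarrow> 0 \<le> v u"
  shows "0 < v (combine Ks Us)"
  using assms
proof (induction Ks Us rule: list_induct2)
  case (Cons k Ks u Us)
  have "0 < v (k \<otimes> u)" using Cons.prems(1,2) Cons.prems(3)[of k] Cons.prems(4)[of u]
    by (cases "v k"; cases "v u") (auto simp: v_mult zero_extended_def add_pos_nonneg)
  moreover have "0 < v (combine Ks Us)" using Cons by auto
  ultimately show ?case using Cons.prems by (auto intro!: v_add_gr combine_in_carrier)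
qed (auto simp: zero_extended_def)

lemma combine_scale_right:
  assumes "set Ks \<subseteq> carrier L" "set Us \<subseteq> carrier L" "x \<in> carrier L"
  shows "combine Ks (map ((\<otimes>) x) Us) = x \<otimes> combine Ks Us"
  using assms
proof (induction Ks Us rule: combine.induct)
  case (1 k Ks u Us)
  define a where "a = combine Ks Us"
  have "a \<in> carrier L" using 1 by (auto simp: a_def intro!: combine_in_carrier)
  moreover have "combine Ks (map ((\<otimes>) x) Us) = x \<otimes> a" using 1 by (auto simp: a_def)
  ultimately show ?case using 1(2-) by (simp flip: a_def) algebra
qed auto

end

context valued_subfield_p
begin

text \<open>After scaling, coefficients from \<open>E\<close> can be replaced by coefficients from \<open>K\<close> up to
  positive value.\<close>

lemma combine_value:
  assumes imm: "immediate E" and F: "subfield F L" "E \<subseteq> F"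
    and ys: "set ys \<subseteq> int_ring F" 
    and ind: "ring.independent (residue_field L v F) (residue_subfield L v F K) (map (res F) ys)"
    and cs: "set cs \<subseteq> E" "length cs = length ys" "\<not> set cs \<subseteq> {\<zero>}"
  shows "\<exists>g\<in>vK. v (combine cs ys) = Fin g"
proof -
  have sE: "subfield E L" "K \<subseteq> E" using imm by (auto simp: immediate_def)
  note subE = subringE[OF subfieldE(1)[OF sE(1)]]
  have ysL: "set ys \<subseteq> carrier L" using ys subfieldE(3)[OF F(1)] by (auto simp: int_ring_def)
  have csL: "set cs \<subseteq> carrier L" using cs(1) subE(1) by auto
  \<comment> \<open>Dividing by a coefficient of least value makes all coefficients integral and one
    of them equal to 1, so the reduced relation stays nontrivial.\<close>
  let ?V = "v ` (set cs - {\<zero>})"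
  have V: "finite ?V" "?V \<noteq> {}" using cs(3) by auto
  obtain c where c: "c \<in> set cs" "c \<noteq> \<zero>" "v c = Min ?V"
  proof -
    obtain c where "Min ?V = v c" "c \<in> set cs - {\<zero>}" using Min_in[OF V] by (rule imageE)
    then show ?thesis using that[of c] by auto
  qed
  have cL: "c \<in> carrier L" "c \<in> E" using c cs(1) csL by auto
  have min: "v c \<le> v d" if "d \<in> set cs" for d
  proof (cases "d = \<zero>")
    case False
    then show ?thesis using that c V by (auto intro!: Min_le)
  qed simp
  obtain \<gamma> where \<gamma>: "v c = Fin \<gamma>" using v_FinE c cL by blast
  have \<gamma>K: "\<gamma> \<in> vK" using immediate_value[OF imm cL(2) \<gamma>] .
  have ic: "inv c \<in> carrier L" "inv c \<in> E" "v (inv c) = Fin (- \<gamma>)" "c \<otimes> inv c = \<one>"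
  proof -
    show "inv c \<in> carrier L" "inv c \<in> E" "c \<otimes> inv c = \<one>"
      using c(2) cL subfield_m_inv(1)[OF sE(1), of c] by (auto simp: field_Units)
    have "v (inv c) = - v c" using v_inv[OF cL(1) c(2)] .
    then show "v (inv c) = Fin (- \<gamma>)" unfolding \<gamma> by simp
  qed
  define ds where "ds = map ((\<otimes>) (inv c)) cs"
  have dsE: "set ds \<subseteq> E" using cs(1) ic subE by (auto simp: ds_def)
  have dsL: "set ds \<subseteq> carrier L" using dsE subE(1) by auto
  have ds_ge: "0 \<le> v d" if d: "d \<in> set ds" for d
  proof -
    obtain e where e: "e \<in> set cs" "d = inv c \<otimes> e" using d by (auto simp: ds_def)
    have "v d = Fin (- \<gamma>) + v e" using e ic csL by (auto simp: v_mult)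
    moreover have "Fin \<gamma> \<le> v e" using min[OF e(1)] \<gamma> by simp
    ultimately show ?thesis by (cases "v e") (auto simp: zero_extended_def)
  qed
  have one_ds: "\<one> \<in> set ds" using c ic cL by (auto simp: ds_def m_comm image_iff intro!: bexI[of _ c])
  \<comment> \<open>If v(d) = 0, immediacy supplies k; if v(d) > 0, zero will do.\<close>
  have "\<exists>k\<in>K. 0 \<le> v k \<and> 0 < v (d \<ominus> k)" if d: "d \<in> set ds" for d
  proof (cases "0 < v d")
    case True
    have "d \<ominus> \<zero> = d" using d dsL by (auto simp: a_minus_def)
    then show ?thesis using True K_sub(2) by (intro bexI[of _ \<zero>]) (auto simp: zero_extended_def)
  next
    case False
    then have v0: "v d = 0" using ds_ge[OF d] by auto
    then have "d \<noteq> \<zero>" by (auto simp: zero_extended_def)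
    then obtain k where k: "k \<in> K" "v d < v (d \<ominus> k)" using imm d dsE by (auto simp: immediate_def)
    then have "v k = v d" using d dsL K_closed by (intro v_eq_of_close) auto
    then show ?thesis using k v0 by (intro bexI[of _ k]) auto
  qed
  then obtain kf where kf: "\<And>d. d \<in> set ds \<Longrightarrow> kf d \<in> K" "\<And>d. d \<in> set ds \<Longrightarrow> 0 \<le> v (kf d)"
    "\<And>d. d \<in> set ds \<Longrightarrow> 0 < v (d \<ominus> kf d)" by metis
  define ks where "ks = map kf ds"
  have ksK: "set ks \<subseteq> int_ring K" using kf by (auto simp: ks_def int_ring_def)
  have ksL: "set ks \<subseteq> carrier L" using ksK K_closed by (auto simp: int_ring_def)
  have len: "length ds = length ys" "length ks = length ys" using cs by (auto simp: ds_def ks_def)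
  have diff: "0 < v (combine ds ys \<ominus> combine ks ys)"
  proof -
    have "combine ds ys \<ominus> combine ks ys = combine (map2 (\<lambda>a b. a \<ominus> b) ds ks) ys"
      by (rule combine_diff) (use len dsL ksL ysL in auto)
    also have "0 < v \<dots>"
    proof (rule combine_v_gr)
      show "set (map2 (\<lambda>a b. a \<ominus> b) ds ks) \<subseteq> carrier L"
      proof
        fix z assume "z \<in> set (map2 (\<lambda>a b. a \<ominus> b) ds ks)"
        then obtain a b where ab: "(a, b) \<in> set (zip ds ks)" "z = a \<ominus> b" by auto
        have "a \<in> carrier L" "b \<in> carrier L"
          using set_zip_leftD[OF ab(1)] set_zip_rightD[OF ab(1)] dsL ksL by auto
        then show "z \<in> carrier L" using ab(2) by simp
      qed
      fix k assume "k \<in> set (map2 (\<lambda>a b. a \<ominus> b) ds ks)"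
      then obtain d where "d \<in> set ds" "k = d \<ominus> kf d" by (auto simp: ks_def zip_map2 zip_same_conv_map)
      then show "0 < v k" using kf by auto
    qed (use len ysL ys in \<open>auto simp: int_ring_def\<close>)
    finally show ?thesis .
  qed
  have F': "subring (int_ring F) L" using subring_int_ring[OF F(1)] .
  interpret R: field "residue_field L v F" using field_residue_field[OF F(1)] .
  interpret h: ring_hom_ring "valuation_ring L v F" "residue_field L v F" "res F" using res_hom[OF F(1)] .
  have KF: "K \<subseteq> F" using sE F by auto
  have sub: "subfield (residue_subfield L v F K) (residue_field L v F)"
    using subfield_residue_subfield[OF F(1) K KF] .
  have ksF: "set ks \<subseteq> int_ring F" using ksK KF by (auto simp: int_ring_def)
  have comb_hom: "R.combine (map (res F) ks) (map (res F) ys) = res F (combine ks ys)"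
  proof -
    have "R.combine (map (res F) ks) (map (res F) ys) = res F (h.R.combine ks ys)"
      using h.combine_hom[of ks ys] ksF ys by (simp add: valuation_ring_eq)
    then show ?thesis using combine_subring_consistent[OF F', of ks ys] by (simp add: valuation_ring_eq)
  qed
  have comb_int: "combine ks ys \<in> int_ring F"
    using h.R.combine_in_carrier[of ks ys] ksF ys combine_subring_consistent[OF F', of ks ys]
    by (simp add: valuation_ring_eq)
  have "res F (combine ks ys) \<noteq> \<zero>\<^bsub>residue_field L v F\<^esub>"
  proof
    assume "res F (combine ks ys) = \<zero>\<^bsub>residue_field L v F\<^esub>"
    then have "R.combine (map (res F) ks) (map (res F) ys) = \<zero>\<^bsub>residue_field L v F\<^esub>" using comb_hom by simp
    moreover have "set (map (res F) ks) \<subseteq> residue_subfield L v F K"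
      using ksK by (auto simp: residue_subfield_def res_def valuation_ring_eq)
    ultimately have "set (take (length (map (res F) ys)) (map (res F) ks)) \<subseteq> {\<zero>\<^bsub>residue_field L v F\<^esub>}"
      using R.independent_imp_trivial_combine[OF sub ind] by blast
    then have z: "res F k = \<zero>\<^bsub>residue_field L v F\<^esub>" if "k \<in> set ks" for k
      using that len by auto
    \<comment> \<open>The approximation of the coefficient 1 is a unit, so its residue is a nonzero
      coefficient, contrary to \<open>z\<close>.\<close>
    have k1: "kf \<one> \<in> set ks" using one_ds by (auto simp: ks_def)
    have "0 < v (\<one> \<ominus> kf \<one>)" using kf one_ds by auto
    then have "v (kf \<one>) = v \<one>" using K_closed kf(1)[OF one_ds] by (intro v_eq_of_close) auto
    then show False using z[OF k1] res_zero_iff[OF F(1), of "kf \<one>"] k1 ksF by auto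
  qed
  then have v0: "v (combine ks ys) = 0" using res_zero_iff[OF F(1) comb_int] comb_int by (auto simp: int_ring_def)
  have dL: "combine ds ys \<in> carrier L" "combine ks ys \<in> carrier L" "combine cs ys \<in> carrier L" 
    using dsL ksL ysL csL by (auto intro!: combine_in_carrier)
  have "v (combine ds ys) = v (combine ks ys)"
    using diff v0 dL v_diff_commute[OF dL(1,2)] by (intro v_eq_of_close) auto
  moreover have "combine ds ys = inv c \<otimes> combine cs ys"
    unfolding ds_def using combine_r_distr[OF csL ysL ic(1)] by simp
  ultimately have "Fin (- \<gamma>) + v (combine cs ys) = 0" using v0 ic dL by (simp add: v_mult)
  then have "v (combine cs ys) = Fin \<gamma>"
    by (cases "v (combine cs ys)") (auto simp: zero_extended_def)
  then show ?thesis using \<gamma>K by auto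
qed

text \<open>The linear algebra behind the fundamental inequality, over E instead of K. Multiplying
  \<open>ys\<close> by x gives a block whose nonzero combinations have values in the coset v(x) +
  vK. Distinct cosets keep the blocks independent of each other, and the second claim carries the
  cosets through the induction.\<close>

lemma independent_products:
  assumes imm: "immediate E" and F: "subfield F L" "E \<subseteq> F"
    and ys: "set ys \<subseteq> int_ring F" 
    and ind: "ring.independent (residue_field L v F) (residue_subfield L v F K) (map (res F) ys)"
    and xs: "set xs \<subseteq> F - {\<zero>}" "distinct xs"
      "\<And>x y g h. x \<in> set xs \<Longrightarrow> y \<in> set xs \<Longrightarrow> x \<noteq> y \<Longrightarrow> v x = Fin g \<Longrightarrow> v y = Fin h \<Longrightarrow> g - h \<notin> vK"
  shows "independent E (concat (map (\<lambda>x. map ((\<otimes>) x) ys) xs))"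
    "\<And>z. z \<in> Span E (concat (map (\<lambda>x. map ((\<otimes>) x) ys) xs)) \<Longrightarrow> z \<noteq> \<zero> \<Longrightarrow>
      \<exists>x\<in>set xs. \<exists>g h. v x = Fin g \<and> h \<in> vK \<and> v z = Fin (g + h)"
proof -
  have sE: "subfield E L" "K \<subseteq> E" using imm by (auto simp: immediate_def)
  have EL: "E \<subseteq> carrier L" using subfieldE(3)[OF sE(1)] .
  have FL: "F \<subseteq> carrier L" using subfieldE(3)[OF F(1)] .
  have ysL: "set ys \<subseteq> carrier L" using ys FL by (auto simp: int_ring_def)
  let ?W = "\<lambda>xs. concat (map (\<lambda>x. map ((\<otimes>) x) ys) xs)"
  have block: "independent E (map ((\<otimes>) x) ys)"
    "\<And>z. z \<in> Span E (map ((\<otimes>) x) ys) \<Longrightarrow> z \<noteq> \<zero> \<Longrightarrow> \<exists>g h. v x = Fin g \<and> h \<in> vK \<and> v z = Fin (g + h)"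
    if x: "x \<in> F - {\<zero>}" for x
  proof -
    have xL: "x \<in> carrier L" "x \<noteq> \<zero>" using x FL by auto
    have bL: "set (map ((\<otimes>) x) ys) \<subseteq> carrier L" using xL ysL by auto
    show "independent E (map ((\<otimes>) x) ys)"
    proof (rule ccontr)
      assume "dependent E (map ((\<otimes>) x) ys)"
      then obtain Ks where Ks: "length Ks = length (map ((\<otimes>) x) ys)" "combine Ks (map ((\<otimes>) x) ys) = \<zero>"
        "set Ks \<subseteq> E" "set Ks \<noteq> {\<zero>}"
        using dependent_imp_non_trivial_combine[OF sE(1) bL] by metis
      have ne: "Ks \<noteq> []" 
      proof
        assume "Ks = []"
        then have "map ((\<otimes>) x) ys = []" using Ks(1) by simp
        then show False using \<open>dependent E (map ((\<otimes>) x) ys)\<close> by auto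
      qed
      then have "\<not> set Ks \<subseteq> {\<zero>}" using Ks(4) by (cases Ks) auto
      then obtain g where g: "v (combine Ks ys) = Fin g"
        using combine_value[OF imm F ys ind Ks(3)] Ks(1) by auto
      have "x \<otimes> combine Ks ys = \<zero>"
        using combine_scale_right[of Ks ys x] Ks EL ysL xL by auto
      moreover have "combine Ks ys \<in> carrier L" using Ks EL ysL by (auto intro!: combine_in_carrier)
      ultimately have "combine Ks ys = \<zero>" using xL integral by blast
      then show False using g by simp
    qed
    fix z assume z: "z \<in> Span E (map ((\<otimes>) x) ys)" "z \<noteq> \<zero>"
    then obtain Ks where Ks: "set Ks \<subseteq> E" "length Ks = length (map ((\<otimes>) x) ys)" "z = combine Ks (map ((\<otimes>) x) ys)"
      using Span_mem_iff_length_version[OF sE(1) bL] by auto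
    have z_eq: "z = x \<otimes> combine Ks ys"
      using combine_scale_right[of Ks ys x] Ks EL ysL xL by auto
    have "\<not> set Ks \<subseteq> {\<zero>}"
    proof
      assume "set Ks \<subseteq> {\<zero>}"
      then have "Ks = replicate (length ys) \<zero>" using Ks(2) by (intro replicate_eqI) auto
      then have "combine Ks ys = \<zero>" using combine_replicate[OF ysL] by simp
      then show False using z z_eq xL by simp
    qed
    then obtain h where h: "h \<in> vK" "v (combine Ks ys) = Fin h"
      using combine_value[OF imm F ys ind Ks(1)] Ks(2) by auto
    obtain g where g: "v x = Fin g" using v_FinE xL by blast
    have "combine Ks ys \<in> carrier L" using Ks EL ysL by (auto intro!: combine_in_carrier)
    then have "v z = Fin (g + h)" using z_eq xL g h by (simp add: v_mult)
    then show "\<exists>g h. v x = Fin g \<and> h \<in> vK \<and> v z = Fin (g + h)" using g h by blast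
  qed
  have main: "independent E (?W xs) \<and> (\<forall>z\<in>Span E (?W xs). z \<noteq> \<zero> \<longrightarrow>
      (\<exists>x\<in>set xs. \<exists>g h. v x = Fin g \<and> h \<in> vK \<and> v z = Fin (g + h)))"
    using xs
  proof (induction xs)
    case (Cons x xs)
    let ?B = "map ((\<otimes>) x) ys"
    have xF: "x \<in> F - {\<zero>}" using Cons.prems by auto
    have IH: "independent E (?W xs)" "\<And>z. z \<in> Span E (?W xs) \<Longrightarrow> z \<noteq> \<zero> \<Longrightarrow> 
        \<exists>x\<in>set xs. \<exists>g h. v x = Fin g \<and> h \<in> vK \<and> v z = Fin (g + h)"
    proof -
      have prems: "set xs \<subseteq> F - {\<zero>}" "distinct xs"
        "\<And>x y g h. x \<in> set xs \<Longrightarrow> y \<in> set xs \<Longrightarrow> x \<noteq> y \<Longrightarrow> v x = Fin g \<Longrightarrow> v y = Fin h \<Longrightarrow> g - h \<notin> vK"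
        using Cons.prems(1,2) apply simp_all using Cons.prems(3) by (meson list.set_intros(2))
      have "independent E (?W xs) \<and> (\<forall>z\<in>Span E (?W xs). z \<noteq> \<zero> \<longrightarrow>
          (\<exists>x\<in>set xs. \<exists>g h. v x = Fin g \<and> h \<in> vK \<and> v z = Fin (g + h)))"
        by (rule Cons.IH[OF prems(1,2)]) (rule prems(3))
      then show "independent E (?W xs)" "\<And>z. z \<in> Span E (?W xs) \<Longrightarrow> z \<noteq> \<zero> \<Longrightarrow> 
        \<exists>x\<in>set xs. \<exists>g h. v x = Fin g \<and> h \<in> vK \<and> v z = Fin (g + h)"
        by blast+
    qed
    have WL: "set (?W xs) \<subseteq> carrier L" using Cons.prems(1) FL ysL by auto
    have BL: "set ?B \<subseteq> carrier L" using xF FL ysL by auto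
    \<comment> \<open>Equal values would put two distinct representatives into the same coset of
      vK.\<close>
    have differ: "v z1 \<noteq> v z2" if zz: "z1 \<in> Span E ?B" "z1 \<noteq> \<zero>" "z2 \<in> Span E (?W xs)" "z2 \<noteq> \<zero>" for z1 z2
    proof
      assume eq: "v z1 = v z2"
      obtain g h where 1: "v x = Fin g" "h \<in> vK" "v z1 = Fin (g + h)" using block(2)[OF xF zz(1,2)] by blast
      obtain x' g' h' where 2: "x' \<in> set xs" "v x' = Fin g'" "h' \<in> vK" "v z2 = Fin (g' + h')"
        using IH(2)[OF zz(3,4)] by blast
      have "g - g' = h' - h" using eq 1 2 by (simp add: algebra_simps)
      then have "g - g' \<in> vK" using 1 2 vK_diff by simp
      moreover have "x \<noteq> x'" using 2 Cons.prems(2) by auto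
      ultimately show False using Cons.prems(3)[of x x' g g'] 1 2 by auto
    qed
    have inter: "Span E ?B \<inter> Span E (?W xs) = {\<zero>}"
      using differ Span_subgroup_props(2)[OF sE(1) BL] Span_subgroup_props(2)[OF sE(1) WL] by blast
    have ind': "independent E (?W (x # xs))"
      using independent_append[OF sE(1) block(1)[OF xF] IH(1) inter] by simp
    have "\<exists>x\<in>set (x # xs). \<exists>g h. v x = Fin g \<and> h \<in> vK \<and> v z = Fin (g + h)"
      if z: "z \<in> Span E (?W (x # xs))" "z \<noteq> \<zero>" for z
    proof -
      have "z \<in> Span E ?B <+>\<^bsub>L\<^esub> Span E (?W xs)"
        using z(1) Span_append_eq_set_add[OF sE(1) BL WL] by simp
      then obtain z1 z2 where z12: "z1 \<in> Span E ?B" "z2 \<in> Span E (?W xs)" "z = z1 \<oplus> z2"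
        unfolding set_add_def' by auto
      have zL: "z1 \<in> carrier L" "z2 \<in> carrier L"
        using z12 Span_subgroup_props(1)[OF sE(1)] BL WL by blast+
      consider "z1 = \<zero>" | "z2 = \<zero>" | "z1 \<noteq> \<zero>" "z2 \<noteq> \<zero>" by blast
      then show ?thesis
      proof cases
        case 1
        then have "z = z2" using z12 zL by simp
        then show ?thesis using IH(2)[OF z12(2)] z(2) by auto
      next
        case 2
        then have "z = z1" using z12 zL by simp
        then show ?thesis using block(2)[OF xF z12(1)] z(2) by auto
      next
        case 3
        then have "v z1 < v z2 \<or> v z2 < v z1" using differ[OF z12(1) _ z12(2)] by (simp add: neq_iff)
        then have "v z = v z1 \<or> v z = v z2"
          using v_add_eq[of z1 z2] v_add_eq[of z2 z1] zL z12(3) by (auto simp: a_comm)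
        then show ?thesis
        proof
          assume "v z = v z1"
          then show ?thesis using block(2)[OF xF z12(1) 3(1)] by auto
        next
          assume "v z = v z2"
          then show ?thesis using IH(2)[OF z12(2) 3(2)] by auto
        qed
      qed
    qed
    then show ?case using ind' by blast
  qed auto
  then show "independent E (?W xs)" by blast
  fix z assume "z \<in> Span E (?W xs)" "z \<noteq> \<zero>"
  then show "\<exists>x\<in>set xs. \<exists>g h. v x = Fin g \<and> h \<in> vK \<and> v z = Fin (g + h)" using main by blast
qed

end

lemma list_in_image:
  assumes "set ys \<subseteq> f ` A"
  shows "\<exists>xs. set xs \<subseteq> A \<and> ys = map f xs"
proof (intro exI conjI)
  show "set (map (inv_into A f) ys) \<subseteq> A" using assms by (auto intro: inv_into_into)
  have "map f (map (inv_into A f) ys) = ys"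
    unfolding map_map using assms by (intro map_idI) (auto intro: f_inv_into_f)
  then show "ys = map f (map (inv_into A f) ys)" by simp
qed

text \<open>Bounding repetition-free lists gives finiteness too, which \<open>card\<close> cannot
  express since it is zero on infinite sets.\<close>

lemma finite_card_le_if_distinct_lists:
  assumes "\<And>xs. set xs \<subseteq> A \<Longrightarrow> distinct xs \<Longrightarrow> length xs \<le> (m::nat)"
  shows "finite A \<and> card A \<le> m"
proof -
  have "finite A"
  proof (rule ccontr)
    assume "infinite A"
    then obtain B where B: "B \<subseteq> A" "finite B" "card B = Suc m" using infinite_arbitrarily_large by blast
    then obtain xs where "set xs = B" "distinct xs" using finite_distinct_list by blast
    then show False using assms[of xs] B distinct_card[of xs] by simp
  qed
  moreover obtain xs where "set xs = A" "distinct xs" using finite_distinct_list calculation by blast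
  then have "card A \<le> m" using assms[of xs] distinct_card[of xs] by simp
  ultimately show ?thesis by simp
qed

context valued_subfield_p
begin

text \<open>The case E = K of the product lemma with 1 as the only value representative.\<close>

lemma independent_one:
  assumes F: "subfield F L" "K \<subseteq> F" and n: "dimension n K F"
    and Us: "ring.independent (residue_field L v F) (residue_subfield L v F K) Us"
  shows "length Us \<le> n" "\<exists>ys. set ys \<subseteq> int_ring F \<and> Us = map (res F) ys"
proof -
  interpret R: field "residue_field L v F" using field_residue_field[OF F(1)] .
  have "set Us \<subseteq> res F ` int_ring F" using R.independent_in_carrier[OF Us] res_surj[OF F(1)] by simp
  then show "\<exists>ys. set ys \<subseteq> int_ring F \<and> Us = map (res F) ys" by (rule list_in_image)
  then obtain ys where ys: "set ys \<subseteq> int_ring F" "Us = map (res F) ys" by blast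
  have F1: "\<one> \<in> F" using subringE(3)[OF subfieldE(1)[OF F(1)]] .
  have "independent K (concat (map (\<lambda>x. map ((\<otimes>) x) ys) [\<one>]))"
    by (rule independent_products(1)[OF immediate_K F ys(1)]) (use Us ys(2) F1 in auto)
  then have "independent K (map ((\<otimes>) \<one>) ys)" by simp
  moreover have "map ((\<otimes>) \<one>) ys = ys"
    using ys(1) subfieldE(3)[OF F(1)] by (intro map_idI) (auto simp: int_ring_def)
  ultimately have "independent K ys" by simp
  then have "length ys \<le> n"
    using independent_length_le_dimension[OF K n] ys(1) by (auto simp: int_ring_def)
  then show "length Us \<le> n" using ys(2) by simp
qed

text \<open>The number \<open>inertia_degree\<close> comes from \<open>dim\<close>, which says
  something only once a dimension is known to exist. The bound n on independent families yields a
  longest one, and this is a basis.\<close>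

lemma residue_basis:
  assumes F: "subfield F L" "K \<subseteq> F" and n: "dimension n K F"
  obtains ys where "set ys \<subseteq> int_ring F" "length ys = inertia_degree L v K F"
    "ring.independent (residue_field L v F) (residue_subfield L v F K) (map (res F) ys)"
proof -
  interpret R: field "residue_field L v F" using field_residue_field[OF F(1)] .
  let ?k = "residue_subfield L v F K"
  have sub: "subfield ?k (residue_field L v F)" using subfield_residue_subfield[OF F(1) K F(2)] .
  define P where "P = (\<lambda>l. \<exists>Us. R.independent ?k Us \<and> length Us = l)"
  have P0: "P 0" by (auto simp: P_def)
  have bound: "l \<le> n" if "P l" for l using independent_one(1)[OF F n] that by (auto simp: P_def)
  define l where "l = Greatest P"
  have l: "P l" unfolding l_def using P0 bound by (rule GreatestI_nat)
  have l_max: "l' \<le> l" if "P l'" for l' unfolding l_def using that bound by (rule Greatest_le_nat)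
  obtain Us where Us: "R.independent ?k Us" "length Us = l" using l unfolding P_def by blast
  have "R.Span ?k Us = carrier (residue_field L v F)"
  proof
    show "R.Span ?k Us \<subseteq> carrier (residue_field L v F)"
      using R.Span_subgroup_props(1)[OF sub R.independent_in_carrier[OF Us(1)]] .
    show "carrier (residue_field L v F) \<subseteq> R.Span ?k Us"
    proof
      fix u assume u: "u \<in> carrier (residue_field L v F)"
      show "u \<in> R.Span ?k Us"
      proof (rule ccontr)
        assume "u \<notin> R.Span ?k Us"
        then have "R.independent ?k (u # Us)" using Us u by (intro R.li_Cons)
        then have "Suc l \<le> l" using Us(2) by (intro l_max) (auto simp: P_def intro!: exI[of _ "u # Us"])
        then show False by simp
      qed
    qed
  qed
  then have "R.dimension l ?k (carrier (residue_field L v F))"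
    using R.dimension_independent[OF Us(1)] Us(2) by simp
  then have "inertia_degree L v K F = l"
    using R.dimI[OF sub] by (simp add: inertia_degree_def extension_degree_def)
  moreover obtain ys where "set ys \<subseteq> int_ring F" "Us = map (res F) ys"
    using independent_one(2)[OF F n Us(1)] by blast
  ultimately show ?thesis using that[of ys] Us by simp
qed

text \<open>A nonzero \<open>ramification_index\<close> guarantees finitely many cosets, because an
  infinite set has \<open>card\<close> zero.\<close>

lemma coset_representatives:
  assumes F: "F \<subseteq> carrier L" and e: "ramification_index v K F \<noteq> 0"
  obtains xs where "length xs = ramification_index v K F" "set xs \<subseteq> F - {\<zero>}" "distinct xs"
      "\<And>x y g h. x \<in> set xs \<Longrightarrow> y \<in> set xs \<Longrightarrow> x \<noteq> y \<Longrightarrow> v x = Fin g \<Longrightarrow> v y = Fin h \<Longrightarrow> g - h \<notin> vK"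
proof -
  let ?A = "(\<lambda>g. (+) g ` vK) ` value_group v F"
  have card: "card ?A = ramification_index v K F" by (simp add: ramification_index_def)
  then have fin: "finite ?A" using e by (metis card.infinite)
  obtain As where As: "set As = ?A" "distinct As" using finite_distinct_list[OF fin] by (elim exE conjE)
  have "\<forall>C\<in>?A. \<exists>x\<in>F. \<exists>g. v x = Fin g \<and> C = (+) g ` vK" by (auto simp: value_group_def)
  then obtain xf where xf: "\<And>C. C \<in> ?A \<Longrightarrow> xf C \<in> F \<and> (\<exists>g. v (xf C) = Fin g \<and> C = (+) g ` vK)"
    by metis
  have inj: "C = C'" if "C \<in> ?A" "C' \<in> ?A" "v (xf C) = Fin g" "v (xf C') = Fin h" "g - h \<in> vK" for C C' g h
  proof -
    have eq: "C = (+) g ` vK" "C' = (+) h ` vK" using xf[OF that(1)] xf[OF that(2)] that(3,4) by auto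
    have "(+) (g - h) ` vK = vK"
    proof
      show "(+) (g - h) ` vK \<subseteq> vK" using that(5) vK_add by auto
      show "vK \<subseteq> (+) (g - h) ` vK"
      proof
        fix x assume "x \<in> vK"
        then have "x - (g - h) \<in> vK" using that(5) by (rule vK_diff)
        then show "x \<in> (+) (g - h) ` vK" by (intro image_eqI[of _ _ "x - (g - h)"]) auto
      qed
    qed
    then have "(+) (h + (g - h)) ` vK = (+) h ` vK" by (simp only: image_add_add[symmetric])
    moreover have "h + (g - h) = g" by simp
    ultimately show ?thesis using eq by (simp only:)
  qed
  show ?thesis
  proof
    show "length (map xf As) = ramification_index v K F" using distinct_card[OF As(2)] As(1) card by simp
    show "set (map xf As) \<subseteq> F - {\<zero>}"
    proof
      fix x assume "x \<in> set (map xf As)"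
      then obtain C where C: "C \<in> ?A" "x = xf C" using As(1) by auto
      then obtain g where "x \<in> F" "v x = Fin g" using xf[OF C(1)] by auto
      then show "x \<in> F - {\<zero>}" by auto
    qed
    have "inj_on xf (set As)"
    proof (rule inj_onI)
      fix C C' assume C: "C \<in> set As" "C' \<in> set As" "xf C = xf C'"
      then obtain g where "v (xf C) = Fin g" using xf[of C] As by auto
      then show "C = C'" using inj[of C C' g g] C As vK_zero by auto
    qed
    then show "distinct (map xf As)" using As by (simp add: distinct_map)
    fix x y g h assume xy: "x \<in> set (map xf As)" "y \<in> set (map xf As)" "x \<noteq> y" "v x = Fin g" "v y = Fin h"
    then obtain C C' where "C \<in> ?A" "x = xf C" "C' \<in> ?A" "y = xf C'" using As by auto
    then show "g - h \<notin> vK" using inj[of C C' g h] xy by auto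
  qed
qed

text \<open>A list spanning F over K also spans it over E and can be thinned out to a basis.\<close>

lemma dimension_over_intermediate:
  assumes E: "subfield E L" "K \<subseteq> E" "E \<subseteq> F" and F: "subfield F L" and n: "dimension n K F"
  shows "\<exists>d. dimension d E F"
proof -
  obtain Us where Us: "set Us \<subseteq> carrier L" "Span K Us = F" using exists_base[OF K n] by blast
  have UF: "set Us \<subseteq> F" using Span_base_incl[OF K Us(1)] Us(2) by simp
  have "Span K Us \<subseteq> Span E Us"
  proof
    fix x assume "x \<in> Span K Us"
    then obtain Ks where "set Ks \<subseteq> K" "length Ks = length Us" "x = combine Ks Us"
      using Span_mem_iff_length_version[OF K Us(1)] by auto
    then show "x \<in> Span E Us" using Span_mem_iff_length_version[OF E(1) Us(1)] E(2) by blast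
  qed
  moreover have "Span E Us \<subseteq> F"
  proof
    fix x assume "x \<in> Span E Us"
    then obtain Ks where Ks: "set Ks \<subseteq> E" "length Ks = length Us" "x = combine Ks Us"
      using Span_mem_iff_length_version[OF E(1) Us(1)] by auto
    have "combine Ks Us \<in> F" if "set Ks \<subseteq> F" "set Us \<subseteq> F" for Ks Us
      using that by (induction Ks Us rule: combine.induct) (auto simp: subringE[OF subfieldE(1)[OF F]])
    then show "x \<in> F" using Ks E(3) UF by blast
  qed
  ultimately have "Span E Us = F" using Us(2) by auto
  then obtain Vs where "independent E Vs" "Span E Vs = F" using filter_base[OF E(1) Us(1)] by metis
  then show ?thesis using dimension_independent by metis
qed

text \<open>Let s be the length of \<open>ws\<close>. The degree n is p^m e f by the defect and p^s
  [F:E] by the tower, and the e f products independent over E give e f \<le> [F:E].\<close>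

lemma length_wimm_le:
  assumes fin: "finite_dimension K (rootf 1)" and d: "defect L v K (rootf 1) = of_nat (p ^ m)"
    and ws: "set ws \<subseteq> wimm" "distinct (map (\<lambda>w. cls (down (dvals K w))) ws)"
  shows "length ws \<le> m"
proof -
  let ?F = "rootf 1"
  have F: "subfield ?F L" by (rule subfield_rootf)
  have KF: "K \<subseteq> ?F" using K_closed K_pow by (auto simp: rootf_def)
  obtain n where n: "dimension n K ?F" using fin by (auto simp: finite_dimension_def)
  define e where "e = ramification_index v K ?F"
  define f where "f = inertia_degree L v K ?F"
  have deg: "extension_degree L K ?F = n" using dimI[OF K n] by (simp add: extension_degree_def)
  have q: "(of_nat n :: rat) / (of_nat e * of_nat f) = of_nat (p ^ m)"
    using d deg by (simp add: defect_def e_def f_def)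
  have pm: "(of_nat (p ^ m) :: rat) \<noteq> 0" using p_pos by simp
  \<comment> \<open>Division by zero yields zero, so the nonzero defect p^m forces both factors to
    be positive.\<close>
  have ef: "e \<noteq> 0" "f \<noteq> 0"
  proof -
    show "e \<noteq> 0"
    proof
      assume "e = 0"
      then show False using q pm by simp
    qed
    show "f \<noteq> 0"
    proof
      assume "f = 0"
      then show False using q pm by simp
    qed
  qed
  then have "(of_nat n :: rat) = of_nat (p ^ m) * (of_nat e * of_nat f)"
    using q by (simp add: field_simps)
  then have n_eq: "n = p ^ m * (e * f)" by (metis of_nat_eq_iff of_nat_mult)
  obtain E where E: "immediate E" "E \<subseteq> ?F" "dimension (p ^ length ws) K E"
    using immediate_chain[OF ws] by blast
  have sE: "subfield E L" "K \<subseteq> E" using E(1) by (auto simp: immediate_def)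
  obtain dd where dd: "dimension dd E ?F" using dimension_over_intermediate[OF sE E(2) F n] by blast
  have n_eq2: "n = p ^ length ws * dd"
    using dimension_is_inj[OF K n telescopic_base[OF K sE(1) E(3) dd]] .
  obtain ys where ys: "set ys \<subseteq> int_ring ?F" "length ys = f"
    "ring.independent (residue_field L v ?F) (residue_subfield L v ?F K) (map (res ?F) ys)"
    using residue_basis[OF F KF n] unfolding f_def by blast
  obtain xs where xs: "length xs = e" "set xs \<subseteq> ?F - {\<zero>}" "distinct xs"
      "\<And>x y g h. x \<in> set xs \<Longrightarrow> y \<in> set xs \<Longrightarrow> x \<noteq> y \<Longrightarrow> v x = Fin g \<Longrightarrow> v y = Fin h \<Longrightarrow> g - h \<notin> vK"
    using coset_representatives[OF subfieldE(3)[OF F]] ef(1) unfolding e_def by blast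
  let ?W = "concat (map (\<lambda>x. map ((\<otimes>) x) ys) xs)"
  have "independent E ?W" by (rule independent_products(1)[OF E(1) F E(2) ys(1,3) xs(2-3)]) (rule xs(4))
  moreover have "set ?W \<subseteq> ?F"
    using xs(2) ys(1) subringE(6)[OF subfieldE(1)[OF F]] by (auto simp: int_ring_def)
  ultimately have "length ?W \<le> dd" using independent_length_le_dimension[OF sE(1) dd] by blast
  moreover have "length ?W = e * f"
  proof -
    have "length (concat (map (\<lambda>x. map ((\<otimes>) x) ys) zs)) = length zs * length ys" for zs
      by (induction zs) auto
    then show ?thesis using xs ys by simp
  qed
  ultimately have "p ^ length ws * (e * f) \<le> p ^ m * (e * f)"
    using n_eq n_eq2 by (metis mult_le_mono2)
  then have "p ^ length ws \<le> p ^ m" using ef by simp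
  then show ?thesis by (rule power_le_imp_le_exp[OF prime_gt_1_nat[OF prime_p]])
qed

lemma card_wimm_classes:
  assumes fin: "finite_dimension K (rootf 1)" and d: "defect L v K (rootf 1) = of_nat (p ^ m)"
  shows "finite ((\<lambda>w. cls (down (dvals K w))) ` wimm) \<and> card ((\<lambda>w. cls (down (dvals K w))) ` wimm) \<le> m"
proof (rule finite_card_le_if_distinct_lists)
  fix xs assume xs: "set xs \<subseteq> (\<lambda>w. cls (down (dvals K w))) ` wimm" "distinct xs"
  obtain ws where "set ws \<subseteq> wimm" "xs = map (\<lambda>w. cls (down (dvals K w))) ws"
    using list_in_image[OF xs(1)] by blast
  then show "length xs \<le> m" using length_wimm_le[OF fin d, of ws] xs by simp
qed

end

section \<open>Cuts bounded by convex subgroups\<close>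

context valued_field
begin

text \<open>For X^n itself the entries are exactly the binomial terms. A lower term a_j X^j
  contributes to entry k an integer multiple of a_j t^(j - k), of value at least (n - k)\<gamma> +
  \<open>\<epsilon>\<close>. The excess \<open>\<epsilon>\<close> is an extended value so that it
  can be infinite when all lower coefficients vanish.\<close>

lemma shift_estimate:
  assumes "set fs \<subseteq> carrier L" "length fs = Suc n" "last fs = \<one>" "t \<in> carrier L" "v t = Fin \<gamma>"
    "\<And>j. j < n \<Longrightarrow> Fin (nmul (n - j) \<gamma>) + \<epsilon> \<le> v (fs ! j)" "k \<le> n"
  shows "Fin (nmul (n - k) \<gamma>) + \<epsilon> \<le> v (shift t fs ! k \<ominus> nmult (n choose k) (t [^] (n - k)))"
  using assms(1-3,6-)
proof (induction n arbitrary: fs k)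
  case 0
  then obtain a where "fs = [a]" by (metis length_0_conv length_Suc_conv)
  then have "fs = [\<one>]" "k = 0" using 0 by auto
  then show ?case by simp
next
  case (Suc n)
  obtain a as where fs: "fs = a # as" using Suc.prems(2) by (cases fs) auto
  have as: "set as \<subseteq> carrier L" "length as = Suc n" "a \<in> carrier L" "as \<noteq> []" "last as = \<one>"
    using Suc.prems fs by (auto split: if_splits)
  let ?bs = "shift t as"
  let ?e = "\<lambda>k. ?bs ! k \<ominus> nmult (n choose k) (t [^] (n - k))"
  have bsL: "?bs ! k \<in> carrier L" if "k \<le> n" for k
    using shift_closed[OF assms(4) as(1)] that as(2) by (metis le_imp_less_Suc length_shift nth_mem subsetD)
  have eL: "?e k \<in> carrier L" if "k \<le> n" for k using bsL[OF that] assms(4) by auto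
  have IH: "Fin (nmul (n - k) \<gamma>) + \<epsilon> \<le> v (?e k)" if "k \<le> n" for k
  proof (rule Suc.IH[OF as(1,2,5) _ that])
    fix j assume "j < n"
    then show "Fin (nmul (n - j) \<gamma>) + \<epsilon> \<le> v (as ! j)" using Suc.prems(4)[of "Suc j"] fs by simp
  qed
  have te: "Fin (nmul (Suc n - k) \<gamma>) + \<epsilon> \<le> v (t \<otimes> ?e k)" if k: "k \<le> n" for k
  proof -
    have "Fin \<gamma> + (Fin (nmul (n - k) \<gamma>) + \<epsilon>) \<le> Fin \<gamma> + v (?e k)" using IH[OF k] by (simp add: Fin_le_add_cancel)
    moreover have "Fin \<gamma> + (Fin (nmul (n - k) \<gamma>) + \<epsilon>) = Fin (nmul (Suc n - k) \<gamma>) + \<epsilon>"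
      using k by (cases \<epsilon>) (auto simp: Suc_diff_le algebra_simps)
    ultimately show ?thesis using assms(4,5) eL[OF k] by (simp add: v_mult)
  qed
  have shift_fs: "shift t fs = comb a t ?bs" using fs by simp
  have ne: "?bs \<noteq> []" using as by simp
  show ?case
  proof (cases k)
    case 0
    have "shift t fs ! 0 = a \<oplus> t \<otimes> ?bs ! 0" unfolding shift_fs by (rule comb_nth_0[OF ne])
    moreover have "t [^] Suc n = t \<otimes> t [^] n" using assms(4) by (simp add: m_comm)
    moreover define b where "b = ?bs ! 0"
    moreover define u where "u = t [^] n"
    moreover have "(a \<oplus> t \<otimes> b) \<ominus> t \<otimes> u = a \<oplus> t \<otimes> (b \<ominus> u)"
    proof -
      have "b \<in> carrier L" "u \<in> carrier L" using bsL[of 0] assms(4) by (auto simp: b_def u_def)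
      then show ?thesis using as(3) assms(4) by algebra
    qed
    moreover have "?e 0 = b \<ominus> u" using assms(4) by (simp add: b_def u_def)
    ultimately have eq: "shift t fs ! k \<ominus> nmult (Suc n choose k) (t [^] (Suc n - k)) = a \<oplus> t \<otimes> ?e 0"
      using 0 assms(4) by (simp del: nat_pow_Suc)
    have "Fin (nmul (Suc n - k) \<gamma>) + \<epsilon> \<le> v a" using Suc.prems(4)[of 0] fs 0 by simp
    moreover have "Fin (nmul (Suc n - k) \<gamma>) + \<epsilon> \<le> v (t \<otimes> ?e 0)" using te[of 0] 0 by simp
    ultimately show ?thesis unfolding eq using as(3) assms(4) eL[of 0] by (intro v_add_ge') auto
  next
    case (Suc k')
    then have k': "k' \<le> n" using Suc.prems by auto
    show ?thesis
    proof (cases "k' = n")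
      case True
      have "comb a t ?bs ! length ?bs = last ?bs" by (rule comb_nth_last[OF ne])
      also have "last ?bs = \<one>" using last_shift[OF as(4)] as(5) by simp
      finally have "shift t fs ! k = \<one>" using True Suc shift_fs as(2) by simp
      then show ?thesis using True Suc by simp
    next
      case False
      then have k'n: "Suc k' \<le> n" using k' by auto
      define m where "m = n - Suc k'"
      have m: "n - k' = Suc m" "Suc n - k = Suc m" using k'n Suc by (auto simp: m_def)
      have s: "shift t fs ! k = ?bs ! k' \<oplus> t \<otimes> ?bs ! Suc k'"
        unfolding shift_fs Suc using k'n as(2) by (intro comb_nth_Suc) simp
      define b1 where "b1 = ?bs ! k'"
      define b2 where "b2 = ?bs ! Suc k'"
      define u where "u = nmult (n choose k') (t [^] Suc m)"
      define w where "w = nmult (n choose Suc k') (t [^] m)"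
      have L: "b1 \<in> carrier L" "b2 \<in> carrier L" "u \<in> carrier L" "w \<in> carrier L"
        using bsL[OF k'] bsL[OF k'n] assms(4) by (auto simp: b1_def b2_def u_def w_def)
      have "nmult (Suc n choose k) (t [^] (Suc n - k)) = u \<oplus> t \<otimes> w"
      proof -
        have "t \<otimes> w = nmult (n choose Suc k') (t [^] Suc m)"
          using assms(4) by (simp add: w_def add_pow_rdistr m_comm)
        moreover have "u \<oplus> nmult (n choose Suc k') (t [^] Suc m) = nmult (Suc n choose Suc k') (t [^] Suc m)"
          using assms(4) by (simp add: u_def add.nat_pow_mult)
        ultimately show ?thesis unfolding m(2) unfolding Suc by (simp only:)
      qed
      then have eq: "shift t fs ! k \<ominus> nmult (Suc n choose k) (t [^] (Suc n - k)) = (b1 \<ominus> u) \<oplus> t \<otimes> (b2 \<ominus> w)"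
        unfolding s b1_def[symmetric] b2_def[symmetric] using L assms(4) by (simp only:) algebra
      have e: "?e k' = b1 \<ominus> u" "?e (Suc k') = b2 \<ominus> w"
        using m(1) by (simp_all add: b1_def b2_def u_def w_def m_def del: nat_pow_Suc)
      have "Fin (nmul (Suc n - k) \<gamma>) + \<epsilon> \<le> v (b1 \<ominus> u)" using IH[OF k'] e m by simp
      moreover have "Fin (nmul (Suc n - k) \<gamma>) + \<epsilon> \<le> v (t \<otimes> (b2 \<ominus> w))" using te[OF k'n] e Suc by simp
      ultimately show ?thesis unfolding eq using L assms(4) by (intro v_add_ge') auto
    qed
  qed
qed

end

context valued_subfield_p
begin

text \<open>The lower cut set immediately below the convex subgroup \<open>H\<close>; adding \<open>\<delta>\<close> gives the exceptional
  distances \<open>{x. x < \<delta> + H}\<close>.\<close>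

definition below :: "'g set \<Rightarrow> 'g set" where
  "below H = {x \<in> \<Delta>. \<forall>h\<in>H. x < h}"

text \<open>The hypothesis \<open>star\<close> is the negation of the existence of some \<gamma> in
  S with q s < (q - 1)\<gamma> + \<delta> for all s in S, the situation in which a radical closer
  than all of K is found. The subgroup sought is the invariance group of the cut.\<close>

lemma cut_below:
  assumes S: "S \<subseteq> vK" "nomax S" and \<delta>: "\<delta> \<in> \<Delta>" "\<And>s. s \<in> S \<Longrightarrow> s < \<delta>" and q: "q > 0"
    and star: "\<And>s. s \<in> S \<Longrightarrow> \<exists>s'\<in>S. nmul (q - 1) s + \<delta> \<le> nmul q s'"
  shows "\<exists>H\<in>proper_convex_subgroups vK. down S = (+) \<delta> ` below H"
proof -
  define D where "D = down S"
  have D_down: "y \<in> D" if "x \<in> D" "y \<in> \<Delta>" "y \<le> x" for x y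
    using that by (auto simp: D_def down_def) (meson order_trans)
  have D_hull: "x \<in> \<Delta>" if "x \<in> D" for x using that by (simp add: D_def down_def)
  have S_D: "S \<subseteq> D" using S vK_hull by (auto simp: D_def down_def)
  have D_less: "x < \<delta>" if x: "x \<in> D" for x
  proof -
    obtain s where "s \<in> S" "x \<le> s" using x by (auto simp: D_def down_def)
    then show ?thesis using \<delta>(2)[of s] by simp
  qed
  obtain s0 where s0: "s0 \<in> S" using S by (auto simp: nomax_def)
  \<comment> \<open>The translations of \<open>\<Delta>\<close> preserving the cut. The rank counts
    subgroups of vK, hence the trace \<open>H\<close> on vK.\<close>
  define HH where "HH = {\<alpha> \<in> \<Delta>. \<forall>x\<in>D. x + \<alpha> \<in> D \<and> x - \<alpha> \<in> D}"
  define H where "H = HH \<inter> vK"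
  have HH_nmul: "nmul n \<alpha> \<in> HH" if \<alpha>: "\<alpha> \<in> HH" for \<alpha> n
  proof (induction n)
    case 0
    then show ?case using hull_zero by (simp add: HH_def)
  next
    case (Suc n)
    have "x + (\<alpha> + nmul n \<alpha>) \<in> D" "x - (\<alpha> + nmul n \<alpha>) \<in> D" if x: "x \<in> D" for x
    proof -
      have "(x + \<alpha>) + nmul n \<alpha> \<in> D" "(x - \<alpha>) - nmul n \<alpha> \<in> D" using x \<alpha> Suc by (auto simp: HH_def)
      then show "x + (\<alpha> + nmul n \<alpha>) \<in> D" "x - (\<alpha> + nmul n \<alpha>) \<in> D" by (simp_all add: algebra_simps)
    qed
    then show ?case using Suc \<alpha> hull_add by (auto simp: HH_def)
  qed
  have pos: "\<epsilon> \<in> HH" if "0 \<le> \<epsilon>" "\<epsilon> \<in> \<Delta>" "\<And>x. x \<in> D \<Longrightarrow> x + \<epsilon> \<in> D" for \<epsilon>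
  proof -
    have "x - \<epsilon> \<in> D" if "x \<in> D" for x
      by (rule D_down[OF that]) (use \<open>0 \<le> \<epsilon>\<close> \<open>\<epsilon> \<in> \<Delta>\<close> that D_hull hull_diff in auto)
    then show ?thesis using that by (simp add: HH_def)
  qed
  text \<open>If \<open>x \<notin> D\<close> lies below \<open>\<delta>\<close>, then \<open>\<delta> - x\<close> leaves \<open>D\<close> invariant: by the hypothesis one can
    move up inside \<open>S\<close> from any element by \<open>(\<delta> - x) / (q - 1)\<close>, and this \<open>q - 1\<close> times.\<close>
  have gap: "\<delta> - x \<in> HH" if x: "x \<in> \<Delta>" "x \<notin> D" "x < \<delta>" for x
  proof (rule pos)
    define \<epsilon> where "\<epsilon> = \<delta> - x"
    show "0 \<le> \<delta> - x" "\<delta> - x \<in> \<Delta>" using x \<delta> hull_diff by auto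
    have S_less: "s < x" if "s \<in> S" for s using that x by (auto simp: D_def down_def not_le)
    have step: "\<exists>s'\<in>S. nmul (q - 1) s + \<epsilon> \<le> nmul (q - 1) s'" if s: "s \<in> S" for s
    proof -
      obtain s' where s': "s' \<in> S" "nmul (q - 1) s + \<delta> \<le> nmul q s'" using star[OF s] by blast
      have "nmul q s' = s' + nmul (q - 1) s'" using q by (metis Suc_diff_1 nmul_Suc)
      also have "\<dots> \<le> x + nmul (q - 1) s'" using S_less[OF s'(1)] by simp
      finally have "nmul (q - 1) s + \<delta> \<le> x + nmul (q - 1) s'" using s' by simp
      then show ?thesis using s' by (intro bexI[of _ s']) (auto simp: \<epsilon>_def algebra_simps)
    qed
    have q1: "q - 1 > 0"
    proof (rule ccontr)
      assume "\<not> q - 1 > 0"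
      then have "q - 1 = 0" by simp
      then have "\<epsilon> \<le> 0" using step[OF s0] by (auto simp: \<epsilon>_def)
      then show False using x by (simp add: \<epsilon>_def)
    qed
    have steps: "\<exists>s'\<in>S. nmul (q - 1) s + nmul k \<epsilon> \<le> nmul (q - 1) s'" if s: "s \<in> S" for s k
    proof (induction k)
      case 0
      then show ?case using s by auto
    next
      case (Suc k)
      then obtain s1 where s1: "s1 \<in> S" "nmul (q - 1) s + nmul k \<epsilon> \<le> nmul (q - 1) s1" by blast
      obtain s2 where s2: "s2 \<in> S" "nmul (q - 1) s1 + \<epsilon> \<le> nmul (q - 1) s2" using step[OF s1(1)] by blast
      have "nmul (q - 1) s + nmul (Suc k) \<epsilon> = (nmul (q - 1) s + nmul k \<epsilon>) + \<epsilon>" by (simp add: algebra_simps)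
      also have "\<dots> \<le> nmul (q - 1) s1 + \<epsilon>" using s1(2) by (rule add_right_mono)
      finally show ?case using s2 by (meson order_trans)
    qed
    fix y assume y: "y \<in> D"
    then obtain s where s: "s \<in> S" "y \<le> s" by (auto simp: D_def down_def)
    obtain s' where s': "s' \<in> S" "nmul (q - 1) s + nmul (q - 1) \<epsilon> \<le> nmul (q - 1) s'"
      using steps[OF s(1)] by blast
    then have "nmul (q - 1) (s + \<epsilon>) \<le> nmul (q - 1) s'" by (simp add: nmul_add_right)
    then have "s + \<epsilon> \<le> s'" using q1 by (simp add: nmul_le_iff)
    then have "y + \<epsilon> \<le> s'" using s(2) by (meson add_right_mono order_trans)
    moreover have "y + \<epsilon> \<in> \<Delta>" unfolding \<epsilon>_def by (intro hull_add hull_diff D_hull y \<delta>(1) x(1))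
    ultimately have "y + \<epsilon> \<in> D" using s'(1) unfolding D_def down_def by blast
    then show "y + (\<delta> - x) \<in> D" by (simp add: \<epsilon>_def)
  qed
  have H_proper: "H \<in> proper_convex_subgroups vK"
  proof -
    have "H \<subseteq> vK" by (simp add: H_def)
    \<comment> \<open>Otherwise a positive multiple of \<delta> - \<open>s0\<close> would preserve
      the cut and carry \<open>s0\<close> up to \<delta> or beyond.\<close>
    moreover have "H \<noteq> vK"
    proof
      assume "H = vK"
      obtain n where n: "n > 0" "nmul n (\<delta> - s0) \<in> vK"
        using hull_diff[OF \<delta>(1)] S_D s0 D_hull by (metis hull_iff subsetD)
      then have "nmul n (\<delta> - s0) \<in> HH" using \<open>H = vK\<close> by (auto simp: H_def)
      then have "s0 + nmul n (\<delta> - s0) \<in> D" using s0 S_D by (auto simp: HH_def)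
      then have "nmul n (\<delta> - s0) < \<delta> - s0" using D_less[of "s0 + nmul n (\<delta> - s0)"] by (simp add: algebra_simps)
      moreover have "\<delta> - s0 \<le> nmul n (\<delta> - s0)"
      proof -
        have "0 \<le> nmul (n - 1) (\<delta> - s0)" using \<delta>(2)[OF s0] by (intro nmul_nonneg) simp
        moreover have "nmul n (\<delta> - s0) = (\<delta> - s0) + nmul (n - 1) (\<delta> - s0)" using n by (metis Suc_diff_1 nmul_Suc)
        ultimately show ?thesis by simp
      qed
      ultimately show False by simp
    qed
    moreover have "0 \<in> H" using vK_zero hull_zero by (simp add: H_def HH_def)
    moreover have "x - y \<in> H" if "x \<in> H" "y \<in> H" for x y
    proof -
      have "z + (x - y) \<in> D" "z - (x - y) \<in> D" if z: "z \<in> D" for z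
      proof -
        have "(z + x) - y \<in> D" "(z - x) + y \<in> D" using z \<open>x \<in> H\<close> \<open>y \<in> H\<close> by (auto simp: H_def HH_def)
        then show "z + (x - y) \<in> D" "z - (x - y) \<in> D" by (simp_all add: algebra_simps)
      qed
      moreover have "x - y \<in> vK" "x - y \<in> \<Delta>" using that vK_diff vK_hull by (auto simp: H_def)
      ultimately show ?thesis by (simp add: H_def HH_def)
    qed
    moreover have "y \<in> H" if "x \<in> H" "z \<in> H" "y \<in> vK" "x \<le> y" "y \<le> z" for x y z
    proof -
      have y: "y \<in> \<Delta>" using that(3) vK_hull by auto
      have "u + y \<in> D" "u - y \<in> D" if u: "u \<in> D" for u
      proof -
        have "u + z \<in> D" "u - x \<in> D" using u \<open>x \<in> H\<close> \<open>z \<in> H\<close> by (auto simp: H_def HH_def)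
        moreover have "u + y \<in> \<Delta>" "u - y \<in> \<Delta>" using D_hull[OF u] y hull_add hull_diff by blast+
        ultimately show "u + y \<in> D" "u - y \<in> D"
          using D_down[of "u + z" "u + y"] D_down[of "u - x" "u - y"] \<open>x \<le> y\<close> \<open>y \<le> z\<close> by simp_all
      qed
      then show ?thesis using that(3) y by (simp add: H_def HH_def)
    qed
    ultimately show ?thesis unfolding proper_convex_subgroups_def by blast
  qed
  have "D = (+) \<delta> ` below H"
  proof
    show "D \<subseteq> (+) \<delta> ` below H"
    proof
      fix x assume x: "x \<in> D"
      \<comment> \<open>The translate x - h stays in the cut and therefore below \<delta>.\<close>
      have "x - \<delta> < h" if "h \<in> H" for h
      proof -
        have "x - h \<in> D" using x that by (auto simp: H_def HH_def)
        then show ?thesis using D_less[of "x - h"] by (simp add: algebra_simps)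
      qed
      then have "x - \<delta> \<in> below H" using D_hull[OF x] \<delta> hull_diff by (auto simp: below_def)
      then show "x \<in> (+) \<delta> ` below H" by (intro image_eqI[of _ _ "x - \<delta>"]) auto
    qed
    show "(+) \<delta> ` below H \<subseteq> D"
    proof
      fix y assume "y \<in> (+) \<delta> ` below H"
      then obtain x where x: "y = \<delta> + x" "x \<in> \<Delta>" "\<And>h. h \<in> H \<Longrightarrow> x < h" by (auto simp: below_def)
      have y: "y \<in> \<Delta>" using x \<delta> hull_add by auto
      have x0: "x < 0" using x(3)[of 0] H_proper by (auto simp: proper_convex_subgroups_def)
      show "y \<in> D"
      proof (rule ccontr)
        assume "y \<notin> D"
        \<comment> \<open>Now -x is in the invariance group, so a positive multiple of x is in
          \<open>H\<close> and exceeds x, which is impossible for negative x.\<close>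
        then have "\<delta> - y \<in> HH" using gap[OF y] x(1) x0 by (simp add: algebra_simps)
        then have mx: "- x \<in> HH" using x(1) by simp
        obtain n where n: "n > 0" "nmul n (- x) \<in> vK" using hull_minus[OF x(2)] by (auto simp: hull_iff)
        have "nmul n (- x) \<in> H" using HH_nmul[OF mx] n by (simp add: H_def)
        then have "0 - nmul n (- x) \<in> H" using H_proper unfolding proper_convex_subgroups_def by blast
        then have "nmul n x \<in> H" by (simp add: nmul_minus)
        then have "x < nmul n x" using x(3) by simp
        moreover have "nmul n x = x + nmul (n - 1) x" using n by (metis Suc_diff_1 nmul_Suc)
        moreover have "nmul (n - 1) x \<le> 0" using nmul_mono[of x 0 "n - 1"] x0 by simp
        ultimately show False by simp
      qed
    qed
  qed
  then show ?thesis using H_proper by (auto simp: D_def)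
qed

end

section \<open>Conjugates under unique extension of the valuation\<close>

context valued_field
begin

text \<open>Factor into linear factors; \<open>rs\<close> lists the roots with multiplicity and
  \<open>\<kappa>\<close> is the value of the leading coefficient.\<close>

lemma v_eval_splitted:
  assumes "q \<in> carrier (poly_ring L)" "q \<noteq> []" "splitted q"
  shows "\<exists>\<kappa> rs. length rs = degree q \<and> (\<forall>r\<in>set rs. r \<in> carrier L \<and> eval q r = \<zero>) \<and>
    (\<forall>x\<in>carrier L. v (eval q x) = Fin \<kappa> + sum_list (map (\<lambda>r. v (x \<ominus> r)) rs))"
  using assms
proof (induction "degree q" arbitrary: q)
  case 0
  then obtain a where a: "q = [a]" by (cases q) auto
  have aL: "a \<in> carrier L" "a \<noteq> \<zero>"
    using 0(2) a unfolding sym[OF univ_poly_carrier] polynomial_def by auto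
  then obtain \<kappa> where "v a = Fin \<kappa>" using v_FinE by blast
  then have "v (eval q x) = Fin \<kappa> + 0" if "x \<in> carrier L" for x using a aL that by (simp add: zero_extended_def)
  then show ?case using a by (intro exI[of _ \<kappa>] exI[of _ "[]"]) auto
next
  case (Suc n)
  interpret UP: domain "poly_ring L" using univ_poly_is_domain[OF carrier_is_subring] .
  have "roots q \<noteq> {#}" using Suc.hyps(2) Suc.prems(3) by (auto simp: splitted_def)
  then obtain a where a: "a \<in> carrier L" "[\<one>, \<ominus> a] \<in> carrier (poly_ring L)" "[\<one>, \<ominus> a] pdivides q"
    using not_empty_rootsE[OF Suc.prems(1)] by metis
  then obtain q1 where q1: "q1 \<in> carrier (poly_ring L)" "q = [\<one>, \<ominus> a] \<otimes>\<^bsub>poly_ring L\<^esub> q1"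
    unfolding pdivides_def factor_def by auto
  have q1_ne: "q1 \<noteq> []"
  proof
    assume "q1 = []"
    then have "q = []" using q1(2) a(2) UP.r_null by (simp add: univ_poly_zero)
    then show False using Suc.prems by simp
  qed
  have deg: "degree q = Suc (degree q1)"
  proof -
    have "degree (poly_mult [\<one>, \<ominus> a] q1) = degree [\<one>, \<ominus> a] + degree q1"
      using poly_mult_degree_eq[OF carrier_is_subring, of "[\<one>, \<ominus> a]" q1] a(2) q1(1) q1_ne
      by (simp add: univ_poly_carrier)
    then show ?thesis using q1(2) by (simp add: univ_poly_mult)
  qed
  have roots_eq: "roots q = add_mset a (roots q1)"
    using poly_mult_degree_one_monic_imp_same_roots[OF a(1) q1(1) q1_ne] q1(2) by simp
  then have spl: "splitted q1" using Suc.prems(3) deg by (simp add: splitted_def)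
  have n: "n = degree q1" using Suc.hyps(2) deg by simp
  obtain \<kappa> rs where IH: "length rs = degree q1" "\<forall>r\<in>set rs. r \<in> carrier L \<and> eval q1 r = \<zero>"
    "\<forall>x\<in>carrier L. v (eval q1 x) = Fin \<kappa> + sum_list (map (\<lambda>r. v (x \<ominus> r)) rs)"
    using Suc.hyps(1)[OF n q1(1) q1_ne spl] by blast
  have q1L: "set q1 \<subseteq> carrier L" using q1(1) unfolding sym[OF univ_poly_carrier] polynomial_def by auto
  have ev: "eval q x = (x \<ominus> a) \<otimes> eval q1 x" if x: "x \<in> carrier L" for x
  proof -
    have "eval q x = eval [\<one>, \<ominus> a] x \<otimes> eval q1 x"
      using q1(2) eval_poly_mult[of "[\<one>, \<ominus> a]" q1 x] q1L a(1) x by (simp add: univ_poly_mult)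
    then show ?thesis using a(1) x by (simp add: a_minus_def)
  qed
  have "v (eval q x) = Fin \<kappa> + sum_list (map (\<lambda>r. v (x \<ominus> r)) (a # rs))" if x: "x \<in> carrier L" for x
    using IH(3) x a(1) eval_in_carrier[OF q1L x] by (simp add: ev v_mult algebra_simps)
  moreover have "\<forall>r\<in>set (a # rs). r \<in> carrier L \<and> eval q r = \<zero>"
    using IH(2) a(1) q1L by (auto simp: ev eval_in_carrier r_neg a_minus_def)
  ultimately show ?case using IH(1) deg by (intro exI[of _ \<kappa>] exI[of _ "a # rs"]) simp
qed

end

section \<open>Divisibility of the hull and conjugates in the algebraic closure\<close>

locale valued_closure = valued_subfield_p L v p K + algebraic_closure L K
  for L :: "('a, 'b) ring_scheme" (structure) and v :: "'a \<Rightarrow> 'g::linordered_ab_group_add extended"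
    and p and K :: "'a set"
begin

lemma alg: "x \<in> carrier L \<Longrightarrow> (algebraic over K) x"
  by (rule algebraic_extension)

lemma exists_root_pow:
  assumes c: "c \<in> K" and n: "n > 0"
  shows "\<exists>y\<in>carrier L. y [^] (n::nat) = c"
proof -
  let ?q = "[\<one>] @ replicate (n - 1) \<zero> @ [\<ominus> c]"
  have q: "?q \<in> carrier (K[X])"
    using K_sub(2,3) K_sub(5)[OF c] unfolding sym[OF univ_poly_carrier] polynomial_def by auto
  have qL: "?q \<in> carrier (poly_ring L)" using carrier_polynomial_shell[OF subfieldE(1)[OF K] q] .
  have "size (roots ?q) > 0" using roots_over_subfield[OF q] n by (simp add: splitted_def)
  then have "roots ?q \<noteq> {#}" by auto
  then obtain y where "y \<in># roots ?q" by (meson multiset_nonemptyE)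
  then have "is_root ?q y" using roots_mem_iff_is_root[OF qL] by simp
  then have y: "y \<in> carrier L" "eval ?q y = \<zero>" by (auto simp: is_root_def)
  have "peval (rev ?q) y = \<zero>"
    using y eval_eq_peval[OF carrier_univ_polyD(2)[OF K q] y(1)] by simp
  moreover have "rev ?q = (\<ominus> c) # replicate (n - 1) \<zero> @ [\<one>]" by simp
  moreover have "y \<otimes> y [^] (n - 1) = y [^] n"
    using y n by (metis Suc_diff_1 nat_pow_Suc m_comm nat_pow_closed)
  ultimately have "\<ominus> c \<oplus> y [^] n = \<zero>" using y by (simp add: peval_monom)
  then have "y [^] n = c" using y K_closed[OF c] by (metis minus_equality minus_minus a_inv_closed nat_pow_closed)
  then show ?thesis using y by blast
qed

text \<open>The hull is formed inside the given group, which need not be divisible. The quotient is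
  realised as the value of a root in L of an element of K.\<close>

lemma hull_divisible:
  assumes x: "x \<in> \<Delta>" and k: "k > 0"
  shows "\<exists>y\<in>\<Delta>. nmul k y = x"
proof -
  obtain m where m: "m > 0" "nmul m x \<in> vK" using x by (auto simp: hull_iff)
  then obtain c where c: "c \<in> K" "v c = Fin (nmul m x)" by (auto simp: value_group_def)
  obtain y where y: "y \<in> carrier L" "y [^] (m * k) = c" using exists_root_pow[OF c(1), of "m * k"] m k by auto
  have "y \<noteq> \<zero>"
  proof
    assume "y = \<zero>"
    then have "c = \<zero>" using y(2) m k by (simp add: nat_pow_zero)
    then show False using c by simp
  qed
  then obtain g where g: "v y = Fin g" using v_FinE y by blast
  then have "nmul (m * k) g = nmul m x" using y c v_pow[OF y(1), of "m * k"] by (simp add: nmul_Fin)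
  then have "nmul k g = x" using m by (simp add: nmul_mult nmul_eq_iff)
  moreover have "g \<in> \<Delta>" using hull_root[OF k] x calculation by metis
  ultimately show ?thesis by blast
qed

text \<open>In f(x) = 0 two terms must share the least value, so a nonzero multiple of v(x) is a
  difference of elements of vK.\<close>

lemma v_in_hull:
  assumes x: "x \<in> carrier L" "v x = Fin g"
  shows "g \<in> \<Delta>"
proof -
  note Irr = IrrE[OF K x(1) alg[OF x(1)]]
  let ?f = "rev (Irr K x)"
  have f: "set ?f \<subseteq> K" "set ?f \<subseteq> carrier L" using carrier_univ_polyD[OF K Irr(1)] by auto
  have ne: "Irr K x \<noteq> []" using pirreducibleE(1)[OF subfieldE(1)[OF K] Irr(1,2)] .
  have f0: "peval ?f x = \<zero>" using Irr(4) eval_eq_peval[OF carrier_univ_polyD(2)[OF K Irr(1)] x(1)] by simp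
  have one: "\<one> \<in> set ?f" using Irr(3) ne by (metis hd_in_set set_rev)
  define J where "J = {j. j < length ?f \<and> ?f ! j \<noteq> \<zero>}"
  obtain j1 where "j1 < length ?f" "?f ! j1 = \<one>" using one unfolding in_set_conv_nth by blast
  then have "j1 \<in> J" by (simp add: J_def)
  moreover have "finite J" by (simp add: J_def)
  ultimately have J: "finite J" "J \<noteq> {}" by auto
  define T where "T = (\<lambda>j. v (?f ! j) + Fin (nmul j g))"
  obtain j0 where j0: "j0 \<in> J" "\<And>j. j \<in> J \<Longrightarrow> T j0 \<le> T j"
    using J by (metis arg_min_if_finite(1) arg_min_least)
  have fin: "\<exists>h\<in>vK. v (?f ! j) = Fin h" if "j \<in> J" for j
  proof -
    have "?f ! j \<in> set ?f" "?f ! j \<noteq> \<zero>" using that unfolding J_def by (blast intro: nth_mem)+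
    then have "?f ! j \<in> K" "?f ! j \<noteq> \<zero>" using f(1) by auto
    then obtain h where "v (?f ! j) = Fin h" using v_FinE K_closed by blast
    then show ?thesis using \<open>?f ! j \<in> K\<close> by (auto simp: value_group_def)
  qed
  \<comment> \<open>A unique least term would determine the value of f(x), which is
    infinite.\<close>
  have "\<exists>j\<in>J. j \<noteq> j0 \<and> T j \<le> T j0"
  proof (rule ccontr)
    assume no: "\<not> ?thesis"
    obtain h where h: "v (?f ! j0) = Fin h" using fin[OF j0(1)] by auto
    have "v (peval ?f x) = Fin (h + nmul j0 g)"
    proof (rule peval_dominant[OF f(2) x])
      show "j0 < length ?f" using j0 by (auto simp: J_def)
      show "v (?f ! j0) + Fin (nmul j0 g) = Fin (h + nmul j0 g)" using h by simp
      fix j assume j: "j < length ?f" "j \<noteq> j0"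
      show "Fin (h + nmul j0 g) < v (?f ! j) + Fin (nmul j g)"
      proof (cases "?f ! j = \<zero>")
        case False
        then have "j \<in> J" using j by (simp add: J_def)
        then have "T j0 < T j" using no j by auto
        then show ?thesis using h by (simp add: T_def)
      qed simp
    qed
    then show False using f0 by simp
  qed
  then obtain j where j: "j \<in> J" "j \<noteq> j0" "T j = T j0" using j0(2) by (meson antisym)
  obtain h h0 where h: "h \<in> vK" "v (?f ! j) = Fin h" "h0 \<in> vK" "v (?f ! j0) = Fin h0"
    using fin[OF j(1)] fin[OF j0(1)] by auto
  have eq: "h + nmul j g = h0 + nmul j0 g" using j(3) h by (simp add: T_def)
  show ?thesis
  proof (cases "j < j0")
    case True
    have "h - h0 = nmul j0 g - nmul j g" using eq by (simp add: algebra_simps)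
    then have "nmul (j0 - j) g = h - h0" using nmul_diff_left[of j j0 g] True by simp
    then show ?thesis using h vK_diff True by (metis hull_iff zero_less_diff)
  next
    case False
    then have lt: "j0 < j" using j by simp
    have "h0 - h = nmul j g - nmul j0 g" using eq by (simp add: algebra_simps)
    then have "nmul (j - j0) g = h0 - h" using nmul_diff_left[of j0 j g] lt by simp
    then show ?thesis using h vK_diff lt by (metis hull_iff zero_less_diff)
  qed
qed

lemma adjoin_eq: "a \<in> carrier L \<Longrightarrow> adjoin L K a = simple_extension K a"
proof -
  assume a: "a \<in> carrier L"
  have "simple_extension K a = generate_field L (insert a K)"
  proof (rule generate_fieldI)
    show "insert a K \<subseteq> carrier L" using a K_closed by auto
    show "subfield (simple_extension K a) L" using simple_extension_is_subfield[OF K a] alg[OF a] by simp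
    show "insert a K \<subseteq> simple_extension K a"
      using simple_extension_incl[OF K_sub(1) a] simple_extension_mem[OF subfieldE(1)[OF K] a] by auto
    fix M assume "subfield M L" "insert a K \<subseteq> M"
    then show "simple_extension K a \<subseteq> M"
      using simple_extension_subring_incl[OF subfieldE(1)] by auto
  qed
  then show ?thesis by (simp add: adjoin_def)
qed

lemma degree_adjoin: "a \<in> carrier L \<Longrightarrow> extension_degree L K (adjoin L K a) = degree (Irr K a)"
  using simple_extension_dim[OF K _ alg] by (simp add: extension_degree_def adjoin_eq)

text \<open>A root \<open>r\<close> of the minimal polynomial yields a \<open>K\<close>-embedding of \<open>K(a)\<close> into \<open>L\<close> sending \<open>a\<close> to
  \<open>r\<close>; pulling \<open>v\<close> back along it gives an extension of \<open>v\<close> from \<open>K\<close>.\<close>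

lemma conjugate_value:
  assumes a: "a \<in> carrier L" and uv: "uv_extension L v K (adjoin L K a)"
    and r: "r \<in> carrier L" "eval (Irr K a) r = \<zero>" and c: "c \<in> K"
  shows "v (c \<ominus> r) = v (c \<ominus> a)"
proof -
  let ?F = "simple_extension K a"
  have sF: "subfield ?F L" using simple_extension_is_subfield[OF K a] alg[OF a] by simp
  note Irr = IrrE[OF K a alg[OF a]]
  interpret UP: domain "K[X]" using univ_poly_is_domain[OF subfieldE(1)[OF K]] .
  interpret ea: ring_hom_ring "K[X]" L "\<lambda>q. eval q a" using eval_ring_hom[OF subfieldE(1)[OF K] a] .
  interpret er: ring_hom_ring "K[X]" L "\<lambda>q. eval q r" using eval_ring_hom[OF subfieldE(1)[OF K] r(1)] .
  \<comment> \<open>A polynomial vanishing at a is a multiple of the minimal polynomial, hence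
    vanishes at r.\<close>
  have ker: "eval q r = \<zero>" if "q \<in> carrier (K[X])" "eval q a = \<zero>" for q
    using pdivides_imp_root_sharing[OF carrier_polynomial_shell[OF subfieldE(1)[OF K] Irr(1)]
        Irr_minimal[OF K a alg[OF a] that] r(1) r(2)] .
  have wd: "eval q r = eval q' r" if q: "q \<in> carrier (K[X])" "q' \<in> carrier (K[X])" "eval q a = eval q' a" for q q'
  proof -
    have "eval (q \<ominus>\<^bsub>K[X]\<^esub> q') a = eval q a \<ominus> eval q' a"
      using q by (simp add: a_minus_def UP.minus_eq)
    then have "eval (q \<ominus>\<^bsub>K[X]\<^esub> q') a = \<zero>" using q ea.hom_closed[of q'] by (simp add: a_minus_def r_neg)
    then have "eval (q \<ominus>\<^bsub>K[X]\<^esub> q') r = \<zero>" using q by (intro ker) auto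
    moreover have "eval (q \<ominus>\<^bsub>K[X]\<^esub> q') r = eval q r \<ominus> eval q' r"
      using q by (simp add: a_minus_def UP.minus_eq)
    ultimately show ?thesis using q er.hom_closed by (metis r_right_minus_eq)
  qed
  have ex: "\<exists>q. q \<in> carrier (K[X]) \<and> eval q a = x" if "x \<in> ?F" for x
    using that simple_extension_as_eval_img[OF K_sub(1) a] by auto
  \<comment> \<open>The embedding q(a) to q(r), through a chosen polynomial q; by \<open>wd\<close>
    the choice does not matter.\<close>
  define \<phi> where "\<phi> = (\<lambda>x. eval (SOME q. q \<in> carrier (K[X]) \<and> eval q a = x) r)"
  have \<phi>: "\<phi> (eval q a) = eval q r" if q: "q \<in> carrier (K[X])" for q
  proof -
    have "\<exists>q'. q' \<in> carrier (K[X]) \<and> eval q' a = eval q a" using q by blast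
    then have "(SOME q'. q' \<in> carrier (K[X]) \<and> eval q' a = eval q a) \<in> carrier (K[X]) \<and>
      eval (SOME q'. q' \<in> carrier (K[X]) \<and> eval q' a = eval q a) a = eval q a" by (rule someI_ex)
    then show ?thesis unfolding \<phi>_def using q by (intro wd) auto
  qed
  have \<phi>_closed: "\<phi> x \<in> carrier L" if "x \<in> ?F" for x using ex[OF that] \<phi> by auto
  have \<phi>_mult: "\<phi> (x \<otimes> y) = \<phi> x \<otimes> \<phi> y" and \<phi>_add: "\<phi> (x \<oplus> y) = \<phi> x \<oplus> \<phi> y" if xy: "x \<in> ?F" "y \<in> ?F" for x y
  proof -
    obtain q q' where q: "q \<in> carrier (K[X])" "eval q a = x" "q' \<in> carrier (K[X])" "eval q' a = y"
      using ex[OF xy(1)] ex[OF xy(2)] by blast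
    have "x \<otimes> y = eval (q \<otimes>\<^bsub>K[X]\<^esub> q') a" "x \<oplus> y = eval (q \<oplus>\<^bsub>K[X]\<^esub> q') a" using q by auto
    then have "\<phi> (x \<otimes> y) = eval (q \<otimes>\<^bsub>K[X]\<^esub> q') r" "\<phi> (x \<oplus> y) = eval (q \<oplus>\<^bsub>K[X]\<^esub> q') r"
      using \<phi>[OF UP.m_closed[OF q(1,3)]] \<phi>[OF UP.a_closed[OF q(1,3)]] by (simp_all only:)
    then show "\<phi> (x \<otimes> y) = \<phi> x \<otimes> \<phi> y" "\<phi> (x \<oplus> y) = \<phi> x \<oplus> \<phi> y"
      using \<phi>[OF q(1)] \<phi>[OF q(3)] er.hom_mult[OF q(1,3)] er.hom_add[OF q(1,3)]
      unfolding q(2,4) by simp_all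
  qed
  have const: "\<phi> k = k" if k: "k \<in> K" for k
  proof (cases "k = \<zero>")
    case True
    have "[] \<in> carrier (K[X])" unfolding sym[OF univ_poly_carrier] polynomial_def by simp
    from \<phi>[OF this] show ?thesis using True by simp
  next
    case False
    then have "[k] \<in> carrier (K[X])" using k unfolding sym[OF univ_poly_carrier] polynomial_def by simp
    from \<phi>[OF this] show ?thesis using k K_closed a r by simp
  qed
  have \<phi>_zero: "\<phi> x = \<zero> \<longleftrightarrow> x = \<zero>" if x: "x \<in> ?F" for x
  proof
    assume z: "\<phi> x = \<zero>"
    show "x = \<zero>"
    proof (rule ccontr)
      assume "x \<noteq> \<zero>"
      then have i: "inv x \<in> ?F" "x \<otimes> inv x = \<one>" using subfield_m_inv[OF sF, of x] x by auto
      then have "\<phi> \<one> = \<zero>" using \<phi>_mult[OF x i(1)] z \<phi>_closed[OF i(1)] by simp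
      then show False using const[OF K_sub(3)] by simp
    qed
  next
    assume "x = \<zero>"
    then show "\<phi> x = \<zero>" using const[OF K_sub(2)] by simp
  qed
  have "valuation_on L ?F (\<lambda>x. v (\<phi> x))"
    unfolding valuation_on_def
    using \<phi>_closed \<phi>_zero \<phi>_mult \<phi>_add v_mult v_add_ge by (auto simp del: min_le_iff_disj)
  then have vx: "v (\<phi> x) = v x" if "x \<in> ?F" for x
    using uv that const unfolding uv_extension_def adjoin_eq[OF a] by (metis (no_types, lifting))
  have q: "[\<one>, \<ominus> c] \<in> carrier (K[X])"
    using K_sub(3) K_sub(5)[OF c] unfolding sym[OF univ_poly_carrier] polynomial_def by simp
  have e: "eval [\<one>, \<ominus> c] x = x \<ominus> c" if "x \<in> carrier L" for x
    using that K_closed[OF c] by (simp add: a_minus_def)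
  have "eval [\<one>, \<ominus> c] a \<in> ?F" unfolding simple_extension_as_eval_img[OF K_sub(1) a] using q by (rule imageI)
  then have "v (eval [\<one>, \<ominus> c] r) = v (eval [\<one>, \<ominus> c] a)" using vx \<phi>[OF q] by metis
  then show ?thesis using e a r(1) K_closed[OF c] v_diff_commute by metis
qed

end

section \<open>Counting the distances\<close>

context valued_closure
begin

text \<open>The minimal polynomial splits into conjugates of a, and all of them are equally far from
  c.\<close>

lemma norm_value:
  assumes a: "a \<in> carrier L" and uv: "uv_extension L v K (adjoin L K a)"
  shows "\<exists>\<kappa>. \<forall>c\<in>K. v (peval (rev (Irr K a)) c) = Fin \<kappa> + nmul (degree (Irr K a)) (v (c \<ominus> a))"
proof -
  note Irr = IrrE[OF K a alg[OF a]]
  have q: "Irr K a \<in> carrier (poly_ring L)" using carrier_polynomial_shell[OF subfieldE(1)[OF K] Irr(1)] .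
  have ne: "Irr K a \<noteq> []" using pirreducibleE(1)[OF subfieldE(1)[OF K] Irr(1,2)] .
  obtain \<kappa> rs where rs: "length rs = degree (Irr K a)" "\<forall>r\<in>set rs. r \<in> carrier L \<and> eval (Irr K a) r = \<zero>"
    "\<forall>x\<in>carrier L. v (eval (Irr K a) x) = Fin \<kappa> + sum_list (map (\<lambda>r. v (x \<ominus> r)) rs)"
    using v_eval_splitted[OF q ne roots_over_subfield[OF Irr(1)]] by blast
  have "v (peval (rev (Irr K a)) c) = Fin \<kappa> + nmul (degree (Irr K a)) (v (c \<ominus> a))" if c: "c \<in> K" for c
  proof -
    have "sum_list (map (\<lambda>r. v (c \<ominus> r)) zs) = nmul (length zs) (v (c \<ominus> a))" if "set zs \<subseteq> set rs" for zs
      using that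
    proof (induction zs)
      case (Cons r zs)
      then have "v (c \<ominus> r) = v (c \<ominus> a)" using rs(2) by (intro conjugate_value[OF a uv _ _ c]) auto
      then show ?case using Cons by simp
    qed simp
    then have "sum_list (map (\<lambda>r. v (c \<ominus> r)) rs) = nmul (degree (Irr K a)) (v (c \<ominus> a))" using rs(1) by simp
    moreover have "v (eval (Irr K a) c) = Fin \<kappa> + sum_list (map (\<lambda>r. v (c \<ominus> r)) rs)"
      using rs(3) K_closed[OF c] by blast
    ultimately show ?thesis
      using eval_eq_peval[OF carrier_univ_polyD(2)[OF K Irr(1)] K_closed[OF c]] by simp
  qed
  then show ?thesis by blast
qed

text \<open>\<open>\<epsilon>\<close> measures by how much the Taylor coefficients at a exceed the
  values (n - j)\<gamma>. This excess survives the change of centre from a to c and the extraction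
  of a q-th root, which is additive by Frobenius. Comparing q-fold multiples avoids dividing values
  by q.\<close>

lemma close_root:
  assumes a: "a \<in> carrier L" and f: "set f \<subseteq> K" "length f = Suc n" "last f = \<one>"
    and n: "n = p ^ t * n'" "n' > 0" "\<not> p dvd n'"
    and c: "c \<in> K" "v (c \<ominus> a) = Fin \<gamma>"
    and est: "\<And>j. j < n \<Longrightarrow> Fin (nmul (n - j) \<gamma>) + \<epsilon> \<le> v (shift a f ! j)"
  shows "\<exists>e\<in>rootf t. Fin (nmul (p ^ t) \<gamma>) + \<epsilon> \<le> nmul (p ^ t) (v (a \<ominus> e))"
proof -
  define q where "q = p ^ t"
  have q: "q > 0" "q \<le> n" using n p_pos by (auto simp: q_def)
  have fL: "set f \<subseteq> carrier L" using f K_closed by auto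
  have cL: "c \<in> carrier L" using c K_closed by auto
  define s where "s = c \<ominus> a"
  have sL: "s \<in> carrier L" using cL a by (simp add: s_def)
  have sa: "s \<oplus> a = c" unfolding s_def using cL a by algebra
  have f_ne: "f \<noteq> []" using f by auto
  define N where "N = shift c f ! (n - q)"
  have "N \<in> set (shift c f)" unfolding N_def using f(2) by (intro nth_mem) simp
  then have N: "N \<in> K" using shift_subring[OF subfieldE(1)[OF K] c(1) f(1)] by auto
  have NL: "N \<in> carrier L" using N K_closed by auto
  have "Fin (nmul (n - (n - q)) \<gamma>) + \<epsilon> \<le>
      v (shift s (shift a f) ! (n - q) \<ominus> nmult (n choose (n - q)) (s [^] (n - (n - q))))"
  proof (rule shift_estimate)
    show "last (shift a f) = \<one>" using last_shift[OF f_ne] f by simp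
    show "v s = Fin \<gamma>" using c(2) by (simp add: s_def)
  qed (use fL a f sL est in auto)
  then have est1: "Fin (nmul q \<gamma>) + \<epsilon> \<le> v (N \<ominus> nmult (n choose q) (s [^] q))"
    using q binomial_symmetric[of q n] by (simp add: shift_shift[OF sL a fL] sa N_def)
  \<comment> \<open>The multiplicity of p in n choose p^t is that in n', by the counting lemma
    behind Sylow's theorem.\<close>
  have ndvd: "\<not> p dvd (n choose q)"
  proof -
    have "multiplicity p (n choose q) = 0"
      using const_p_fac[OF n(2) prime_p, of t] n by (simp add: q_def not_dvd_imp_multiplicity_0)
    moreover have "n choose q \<noteq> 0" using q by simp
    moreover have "\<not> is_unit p" using prime_p not_prime_unit by blast
    ultimately show ?thesis using multiplicity_eq_zero_iff by blast
  qed
  define u where "u = nmult (n choose q) \<one>"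
  have u: "u \<in> K" "v u = 0" using add_pow_subring[OF subfieldE(1)[OF K] K_sub(3)] v_nat_unit[OF ndvd] by (simp_all add: u_def)
  have uL: "u \<in> carrier L" "u \<noteq> \<zero>" using u K_closed by (auto simp: zero_extended_def)
  define M where "M = N \<otimes> inv u"
  have M: "M \<in> K" using N K_inv[OF u(1) uL(2)] K_sub(6) by (simp add: M_def)
  have M_carr: "M \<in> carrier L" using M K_closed by auto
  have uM: "u \<otimes> M = N" 
  proof -
    have "inv u \<in> carrier L" "u \<otimes> inv u = \<one>" using uL by (auto simp: field_Units)
    then have "u \<otimes> (N \<otimes> inv u) = N \<otimes> \<one>" using uL NL by (metis m_comm m_lcomm)
    then show ?thesis using NL by (simp add: M_def)
  qed
  have "nmult (n choose q) (s [^] q) = u \<otimes> s [^] q" using sL by (simp add: u_def add_pow_ldistr)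
  then have "N \<ominus> nmult (n choose q) (s [^] q) = u \<otimes> (M \<ominus> s [^] q)"
  proof -
    define z where "z = s [^] q"
    have zL: "z \<in> carrier L" using sL by (simp add: z_def)
    assume "nmult (n choose q) (s [^] q) = u \<otimes> s [^] q"
    then show ?thesis unfolding uM[symmetric] z_def[symmetric] using uL M_carr zL by simp algebra
  qed
  then have est2: "Fin (nmul q \<gamma>) + \<epsilon> \<le> v (M \<ominus> s [^] q)"
    using est1 u(2) uL M_carr sL by (simp add: v_mult)
  obtain \<nu> where \<nu>: "\<nu> \<in> carrier L" "\<nu> [^] q = M" using exists_root_pow[OF M q(1)] by blast
  have "(\<nu> \<ominus> s) [^] q = M \<ominus> s [^] q" using frobenius_power_diff[OF \<nu>(1) sL, of t] \<nu>(2) by (simp add: q_def)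
  then have est3: "Fin (nmul q \<gamma>) + \<epsilon> \<le> nmul q (v (\<nu> \<ominus> s))"
    using est2 v_pow[of "\<nu> \<ominus> s" q] \<nu> sL by simp
  \<comment> \<open>Since c - s is a, replacing s by its radical approximation \<open>\<nu>\<close>
    gives an element of K^(1/q) near a.\<close>
  define e where "e = c \<ominus> \<nu>"
  have "e [^] q = c [^] q \<ominus> M" using frobenius_power_diff[OF cL \<nu>(1), of t] \<nu>(2) by (simp add: q_def e_def)
  then have "e \<in> rootf t" using K_diff[OF K_pow[OF c(1)] M] cL \<nu> by (simp add: rootf_def e_def q_def)
  moreover have "a \<ominus> e = \<nu> \<ominus> s" unfolding e_def s_def using a cL \<nu> by algebra
  ultimately show ?thesis using est3 unfolding q_def by (intro bexI[of _ e]) simp_all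
qed

text \<open>For \<gamma> in S, \<open>close_root\<close> with excess \<delta> - \<gamma> reaches
  precision ((q - 1)\<gamma> + \<delta>)/q. Either some \<gamma> makes this exceed all of S, or the
  hypothesis of \<open>cut_below\<close> holds.\<close>

lemma distance_alternatives:
  assumes a: "a \<in> carrier L" "a \<notin> K" "nomax (dvals K a)" and uv: "uv_extension L v K (adjoin L K a)"
    and deg: "degree (Irr K a) \<le> p ^ i"
  shows "(\<exists>H\<in>proper_convex_subgroups vK. cls (down (dvals K a)) = cls (below H)) \<or>
    (\<exists>t\<le>i. \<exists>e\<in>rootf t. close a e)"
proof -
  let ?S = "dvals K a"
  define n where "n = degree (Irr K a)"
  define f where "f = rev (Irr K a)"
  note Irr = IrrE[OF K a(1) alg[OF a(1)]]
  have ne: "Irr K a \<noteq> []" using pirreducibleE(1)[OF subfieldE(1)[OF K] Irr(1,2)] .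
  have n1: "n \<ge> 1" using pirreducible_degree[OF K Irr(1,2)] by (simp add: n_def)
  have f: "set f \<subseteq> K" "length f = Suc n" "last f = \<one>" "f \<noteq> []"
    using carrier_univ_polyD(1)[OF K Irr(1)] ne Irr(3) by (auto simp: f_def n_def last_rev)
  have fL: "set f \<subseteq> carrier L" using f K_closed by auto
  interpret ap: approximated L v K a
    by (intro approximated.intro approximated_axioms.intro valued_field_axioms K a)
  obtain \<kappa> where \<kappa>: "\<And>c. c \<in> K \<Longrightarrow> v (peval f c) = Fin \<kappa> + nmul n (v (c \<ominus> a))"
    using norm_value[OF a(1) uv] unfolding f_def n_def by blast
  have as: "ap.asym (peval f) n \<kappa>"
    unfolding ap.asym_def using ap.eventually_in_E by eventually_elim (auto simp: \<kappa> nmul_Fin)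
  have fnz: "\<not> set f \<subseteq> {\<zero>}" using f(3,4) by (metis last_in_set one_not_zero singletonD subsetD)
  let ?fs = "shift a f"
  obtain j0 \<beta> where dom: "dominant ?fs ?S j0 \<beta>" "ap.asym (peval f) j0 \<beta>"
    by (rule ap.asym_peval[OF fL fnz])
  have j0n: "j0 = n" using ap.asym_unique(1)[OF dom(2) as] .
  have j0: "v (?fs ! j0) = Fin \<beta>" "\<forall>\<^sub>F \<gamma> in tail ?S. \<forall>j < length f. j \<noteq> j0 \<longrightarrow>
      Fin (\<beta> + nmul j0 \<gamma>) < v (?fs ! j) + Fin (nmul j \<gamma>)"
    using dom(1) by (auto simp: dominant_def)
  have "?fs ! n = \<one>"
    using last_shift[OF f(4), of a] f(2,3) last_conv_nth[of ?fs] f(4) by simp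
  then have \<beta>0: "\<beta> = 0" using j0(1) j0n by (simp add: zero_extended_def)
  have fsL: "?fs ! j \<in> carrier L" if "j < n" for j
    using shift_closed[OF a(1) fL] that f(2) by (metis length_shift less_SucI nth_mem subsetD)
  \<comment> \<open>Dominance of index n is known only for large arguments, but the bound grows with
    s and so extends to all of S.\<close>
  have key: "Fin (nmul (n - j) s) < v (?fs ! j)" if s: "s \<in> ?S" and j: "j < n" for s j
  proof -
    obtain s1 where s1: "s1 \<in> ?S" "\<And>x. x \<in> ?S \<Longrightarrow> s1 \<le> x \<Longrightarrow>
      \<forall>j < length f. j \<noteq> j0 \<longrightarrow> Fin (\<beta> + nmul j0 x) < v (?fs ! j) + Fin (nmul j x)"
      using j0(2) a(3) by (subst (asm) eventually_tail) (auto simp: nomax_def)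
    define x where "x = max s s1"
    have x: "x \<in> ?S" "s1 \<le> x" "s \<le> x" using s s1 by (auto simp: x_def max_def)
    have lt: "Fin (nmul n x) < v (?fs ! j) + Fin (nmul j x)"
      using s1(2)[OF x(1,2)] j f(2) j0n \<beta>0 by auto
    show ?thesis
    proof (cases "v (?fs ! j)")
      case (Fin b)
      have "nmul (n - j) s \<le> nmul (n - j) x" using x(3) by (rule nmul_mono)
      also have "\<dots> = nmul n x - nmul j x" using j by (simp add: nmul_diff_left)
      also have "\<dots> < b" using lt Fin by (simp add: algebra_simps)
      finally show ?thesis using Fin by simp
    next
      case Minf
      then show ?thesis using v_not_Minf[OF fsL[OF j]] by simp
    qed simp
  qed
  obtain n' where n': "n = p ^ multiplicity p n * n'" "\<not> p dvd n'"
    using multiplicity_decompose'[of n p] n1 prime_p by (metis not_one_le_zero not_prime_unit)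
  define t where "t = multiplicity p n"
  have n'0: "n' > 0" using n' n1 by (cases n') auto
  have nt: "n = p ^ t * n'" using n'(1) by (simp add: t_def)
  have "p ^ t \<le> p ^ i" using nt n'0 deg unfolding n_def[symmetric] by (metis le_trans dvd_imp_le dvd_triv_left n1 less_le_trans zero_less_one)
  then have t: "t \<le> i" by (rule power_le_imp_le_exp[OF prime_gt_1_nat[OF prime_p]])
  define q where "q = p ^ t"
  have q: "q > 0" by (simp add: q_def)
  show ?thesis
  proof (cases "\<forall>j<n. ?fs ! j = \<zero>")
    case True
    \<comment> \<open>Here f = (X - a)^n. Any centre serves, for instance zero, and the infinite
      excess shows that a itself is a radical.\<close>
    obtain \<gamma> where \<gamma>: "v (\<zero> \<ominus> a) = Fin \<gamma>" using dvals_FinE[OF a(1,2) K_sub(2)] by metis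
    have "\<exists>e\<in>rootf t. Fin (nmul (p ^ t) \<gamma>) + Pinf \<le> nmul (p ^ t) (v (a \<ominus> e))"
      by (rule close_root[OF a(1) f(1-3) nt n'0 n'(2) K_sub(2) \<gamma>]) (use True in auto)
    then obtain e where e: "e \<in> rootf t" "nmul (p ^ t) (v (a \<ominus> e)) = Pinf" by auto
    have "a \<ominus> e \<in> carrier L" using a e by (auto simp: rootf_def)
    then have "v (a \<ominus> e) = Pinf" using e(2) v_not_Minf[of "a \<ominus> e"] by (cases "v (a \<ominus> e)") (auto simp: nmul_Fin)
    then have "close a e" by (simp add: close_def)
    then show ?thesis using e t by blast
  next
    case False
    define J where "J = {j. j < n \<and> ?fs ! j \<noteq> \<zero>}"
    have J: "finite J" "J \<noteq> {}" using False by (auto simp: J_def)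
    have "\<exists>d\<in>\<Delta>. v (?fs ! j) = Fin (nmul (n - j) d)" if j: "j \<in> J" for j
    proof -
      have jn: "j < n" "?fs ! j \<noteq> \<zero>" using j by (auto simp: J_def)
      obtain b where b: "v (?fs ! j) = Fin b" using v_FinE[OF fsL[OF jn(1)] jn(2)] .
      then have "b \<in> \<Delta>" using v_in_hull[OF fsL[OF jn(1)]] by simp
      then obtain d where "d \<in> \<Delta>" "nmul (n - j) d = b" using hull_divisible[of b "n - j"] jn by auto
      then show ?thesis using b by auto
    qed
    then obtain df where df: "\<And>j. j \<in> J \<Longrightarrow> df j \<in> \<Delta>" "\<And>j. j \<in> J \<Longrightarrow> v (?fs ! j) = Fin (nmul (n - j) (df j))"
      by metis
    \<comment> \<open>The largest \<delta> with v(a_j) \<ge> (n - j)\<delta> for all j < n, as on a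
      Newton polygon.\<close>
    define \<delta> where "\<delta> = Min (df ` J)"
    have dJ: "finite (df ` J)" "df ` J \<noteq> {}" using J by auto
    have \<delta>_in: "\<delta> \<in> df ` J" unfolding \<delta>_def using Min_in[OF dJ] .
    have \<delta>: "\<delta> \<in> \<Delta>" using \<delta>_in df(1) by auto
    have \<delta>_le: "Fin (nmul (n - j) \<delta>) \<le> v (?fs ! j)" if j: "j < n" for j
    proof (cases "?fs ! j = \<zero>")
      case False
      then have jJ: "j \<in> J" using j by (simp add: J_def)
      then have "\<delta> \<le> df j" unfolding \<delta>_def using dJ by (intro Min_le) auto
      then show ?thesis using df(2)[OF jJ] nmul_mono by auto
    qed simp
    have S_less: "s < \<delta>" if s: "s \<in> ?S" for s
    proof -
      obtain j where j: "j \<in> J" "\<delta> = df j" using \<delta>_in by auto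
      then have "nmul (n - j) s < nmul (n - j) \<delta>" using key[OF s, of j] df(2)[OF j(1)] by (simp add: J_def)
      then show ?thesis using j by (subst (asm) nmul_less_iff) (auto simp: J_def)
    qed
    show ?thesis
    proof (cases "\<forall>s\<in>?S. \<exists>s'\<in>?S. nmul (q - 1) s + \<delta> \<le> nmul q s'")
      case True
      then obtain H where "H \<in> proper_convex_subgroups vK" "down ?S = (+) \<delta> ` below H"
        using cut_below[OF dvals_subset_vK[OF a(1,3)] a(3) \<delta> S_less q] by blast
      then show ?thesis using cls_translate[OF \<delta>] by auto
    next
      case False
      then obtain \<gamma> where \<gamma>: "\<gamma> \<in> ?S" "\<And>s. s \<in> ?S \<Longrightarrow> nmul q s < nmul (q - 1) \<gamma> + \<delta>" by (auto simp: not_le)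
      obtain c where c: "c \<in> K" "v (c \<ominus> a) = Fin \<gamma>" using \<gamma>(1) by (auto simp: dvals_def)
      have "\<exists>e\<in>rootf t. Fin (nmul (p ^ t) \<gamma>) + Fin (\<delta> - \<gamma>) \<le> nmul (p ^ t) (v (a \<ominus> e))"
      proof (rule close_root[OF a(1) f(1-3) nt n'0 n'(2) c])
        fix j assume j: "j < n"
        obtain m where m: "n - j = Suc m" using j by (metis Suc_diff_Suc)
        \<comment> \<open>Of the n - j copies of \<gamma>, one is traded for \<delta> and the others
          are enlarged to \<delta>.\<close>
        have "nmul (n - j) \<gamma> + (\<delta> - \<gamma>) = nmul m \<gamma> + \<delta>" by (simp add: m)
        also have "\<dots> \<le> nmul m \<delta> + \<delta>" using S_less[OF \<gamma>(1)] by (intro add_right_mono nmul_mono) simp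
        also have "\<dots> = nmul (n - j) \<delta>" by (simp add: m add.commute)
        finally have "Fin (nmul (n - j) \<gamma> + (\<delta> - \<gamma>)) \<le> Fin (nmul (n - j) \<delta>)" by simp
        then show "Fin (nmul (n - j) \<gamma>) + Fin (\<delta> - \<gamma>) \<le> v (?fs ! j)"
          unfolding plus_extended.simps using \<delta>_le[OF j] by (rule order_trans)
      qed
      then obtain e where e: "e \<in> rootf t" "Fin (nmul q \<gamma> + (\<delta> - \<gamma>)) \<le> nmul q (v (a \<ominus> e))"
        by (auto simp: q_def)
      have "nmul q \<gamma> = \<gamma> + nmul (q - 1) \<gamma>" using q by (metis Suc_diff_1 nmul_Suc)
      then have eq: "nmul q \<gamma> + (\<delta> - \<gamma>) = nmul (q - 1) \<gamma> + \<delta>" by simp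
      have "Fin s < v (a \<ominus> e)" if s: "s \<in> ?S" for s
      proof -
        have "Fin (nmul q s) < Fin (nmul (q - 1) \<gamma> + \<delta>)" using \<gamma>(2)[OF s] by simp
        also have "\<dots> \<le> nmul q (v (a \<ominus> e))" using e(2) eq by simp
        finally have lt: "Fin (nmul q s) < nmul q (v (a \<ominus> e))" .
        have eL: "a \<ominus> e \<in> carrier L" using a e by (auto simp: rootf_def)
        show ?thesis
        proof (cases "v (a \<ominus> e)")
          case (Fin g)
          then show ?thesis using lt q by (simp add: nmul_Fin nmul_less_iff)
        next
          case Minf
          then show ?thesis using v_not_Minf[OF eL] by simp
        qed simp
      qed
      then have "close a e" by (simp add: close_def)
      then show ?thesis using e t by blast
    qed
  qed
qed

section \<open>Descent along the fields K^(1/p^l) and the final count\<close>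

definition scale :: "nat \<Rightarrow> 'g set \<Rightarrow> 'g set" where
  "scale l D = {x \<in> \<Delta>. nmul (p ^ l) x \<in> D}"

text \<open>A translation of the cut by \<alpha> becomes a translation by \<alpha>/p^l, which is
  available because the hull is divisible.\<close>

lemma cls_scale:
  assumes "cls D = cls D'"
  shows "cls (scale l D) = cls (scale l D')"
proof -
  obtain \<alpha> where \<alpha>: "\<alpha> \<in> \<Delta>" "D = (+) \<alpha> ` D'" using cls_eqD[OF assms] .
  obtain \<beta> where \<beta>: "\<beta> \<in> \<Delta>" "nmul (p ^ l) \<beta> = \<alpha>" using hull_divisible[OF \<alpha>(1), of "p ^ l"] by auto
  have "scale l D = (+) \<beta> ` scale l D'"
  proof
    show "scale l D \<subseteq> (+) \<beta> ` scale l D'"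
    proof
      fix x assume "x \<in> scale l D"
      then obtain d where x: "x \<in> \<Delta>" "d \<in> D'" "nmul (p ^ l) x = \<alpha> + d" using \<alpha>(2) by (auto simp: scale_def)
      then have "nmul (p ^ l) (x - \<beta>) = d" using \<beta>(2) by (simp add: nmul_diff)
      then have "x - \<beta> \<in> scale l D'" using x \<beta>(1) hull_diff by (simp add: scale_def)
      then show "x \<in> (+) \<beta> ` scale l D'" by (intro image_eqI[of _ _ "x - \<beta>"]) auto
    qed
    show "(+) \<beta> ` scale l D' \<subseteq> scale l D"
      using \<alpha>(2) \<beta> hull_add by (auto simp: scale_def nmul_add_right)
  qed
  then show ?thesis using cls_translate[OF \<beta>(1)] by simp
qed

lemma rootf_0: "rootf 0 = K"
  using K_closed by (auto simp: rootf_def)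

text \<open>The Frobenius power maps K^(1/p^l) onto K, so approximating \<open>w'\<close> from K
  amounts to approximating \<open>w\<close> from K^(1/p^l). By the choice of l the latter field does
  no better than K.\<close>

lemma close_root_distance:
  assumes a: "a \<in> carrier L" "a \<notin> K" "nomax (dvals K a)" and e: "e \<in> rootf t" "close a e"
  shows "\<exists>l<t. \<exists>w\<in>wimm. down (dvals K a) = scale l (down (dvals K w))"
proof -
  let ?S = "dvals K a"
  have eL: "e \<in> carrier L" using e by (simp add: rootf_def)
  have Se: "dvals K e = ?S" and eK: "e \<notin> K" using close_dvals[OF a(1,2) eL e(2)] by auto
  \<comment> \<open>False at 0 since e is not in K, and true at t with e itself; l is the exponent
    just before it first becomes true.\<close>
  define beyond where "beyond = (\<lambda>l. \<exists>y\<in>rootf l. \<forall>s\<in>?S. Fin s < v (e \<ominus> y))"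
  have "beyond t" unfolding beyond_def using e(1) eL by (intro bexI[of _ e]) auto
  moreover have "\<not> beyond 0"
  proof
    assume "beyond 0"
    then obtain y where y: "y \<in> K" "\<forall>s\<in>?S. Fin s < v (e \<ominus> y)" by (auto simp: beyond_def rootf_0)
    obtain s where "s \<in> ?S" "v (y \<ominus> e) = Fin s" using dvals_FinE[OF eL eK y(1)] Se by metis
    then show False using y v_diff_commute[OF eL K_closed[OF y(1)]] by auto
  qed
  ultimately obtain l where l: "l < t" "\<not> beyond l" "beyond (Suc l)"
    using ex_least_nat_less[of beyond t] by auto
  obtain w where w: "w \<in> rootf (Suc l)" "\<And>s. s \<in> ?S \<Longrightarrow> Fin s < v (e \<ominus> w)" using l(3) by (auto simp: beyond_def)
  have wL: "w \<in> carrier L" using w by (simp add: rootf_def)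
  have bound: "\<exists>s\<in>?S. v (y \<ominus> w) \<le> Fin s \<and> v (y \<ominus> w) = v (y \<ominus> e)" if y: "y \<in> rootf l" for y
  proof -
    have yL: "y \<in> carrier L" using y by (simp add: rootf_def)
    obtain s where s: "s \<in> ?S" "v (e \<ominus> y) \<le> Fin s" using l(2) y by (auto simp: beyond_def not_less)
    have "v ((y \<ominus> e) \<oplus> (e \<ominus> w)) = v (y \<ominus> e)"
      using s w(2)[OF s(1)] v_diff_commute[OF eL yL] yL eL wL by (intro v_add_eq) auto
    moreover have "(y \<ominus> e) \<oplus> (e \<ominus> w) = y \<ominus> w" using yL eL wL by algebra
    ultimately show ?thesis using s v_diff_commute[OF eL yL] by auto
  qed
  define w' where "w' = w [^] (p ^ l)"
  have w'L: "w' \<in> carrier L" using wL by (simp add: w'_def)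
  have diff: "v (y [^] (p ^ l) \<ominus> w') = nmul (p ^ l) (v (y \<ominus> w))" if "y \<in> carrier L" for y
    using frobenius_power_diff[OF that wL, of l] v_pow[of "y \<ominus> w" "p ^ l"] that wL by (simp add: w'_def)
  have "w' [^] p = w [^] (p ^ Suc l)" using wL by (simp add: w'_def nat_pow_pow mult.commute)
  then have w'1: "w' \<in> rootf 1" using w w'L by (simp add: rootf_def)
  have w'K: "w' \<notin> K"
  proof
    assume "w' \<in> K"
    then have "w \<in> rootf l" using wL by (simp add: rootf_def w'_def)
    from bound[OF this] show False using wL by auto
  qed
  \<comment> \<open>Each c in K is the p^l-th power of some y in K^(1/p^l), and \<open>bound\<close>
    applies to y.\<close>
  have up: "\<exists>s\<in>?S. d \<le> nmul (p ^ l) s" if d: "d \<in> dvals K w'" for d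
  proof -
    obtain c where c: "c \<in> K" "v (c \<ominus> w') = Fin d" using d by (auto simp: dvals_def)
    obtain y where y: "y \<in> carrier L" "y [^] (p ^ l) = c" using exists_root_pow[OF c(1), of "p ^ l"] by auto
    then have "y \<in> rootf l" using c by (simp add: rootf_def)
    then obtain s where s: "s \<in> ?S" "v (y \<ominus> w) \<le> Fin s" using bound by blast
    have eq: "Fin d = nmul (p ^ l) (v (y \<ominus> w))" using diff[OF y(1)] y(2) c(2) by simp
    obtain g where g: "v (y \<ominus> w) = Fin g"
      using s(2) v_not_Minf[of "y \<ominus> w"] y wL by (cases "v (y \<ominus> w)") auto
    have "d \<le> nmul (p ^ l) s" using eq g s(2) nmul_mono by (auto simp: nmul_Fin)
    then show ?thesis using s by blast
  qed
  have low: "nmul (p ^ l) s \<in> dvals K w'" if s: "s \<in> ?S" for s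
  proof -
    obtain c where c: "c \<in> K" "v (c \<ominus> e) = Fin s" using s Se by (auto simp: dvals_def)
    have "c \<in> rootf l" using c K_closed K_pow by (simp add: rootf_def)
    then have "v (c \<ominus> w) = Fin s" using bound c(2) by auto
    then have "v (c [^] (p ^ l) \<ominus> w') = Fin (nmul (p ^ l) s)" using diff[OF K_closed[OF c(1)]] by (simp add: nmul_Fin)
    then show ?thesis using K_pow[OF c(1)] unfolding dvals_def by blast
  qed
  have "nomax (dvals K w')"
    unfolding nomax_def
  proof (intro conjI ballI)
    obtain s where "s \<in> ?S" using a(3) by (auto simp: nomax_def)
    then show "dvals K w' \<noteq> {}" using low by auto
    fix d assume "d \<in> dvals K w'"
    then obtain s where s: "s \<in> ?S" "d \<le> nmul (p ^ l) s" using up by blast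
    obtain s' where s': "s' \<in> ?S" "s < s'" using a(3) s by (auto simp: nomax_def)
    have "nmul (p ^ l) s < nmul (p ^ l) s'" using s' by (intro nmul_strict_mono) auto
    then show "\<exists>d'\<in>dvals K w'. d < d'" using s low[OF s'(1)] by (meson order_le_less_trans)
  qed
  then have w'w: "w' \<in> wimm" using w'1 w'K by (simp add: wimm_def)
  have "down ?S = scale l (down (dvals K w'))"
  proof
    show "down ?S \<subseteq> scale l (down (dvals K w'))"
    proof
      fix x assume "x \<in> down ?S"
      then obtain s where s: "x \<in> \<Delta>" "s \<in> ?S" "x \<le> s" by (auto simp: down_def)
      then have "nmul (p ^ l) x \<le> nmul (p ^ l) s" by (intro nmul_mono)
      then show "x \<in> scale l (down (dvals K w'))" using s low hull_nmul by (auto simp: scale_def down_def)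
    qed
    show "scale l (down (dvals K w')) \<subseteq> down ?S"
    proof
      fix x assume "x \<in> scale l (down (dvals K w'))"
      then obtain d where d: "x \<in> \<Delta>" "d \<in> dvals K w'" "nmul (p ^ l) x \<le> d" by (auto simp: scale_def down_def)
      then obtain s where s: "s \<in> ?S" "d \<le> nmul (p ^ l) s" using up by blast
      then have "nmul (p ^ l) x \<le> nmul (p ^ l) s" using d by simp
      then have "x \<le> s" by (simp add: nmul_le_iff)
      then show "x \<in> down ?S" using d s by (auto simp: down_def)
    qed
  qed
  then show ?thesis using l w'w by blast
qed

lemma ndd_bound:
  assumes rank: "has_finite_rank v K r" and fin: "finite_p_degree L K p"
    and d: "defect L v K (root_field L K p) = of_nat (p ^ m)"
  shows "finite (ndd_classes L v K p i) \<and> ndd L v K p i \<le> r + i * m"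
proof -
  let ?C = "(\<lambda>w. cls (down (dvals K w))) ` wimm"
  let ?P = "proper_convex_subgroups vK"
  have C: "finite ?C" "card ?C \<le> m"
    using card_wimm_classes[of m] fin d by (auto simp: finite_p_degree_def root_field_eq)
  have P: "finite ?P" "card ?P = r" using rank by (auto simp: has_finite_rank_def)
  \<comment> \<open>The operation \<open>scale\<close> on classes, through a chosen representative;
    \<open>cls_scale\<close> makes it independent of the choice.\<close>
  define sc where "sc = (\<lambda>(l, Y). cls (scale l (SOME D. cls D = Y)))"
  have sc: "sc (l, cls D) = cls (scale l D)" for l D
  proof -
    have "cls (SOME D'. cls D' = cls D) = cls D" by (rule someI) (rule refl)
    then have "cls (scale l (SOME D'. cls D' = cls D)) = cls (scale l D)" by (rule cls_scale)
    then show ?thesis by (simp only: sc_def prod.case)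
  qed
  let ?U = "(\<lambda>H. cls (below H)) ` ?P \<union> sc ` ({..<i} \<times> ?C)"
  have "ndd_classes L v K p i \<subseteq> ?U"
  proof
    fix Y assume "Y \<in> ndd_classes L v K p i"
    then obtain D where D: "D \<in> ndd_distances L v K p i" "Y = cls D"
      by (auto simp: ndd_classes_def quotient_def cls_def)
    then obtain a where a: "D = distance L v K a" "a \<in> carrier L" "a \<notin> K"
      "extension_degree L K (adjoin L K a) \<le> p ^ i" "uv_extension L v K (adjoin L K a)" "weakly_immediate L v K a"
      by (auto simp: ndd_distances_def)
    have nm: "nomax (dvals K a)" using weakly_immediate_iff a by simp
    have Y: "Y = cls (down (dvals K a))" using D(2) a(1) distance_eq[OF a(2,3) nm] by simp
    have "degree (Irr K a) \<le> p ^ i" using a(4) degree_adjoin[OF a(2)] by simp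
    then consider H where "H \<in> ?P" "cls (down (dvals K a)) = cls (below H)"
      | t e where "t \<le> i" "e \<in> rootf t" "close a e"
      using distance_alternatives[OF a(2,3) nm a(5)] by blast
    then show "Y \<in> ?U"
    proof cases
      case 1
      then show ?thesis using Y by blast
    next
      case 2
      obtain l w where lw: "l < t" "w \<in> wimm" "down (dvals K a) = scale l (down (dvals K w))"
        using close_root_distance[OF a(2,3) nm 2(2,3)] by blast
      then have "Y = sc (l, cls (down (dvals K w)))" using Y sc by simp
      moreover have "(l, cls (down (dvals K w))) \<in> {..<i} \<times> ?C" using lw 2(1) by auto
      ultimately show ?thesis by blast
    qed
  qed
  moreover have "finite ?U" using C P by auto
  moreover have "card ?U \<le> r + i * m"
  proof -
    have "card ?U \<le> card ((\<lambda>H. cls (below H)) ` ?P) + card (sc ` ({..<i} \<times> ?C))" by (rule card_Un_le)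
    also have "\<dots> \<le> card ?P + card ({..<i} \<times> ?C)"
      using C P by (intro add_mono card_image_le) auto
    also have "\<dots> \<le> r + i * m" using C P by (simp add: card_cartesian_product)
    finally show ?thesis .
  qed
  ultimately show ?thesis unfolding ndd_def by (meson card_mono finite_subset le_trans)
qed

end

section \<open>Primality of the characteristic and the theorem\<close>

lemma char_prime:
  fixes L (structure)
  assumes "field L" and K: "subfield K L" and p: "ring_char (L\<lparr>carrier := K\<rparr>) = p" "p > 0"
  shows "Factorial_Ring.prime p" "add_pow L p \<one> = \<zero>"
proof -
  interpret field L by fact
  interpret F: field "L\<lparr>carrier := K\<rparr>" using subfield_iff(2)[OF K] .
  have one: "\<one> \<in> K" using subringE(3)[OF subfieldE(1)[OF K]] .
  have pow: "add_pow (L\<lparr>carrier := K\<rparr>) n \<one> = nmult n \<one>" for n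
    unfolding add_pow_def using nat_pow_def by (simp add: nat_pow_def)
  \<comment> \<open>The characteristic is the additive order of 1 in K, so it divides exactly the
    integers that vanish in L. Primality then follows because L has no zero divisors.\<close>
  have iff: "nmult n \<one> = \<zero> \<longleftrightarrow> p dvd n" for n
    using F.add.pow_eq_id[of \<one> n] one p(1) pow by (simp add: ring_char_def add_pow_def)
  show "add_pow L p \<one> = \<zero>" using iff by simp
  have "p \<noteq> 1" using iff[of 1] by auto
  moreover have "m = 1 \<or> m = p" if m: "m dvd p" for m
  proof -
    obtain k where k: "p = m * k" using m by blast
    have "nmult m \<one> \<otimes> nmult k \<one> = nmult (m * k) \<one>"
      by (simp add: add_pow_ldistr add_pow_rdistr add.nat_pow_pow mult.commute)
    then have "nmult m \<one> \<otimes> nmult k \<one> = \<zero>" using iff[of "m * k"] k by simp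
    then have "nmult m \<one> = \<zero> \<or> nmult k \<one> = \<zero>" using integral by simp
    then have "p dvd m \<or> p dvd k" using iff by simp
    then show ?thesis
    proof
      assume "p dvd m"
      then show ?thesis using m dvd_antisym by blast
    next
      assume "p dvd k"
      then have "k = p" using k by (metis dvd_antisym dvd_triv_right)
      then show ?thesis using k p(2) by simp
    qed
  qed
  ultimately show "Factorial_Ring.prime p" using p(2) unfolding prime_nat_iff by auto
qed

theorem theorem24:
  fixes L :: "('a, 'b) ring_scheme"
    and K :: "'a set"
    and v :: "'a \<Rightarrow> 'g :: linordered_ab_group_add extended"
    and p r m i :: nat
  assumes "algebraic_closure L K"
    and "valuation_on L (carrier L) v"
    and "ring_char (L\<lparr>carrier := K\<rparr>) = p" and "p > 0"
    and "has_finite_rank v K r"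
    and "finite_p_degree L K p"
    and "defect L v K (root_field L K p) = of_nat (p ^ m)"
  shows "finite (ndd_classes L v K p i) \<and> ndd L v K p i \<le> r + i * m"
proof -
  interpret A: algebraic_closure L K by fact
  have K: "subfield K L" by (rule A.subfield_axioms)
  have p: "Factorial_Ring.prime p" "add_pow L p \<one>\<^bsub>L\<^esub> = \<zero>\<^bsub>L\<^esub>"
    using char_prime[OF A.field_axioms K assms(3,4)] by auto
  interpret valued_closure L v p K
    by (intro valued_closure.intro valued_subfield_p.intro valued_field_p.intro valued_field.intro
        valued_field_axioms.intro valued_field_p_axioms.intro valued_subfield_p_axioms.intro
        A.field_axioms assms(1,2) K p)
  show ?thesis using ndd_bound[OF assms(5-7)] .
qed

end
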